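(* Let $1\le r_0\le n$ and $j_0\ge r_0$, and suppose that $\lambda_{j_0-(r_0-1)}(\Lambda_D)=\cdots=\lambda_{j_0}(\Lambda_D)$ is an eigenvalue of $\mathcal A_{\Lambda_D}$ of multiplicity $r_0$. Then for every $r$ with $2n-r_0+1\le r\le 2n$ and every $\Lambda\in\Sigma_r$, one has $\lambda_{j_0}(\Lambda)=\lambda_{j_0}(\Lambda_D)$.
   Context: Setting. Let $n\ge1$, $T>0$, $P,Q\in H^1([0,T],L(n))$, $R\in C([0,T],L(n))$, where $L(n)$ is the set of real $n\times n$ matrices; $P(t),R(t)$ are symmetric and $P(t)$ is positive definite for all $t\in[0,T]$. For $x:[0,T]\to\mathbf C^n$ put $y=P\dot x+Qx$ and $z=(y^T,x^T)^T$. Let $\mathcal Ax=-\frac{d}{dt}(P\dot x+Qx)+Q^T\dot x+Rx$. Let $J_n=\begin{bmatrix}0&-I_n\\ I_n&0\end{bmatrix}$, $\omega_n(u,v)=\langle J_nu,v\rangle$ on $\mathbf C^{2n}$ (standard Hermitian product), and $(\mathcal V,\Omega)=(\mathbf C^{2n}\oplus\mathbf C^{2n},-\omega_n\oplus\omega_n)$. $\mathrm{Lag}(\mathcal V,\Omega)$ is the set of complex subspaces $\Lambda\subset\mathcal V$ with $\Omega|_\Lambda=0$ and $\dim_{\mathbf C}\Lambda=2n$. Vectors of $\mathcal V$ are written $(z(0),z(T))$ with $z(0)=(y(0),x(0))$, $z(T)=(y(T),x(T))$; the Dirichlet condition is $\Lambda_D=\{x(0)=x(T)=0\}$. For $\Lambda\in\mathrm{Lag}(\mathcal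 V,\Omega)$, $\mathcal A_\Lambda$ is the self-adjoint operator on $L^2([0,T],\mathbf C^n)$ acting as $\mathcal A$ with domain $\{x\in H^2([0,T],\mathbf C^n):(z(0),z(T))\in\Lambda\}$. Its spectrum is bounded below and consists of discrete eigenvalues, $\lambda_1(\Lambda)\le\lambda_2(\Lambda)\le\cdots$, counted with multiplicity. For $0\le r\le2n$, the $r$-th layer is $\Sigma_r=\{\Lambda\in\mathrm{Lag}(\mathcal V,\Omega):\dim(\Lambda\cap\Lambda_D)=r\}$. *)

theory Defs
  imports "HOL-Analysis.Analysis" "HOL-Library.Function_Algebras"
begin

section \<open>Sobolev functions on \<open>[0,T]\<close>\<close>

definition L2_on :: "real \<Rightarrow> (real \<Rightarrow> 'a::euclidean_space) \<Rightarrow> bool" where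
  "L2_on T f \<longleftrightarrow> f \<in> borel_measurable (lebesgue_on {0..T}) \<and>
     integrable (lebesgue_on {0..T}) (\<lambda>t. (norm (f t))\<^sup>2)"

text \<open>In dimension one, \<open>g \<in> L\<^sup>1\<close> is the distributional derivative of (the continuous
  representative of) \<open>f\<close> exactly if \<open>f\<close> is the indefinite integral of \<open>g\<close>. We always work with
  the continuous representative, so that boundary values make sense.\<close>

definition weak_derivative_on :: "real \<Rightarrow> (real \<Rightarrow> 'a::euclidean_space) \<Rightarrow> (real \<Rightarrow> 'a) \<Rightarrow> bool" where
  "weak_derivative_on T f g \<longleftrightarrow> (\<forall>t\<in>{0..T}. (g has_integral (f t - f 0)) {0..t})"

definition H1_on :: "real \<Rightarrow> (real \<Rightarrow> 'a::euclidean_space) \<Rightarrow> bool" where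
  "H1_on T f \<longleftrightarrow> (\<exists>g. L2_on T g \<and> weak_derivative_on T f g)"

definition H2_on :: "real \<Rightarrow> (real \<Rightarrow> 'a::euclidean_space) \<Rightarrow> bool" where
  "H2_on T f \<longleftrightarrow> (\<exists>g. H1_on T g \<and> weak_derivative_on T f g)"

text \<open>The \<open>L\<^sup>2\<close> derivative of an \<open>H\<^sup>1\<close> function; it is determined only almost everywhere.\<close>

definition weak_deriv :: "real \<Rightarrow> (real \<Rightarrow> 'a::euclidean_space) \<Rightarrow> real \<Rightarrow> 'a" where
  "weak_deriv T f = (SOME g. L2_on T g \<and> weak_derivative_on T f g)"

section \<open>The differential expression\<close>

abbreviation cmat :: "real^'n^'m \<Rightarrow> complex^'n^'m" where
  "cmat \<equiv> map_matrix complex_of_real"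

text \<open>The derivative of an \<open>H\<^sup>2\<close> function is continuous, so it is taken in the classical
  sense at every point, one-sided at the end points.\<close>

definition dot :: "real \<Rightarrow> (real \<Rightarrow> complex^'n) \<Rightarrow> real \<Rightarrow> complex^'n" where
  "dot T x t = vector_derivative x (at t within {0..T})"

definition quasi_deriv ::
  "real \<Rightarrow> (real \<Rightarrow> real^'n^'n) \<Rightarrow> (real \<Rightarrow> real^'n^'n) \<Rightarrow> (real \<Rightarrow> complex^'n) \<Rightarrow> real \<Rightarrow> complex^'n" where
  "quasi_deriv T P Q x t = cmat (P t) *v dot T x t + cmat (Q t) *v x t"

definition SL_op ::
  "real \<Rightarrow> (real \<Rightarrow> real^'n^'n) \<Rightarrow> (real \<Rightarrow> real^'n^'n) \<Rightarrow> (real \<Rightarrow> real^'n^'n) \<Rightarrow>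
   (real \<Rightarrow> complex^'n) \<Rightarrow> real \<Rightarrow> complex^'n" where
  "SL_op T P Q R x t = - weak_deriv T (quasi_deriv T P Q x) t
     + cmat (transpose (Q t)) *v dot T x t + cmat (R t) *v x t"

section \<open>Lagrangian boundary conditions\<close>

text \<open>\<open>\<complex>\<^sup>2\<^sup>n\<close> is \<open>complex^('n + 'n)\<close> and the boundary space is
  \<open>complex^(('n + 'n) + ('n + 'n))\<close>; \<open>vjoin\<close> stacks two vectors, the first one on top.\<close>

definition vjoin :: "'a^'m \<Rightarrow> 'a^'n \<Rightarrow> 'a^('m::finite + 'n::finite)" where
  "vjoin u v = (\<chi> i. case i of Inl k \<Rightarrow> u $ k | Inr k \<Rightarrow> v $ k)"

definition vtop :: "'a^('m::finite + 'n::finite) \<Rightarrow> 'a^'m" where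
  "vtop w = (\<chi> k. w $ Inl k)"

definition vbot :: "'a^('m::finite + 'n::finite) \<Rightarrow> 'a^'n" where
  "vbot w = (\<chi> k. w $ Inr k)"

definition hermitian_inner :: "complex^'m \<Rightarrow> complex^'m \<Rightarrow> complex" where
  "hermitian_inner u v = (\<Sum>i\<in>UNIV. u $ i * cnj (v $ i))"

definition J_mat :: "complex^('n::finite + 'n)^('n + 'n)" where
  "J_mat = (\<chi> i j. case (i, j) of
      (Inl k, Inr l) \<Rightarrow> if k = l then - 1 else 0
    | (Inr k, Inl l) \<Rightarrow> if k = l then 1 else 0
    | _ \<Rightarrow> 0)"

definition omega :: "complex^('n::finite + 'n) \<Rightarrow> complex^('n + 'n) \<Rightarrow> complex" where
  "omega u v = hermitian_inner (J_mat *v u) v"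

type_synonym 'n bspace = "(complex, ('n + 'n) + ('n + 'n)) vec"

definition Omega :: "'n::finite bspace \<Rightarrow> 'n bspace \<Rightarrow> complex" where
  "Omega u v = - omega (vtop u) (vtop v) + omega (vbot u) (vbot v)"

definition Lag :: "'n::finite bspace set set" where
  "Lag = {\<Lambda>. vec.subspace \<Lambda> \<and> (\<forall>u\<in>\<Lambda>. \<forall>v\<in>\<Lambda>. Omega u v = 0) \<and> vec.dim \<Lambda> = 2 * CARD('n)}"

text \<open>Boundary vectors are \<open>((y(0), x(0)), (y(T), x(T)))\<close>.\<close>

definition Dirichlet :: "'n::finite bspace set" where
  "Dirichlet = {w. vbot (vtop w) = 0 \<and> vbot (vbot w) = 0}"

definition layer :: "nat \<Rightarrow> 'n::finite bspace set set" where
  "layer r = {\<Lambda> \<in> Lag. vec.dim (\<Lambda> \<inter> Dirichlet) = r}"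

definition boundary_vec ::
  "real \<Rightarrow> (real \<Rightarrow> real^'n^'n) \<Rightarrow> (real \<Rightarrow> real^'n^'n) \<Rightarrow> (real \<Rightarrow> complex^'n) \<Rightarrow> 'n::finite bspace" where
  "boundary_vec T P Q x =
     vjoin (vjoin (quasi_deriv T P Q x 0) (x 0)) (vjoin (quasi_deriv T P Q x T) (x T))"

section \<open>Eigenvalues\<close>

text \<open>A function on \<open>[0,T]\<close> is represented by its extension by zero to the real line, so that
  dimensions of spaces of such functions are not affected by values outside \<open>[0,T]\<close>.\<close>

definition SL_dom ::
  "real \<Rightarrow> (real \<Rightarrow> real^'n^'n) \<Rightarrow> (real \<Rightarrow> real^'n^'n) \<Rightarrow> 'n::finite bspace set \<Rightarrow>
   (real \<Rightarrow> complex^'n) set" where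
  "SL_dom T P Q \<Lambda> = {x. H2_on T x \<and> (\<forall>t. t \<notin> {0..T} \<longrightarrow> x t = 0) \<and> boundary_vec T P Q x \<in> \<Lambda>}"

definition eigenspace ::
  "real \<Rightarrow> (real \<Rightarrow> real^'n^'n) \<Rightarrow> (real \<Rightarrow> real^'n^'n) \<Rightarrow> (real \<Rightarrow> real^'n^'n) \<Rightarrow> 'n::finite bspace set \<Rightarrow>
   real \<Rightarrow> (real \<Rightarrow> complex^'n) set" where
  "eigenspace T P Q R \<Lambda> \<mu> = {x \<in> SL_dom T P Q \<Lambda>.
     AE t in lebesgue_on {0..T}. SL_op T P Q R x t = complex_of_real \<mu> *s x t}"

interpretation cfun: vector_space "\<lambda>(c::complex) (f::real \<Rightarrow> complex^'n) t. c *s f t"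
  by unfold_locales (auto simp: fun_eq_iff vec_eq_iff algebra_simps)

text \<open>Geometric multiplicity over the complex numbers. The operators are self-adjoint, so their
  eigenvalues are real and geometric and algebraic multiplicities agree. The multiplicity is 0 if
  \<open>\<mu>\<close> is not an eigenvalue.\<close>

definition eig_mult ::
  "real \<Rightarrow> (real \<Rightarrow> real^'n^'n) \<Rightarrow> (real \<Rightarrow> real^'n^'n) \<Rightarrow> (real \<Rightarrow> real^'n^'n) \<Rightarrow> 'n::finite bspace set \<Rightarrow>
   real \<Rightarrow> nat" where
  "eig_mult T P Q R \<Lambda> \<mu> = cfun.dim (eigenspace T P Q R \<Lambda> \<mu>)"

text \<open>The \<open>k\<close>-th eigenvalue, \<open>k \<ge> 1\<close>, in increasing order and counted with multiplicity: the
  least \<open>\<mu>\<close> such that the eigenvalues up to \<open>\<mu>\<close> have total multiplicity at least \<open>k\<close>.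
  The lemma below shows that this is the \<open>k\<close>-th term of the nondecreasing enumeration of
  the eigenvalues.\<close>

definition eigval ::
  "real \<Rightarrow> (real \<Rightarrow> real^'n^'n) \<Rightarrow> (real \<Rightarrow> real^'n^'n) \<Rightarrow> (real \<Rightarrow> real^'n^'n) \<Rightarrow> 'n::finite bspace set \<Rightarrow>
   nat \<Rightarrow> real" where
  "eigval T P Q R \<Lambda> k =
     Inf {\<mu>. \<exists>F. finite F \<and> F \<subseteq> {..\<mu>} \<and> k \<le> (\<Sum>\<nu>\<in>F. eig_mult T P Q R \<Lambda> \<nu>)}"

lemma eigval_eq_enumeration:
  fixes lam :: "nat \<Rightarrow> real"
  assumes mono: "\<And>i j. 1 \<le> i \<Longrightarrow> i \<le> j \<Longrightarrow> lam i \<le> lam j"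
    and fin: "\<And>\<mu>. finite {k. 1 \<le> k \<and> lam k = \<mu>}"
    and card: "\<And>\<mu>. card {k. 1 \<le> k \<and> lam k = \<mu>} = eig_mult T P Q R \<Lambda> \<mu>"
    and k: "1 \<le> k"
  shows "eigval T P Q R \<Lambda> k = lam k"
proof -
  have sum: "(\<Sum>\<nu>\<in>F. eig_mult T P Q R \<Lambda> \<nu>) = card {i. 1 \<le> i \<and> lam i \<in> F}" if "finite F" for F
  proof -
    have "{i. 1 \<le> i \<and> lam i \<in> F} = (\<Union>\<nu>\<in>F. {i. 1 \<le> i \<and> lam i = \<nu>})"
      by auto
    then have "card {i. 1 \<le> i \<and> lam i \<in> F} = (\<Sum>\<nu>\<in>F. card {i. 1 \<le> i \<and> lam i = \<nu>})"
      using that fin by (simp only:) (rule card_UN_disjoint, auto)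
    then show ?thesis
      by (simp only: card)
  qed
  have finF: "finite {i. 1 \<le> i \<and> lam i \<in> F}" if "finite F" for F
  proof -
    have "{i. 1 \<le> i \<and> lam i \<in> F} = (\<Union>\<nu>\<in>F. {i. 1 \<le> i \<and> lam i = \<nu>})"
      by auto
    then show ?thesis
      using that fin by (simp only:) blast
  qed
  show ?thesis
    unfolding eigval_def
  proof (rule cInf_eq_minimum)
    have "card {1..k} \<le> card {i. 1 \<le> i \<and> lam i \<in> lam ` {1..k}}"
      by (rule card_mono, rule finF) auto
    then have "k \<le> (\<Sum>\<nu>\<in>lam ` {1..k}. eig_mult T P Q R \<Lambda> \<nu>)"
      by (subst sum) simp_all
    moreover have "lam ` {1..k} \<subseteq> {..lam k}"
      by (auto intro: mono)
    ultimately show "lam k \<in> {\<mu>. \<exists>F. finite F \<and> F \<subseteq> {..\<mu>} \<and> k \<le> (\<Sum>\<nu>\<in>F. eig_mult T P Q R \<Lambda> \<nu>)}"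
      by blast
  next
    fix \<mu> assume "\<mu> \<in> {\<mu>. \<exists>F. finite F \<and> F \<subseteq> {..\<mu>} \<and> k \<le> (\<Sum>\<nu>\<in>F. eig_mult T P Q R \<Lambda> \<nu>)}"
    then obtain F where F: "finite F" "F \<subseteq> {..\<mu>}" "k \<le> card {i. 1 \<le> i \<and> lam i \<in> F}"
      unfolding mem_Collect_eq using sum by metis
    show "lam k \<le> \<mu>"
    proof (rule ccontr)
      assume less: "\<not> lam k \<le> \<mu>"
      have "{i. 1 \<le> i \<and> lam i \<in> F} \<subseteq> {1..<k}"
      proof
        fix i assume i: "i \<in> {i. 1 \<le> i \<and> lam i \<in> F}"
        then have "lam i \<le> \<mu>"
          using F(2) by auto
        then have "\<not> k \<le> i"
          using less mono[OF k, of i] by auto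
        then show "i \<in> {1..<k}"
          using i by auto
      qed
      then have "card {i. 1 \<le> i \<and> lam i \<in> F} \<le> card {1..<k}"
        by (rule card_mono[rotated]) simp
      then show False
        using F(3) k by simp
    qed
  qed
qed

end

theory Submission
  imports Defs
begin

text \<open>
  Both inequalities \<open>\<lambda>\<^sub>j(\<Lambda>) \<le> \<lambda>\<^sub>j(\<Lambda>\<^sub>D)\<close> and \<open>\<lambda>\<^sub>i(\<Lambda>\<^sub>D) \<le> \<lambda>\<^sub>i\<^sub>+\<^sub>k(\<Lambda>)\<close>, \<open>k = 2n - r\<close>, follow from a
  variational count: if the energy form of \<open>\<Lambda>\<close>, shifted by \<open>\<mu>\<close>, is nonpositive on a subspace of
  dimension \<open>d\<close>, then the eigenvalues up to \<open>\<mu>\<close> have total multiplicity at least \<open>d\<close>. The form domain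
  of \<open>\<Lambda>\<^sub>D\<close> is contained in that of \<open>\<Lambda>\<close> with codimension \<open>k\<close>, and the forms agree there. If
  \<open>k < r\<^sub>0\<close>, the eigenvalue \<open>\<lambda>\<^sub>j(\<Lambda>)\<close>, \<open>j = j\<^sub>0\<close>, is squeezed between two equal Dirichlet eigenvalues.

  The count is reduced to finite dimensions as in Morse theory. On a partition so fine that the
  Dirichlet forms of the pieces are positive, functions are replaced by broken extremals, which
  are determined by their values at the nodes and minimize the form. This gives Hermitian forms
  \<open>H\<^sub>\<lambda>\<close> on a fixed space of node values. They are continuous in \<open>\<lambda>\<close>, positive for very negative
  \<open>\<lambda>\<close>, and their kernels are the eigenspaces; so the nonpositive index at \<open>\<mu>\<close> can only be built
  up by kernels at parameters up to \<open>\<mu>\<close>.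
\<close>


section \<open>Hermitian forms on finite-dimensional spaces\<close>

text \<open>A Lagrangian condition couples momenta y and values x at the ends, while a quadratic
  form sees only x. So \<Lambda> is split. Its projection to (x(0), x(T)) restricts the form domain;
  a linear choice of momenta over this projection supplies a Hermitian boundary term; what remains
  of the condition comes back as the natural boundary condition of the form. Maximal isotropy
  guarantees that nothing is lost. The kernel of the projection is the intersection with the
  Dirichlet space, whence the codimension 2n - r.

  Since P and Q are only H^1, the variational work is done for the first-order system in (x, y),
  whose coefficients are continuous: along solutions y is C^1, while x need not be C^2. Sobolev
  regularity enters when eigenspaces are identified with solutions of this system.

  The eigenvalues are infima of counting sets, so the two counts are applied as inclusions of such
  sets. The Dirichlet sets are shown to be nonempty and bounded below, and those of \<Lambda>
  inherit this by lying between two of them.\<close>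

locale complex_space = vector_space scale
  for scale :: "complex \<Rightarrow> 'b::ab_group_add \<Rightarrow> 'b" (infixr "\<cdot>" 75)
begin

text \<open>Finiteness is part of the notion: \<open>dim\<close> is a cardinality and hence 0 for an
  infinite basis, so a bound on \<open>dim\<close> would not express finite dimension.\<close>

definition rank_le :: "'b set \<Rightarrow> nat \<Rightarrow> bool" where
  "rank_le V n \<longleftrightarrow> (\<forall>B\<subseteq>V. independent B \<longrightarrow> finite B \<and> card B \<le> n)"

lemma rank_leD: "rank_le V n \<Longrightarrow> B \<subseteq> V \<Longrightarrow> independent B \<Longrightarrow> finite B \<and> card B \<le> n"
  by (auto simp: rank_le_def)

lemma rank_le_span: "finite A \<Longrightarrow> V \<subseteq> span A \<Longrightarrow> rank_le V (card A)"
  unfolding rank_le_def by (meson independent_span_bound subset_trans)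

lemma basis_of_rank_le:
  assumes "rank_le V n"
  obtains B where "B \<subseteq> V" "independent B" "V \<subseteq> span B" "finite B" "card B \<le> n"
  using maximal_independent_subset[of V] rank_leD[OF assms] by metis

lemma card_le_dim:
  assumes "rank_le V n" "B \<subseteq> V" "independent B"
  shows "card B \<le> dim V"
proof -
  obtain C where C: "C \<subseteq> V" "independent C" "V \<subseteq> span C" "finite C"
    by (rule basis_of_rank_le[OF assms(1)])
  then have "card B \<le> card C"
    using independent_span_bound[of C B] assms(2,3) by auto
  then show ?thesis
    using basis_card_eq_dim[OF C(1,3,2)] by simp
qed

lemma independent_Un_disjoint_span:
  assumes A: "independent A" and C: "independent C" "finite C" and AC: "span A \<inter> span C = {0}"
  shows "independent (A \<union> C) \<and> A \<inter> C = {}"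
proof
  show "A \<inter> C = {}"
  proof (rule ccontr)
    assume "A \<inter> C \<noteq> {}"
    then obtain x where "x \<in> A" "x \<in> C" by auto
    then have "x = 0" using AC span_base by blast
    with \<open>x \<in> A\<close> A show False using dependent_zero by blast
  qed
  have "independent (A \<union> D)" if "D \<subseteq> C" for D
    using finite_subset[OF that C(2)] that
  proof (induction D rule: finite_induct)
    case empty
    then show ?case using A by simp
  next
    case (insert c D)
    have "c \<notin> span (A \<union> D)"
    proof
      assume "c \<in> span (A \<union> D)"
      then obtain a d where ad: "c = a + d" "a \<in> span A" "d \<in> span D"
        unfolding span_Un by auto
      have "d \<in> span C" using ad(3) insert.prems span_mono by blast
      then have "a \<in> span C" using ad(1) insert.prems span_base[of c C] span_diff[of c C d] by auto
      then have "a = 0" using ad(2) AC by auto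
      then have "c \<in> span D" using ad by simp
      then have "dependent (insert c D)"
        using insert.hyps unfolding dependent_def by (metis Diff_insert_absorb insertI1)
      then show False using C(1) dependent_mono insert.prems by blast
    qed
    then show ?case
      using insert by (simp add: independent_insertI)
  qed
  then show "independent (A \<union> C)" by blast
qed

text \<open>Relative to \<open>V\<close>, because the energy forms are symmetric only on functions
  whose end values satisfy the boundary condition. Conjugate linearity in the second argument
  follows from the symmetry.\<close>

definition hermitian_on :: "'b set \<Rightarrow> ('b \<Rightarrow> 'b \<Rightarrow> complex) \<Rightarrow> bool" where
  "hermitian_on V h \<longleftrightarrow>
     (\<forall>u\<in>V. \<forall>v\<in>V. \<forall>w\<in>V. h (u + v) w = h u w + h v w) \<and>
     (\<forall>c. \<forall>u\<in>V. \<forall>v\<in>V. h (c \<cdot> u) v = c * h u v) \<and>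
     (\<forall>u\<in>V. \<forall>v\<in>V. h v u = cnj (h u v))"

context
  fixes V h
  assumes V: "subspace V" and h: "hermitian_on V h"
begin

lemma herm_add: "u \<in> V \<Longrightarrow> v \<in> V \<Longrightarrow> w \<in> V \<Longrightarrow> h (u + v) w = h u w + h v w"
  and herm_scale: "u \<in> V \<Longrightarrow> v \<in> V \<Longrightarrow> h (c \<cdot> u) v = c * h u v"
  and herm_sym: "u \<in> V \<Longrightarrow> v \<in> V \<Longrightarrow> h v u = cnj (h u v)"
  using h unfolding hermitian_on_def by blast+

lemma herm_add_right: "u \<in> V \<Longrightarrow> v \<in> V \<Longrightarrow> w \<in> V \<Longrightarrow> h w (u + v) = h w u + h w v"
  by (metis V complex_cnj_add herm_add herm_sym subspace_add)

lemma herm_scale_right: "u \<in> V \<Longrightarrow> v \<in> V \<Longrightarrow> h u (c \<cdot> v) = cnj c * h u v"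
  by (metis V complex_cnj_mult herm_scale herm_sym subspace_scale)

lemma herm_zero: "u \<in> V \<Longrightarrow> h 0 u = 0"
  using herm_scale[of 0 u 0] subspace_0[OF V] by simp

lemma herm_zero_right: "u \<in> V \<Longrightarrow> h u 0 = 0"
  using herm_zero herm_sym[of 0 u] subspace_0[OF V] by simp

lemma herm_diff: "u \<in> V \<Longrightarrow> v \<in> V \<Longrightarrow> w \<in> V \<Longrightarrow> h (u - v) w = h u w - h v w"
  using herm_add[of u "- v" w] herm_scale[of v w "-1"] subspace_neg[OF V, of v] by simp

lemma herm_sum: "finite B \<Longrightarrow> (\<And>b. b \<in> B \<Longrightarrow> f b \<in> V) \<Longrightarrow> w \<in> V \<Longrightarrow> h (sum f B) w = (\<Sum>b\<in>B. h (f b) w)"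
  by (induction B rule: finite_induct) (auto simp: herm_add herm_zero subspace_sum[OF V])

lemma herm_sum_right: "finite B \<Longrightarrow> (\<And>b. b \<in> B \<Longrightarrow> f b \<in> V) \<Longrightarrow> w \<in> V \<Longrightarrow> h w (sum f B) = (\<Sum>b\<in>B. h w (f b))"
  by (induction B rule: finite_induct) (auto simp: herm_add_right herm_zero_right subspace_sum[OF V])

lemma herm_sum_both:
  assumes "finite B" "B \<subseteq> V"
  shows "h (\<Sum>b\<in>B. c b \<cdot> b) (\<Sum>b\<in>B. c b \<cdot> b) = (\<Sum>a\<in>B. \<Sum>b\<in>B. c a * cnj (c b) * h a b)"
proof -
  have "(\<Sum>b\<in>B. c b \<cdot> b) \<in> V" by (meson V assms(2) subsetD subspace_scale subspace_sum)
  then have "h (\<Sum>b\<in>B. c b \<cdot> b) (\<Sum>b\<in>B. c b \<cdot> b) = (\<Sum>a\<in>B. h (c a \<cdot> a) (\<Sum>b\<in>B. c b \<cdot> b))"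
    using assms by (intro herm_sum) (auto intro: subspace_scale[OF V])
  also have "\<dots> = (\<Sum>a\<in>B. \<Sum>b\<in>B. h (c a \<cdot> a) (c b \<cdot> b))"
    using assms by (intro sum.cong refl herm_sum_right) (auto intro: subspace_scale[OF V])
  also have "\<dots> = (\<Sum>a\<in>B. \<Sum>b\<in>B. c a * cnj (c b) * h a b)"
    using assms by (intro sum.cong refl) (simp add: herm_scale herm_scale_right subspace_scale[OF V] subset_iff)
  finally show ?thesis .
qed

lemma herm_real: "u \<in> V \<Longrightarrow> h u u = of_real (Re (h u u))"
  using herm_sym[of u u] by (metis Reals_cnj_iff complex_is_Real_iff of_real_Re)

text \<open>Serves to pass from diagonal values to all values of a form, in particular to transfer
  continuity in the spectral parameter.\<close>

lemma herm_polar: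
  assumes "u \<in> V" "v \<in> V"
  shows "Re (h u v) = (Re (h (u + v) (u + v)) - Re (h u u) - Re (h v v)) / 2"
    and "Im (h u v) = Re (h u (\<i> \<cdot> v))"
  using assms herm_sym[of u v]
  by (simp_all add: herm_add herm_add_right subspace_add[OF V] herm_scale_right)

lemma herm_polar_zero:
  assumes "\<And>u. u \<in> V \<Longrightarrow> h u u = 0" "u \<in> V" "v \<in> V"
  shows "h u v = 0"
proof -
  have R: "Re (h u w) = 0" if "w \<in> V" for w
    using herm_polar(1)[OF assms(2) that] assms(1)[of u] assms(1)[of w] assms(1)[of "u + w"]
      subspace_add[OF V assms(2) that] assms(2) that by simp
  then have "Im (h u v) = 0"
    using herm_polar(2)[OF assms(2,3)] subspace_scale[OF V assms(3)] by simp
  then show ?thesis using R[OF assms(3)] by (simp add: complex_eq_iff)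
qed

end

lemma hermitian_on_subset: "hermitian_on V h \<Longrightarrow> W \<subseteq> V \<Longrightarrow> hermitian_on W h"
  unfolding hermitian_on_def by (meson subsetD)

lemma hermitian_onI:
  assumes "\<And>u v w. u \<in> V \<Longrightarrow> v \<in> V \<Longrightarrow> w \<in> V \<Longrightarrow> h (u + v) w = h u w + h v w"
    and "\<And>c u v. u \<in> V \<Longrightarrow> v \<in> V \<Longrightarrow> h (c \<cdot> u) v = c * h u v"
    and "\<And>u v. u \<in> V \<Longrightarrow> v \<in> V \<Longrightarrow> h v u = cnj (h u v)"
  shows "hermitian_on V h"
  using assms unfolding hermitian_on_def by blast

lemma hermitian_on_uminus:
  assumes V: "subspace V" and h: "hermitian_on V h"
  shows "hermitian_on V (\<lambda>u v. - h u v)"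
proof (rule hermitian_onI)
  show "- h v u = cnj (- h u v)" if "u \<in> V" "v \<in> V" for u v
    using herm_sym[OF V h that] by simp
qed (simp_all add: herm_add[OF V h] herm_scale[OF V h])

text \<open>The form may be indefinite and degenerate, so Gram-Schmidt could meet isotropic vectors.
  Instead a vector with \<open>h v v\<close> nonzero is split off and the induction continues on its
  orthogonal complement; if there is no such vector, polarization makes the form vanish and any
  basis will do.\<close>

lemma orthogonal_basis_exists:
  assumes "subspace V" "hermitian_on V h" "rank_le V n"
  shows "\<exists>B. B \<subseteq> V \<and> independent B \<and> V \<subseteq> span B \<and> finite B \<and> (\<forall>u\<in>B. \<forall>v\<in>B. u \<noteq> v \<longrightarrow> h u v = 0)"
  using assms
proof (induction n arbitrary: V)
  case 0
  obtain B where "B \<subseteq> V" "independent B" "V \<subseteq> span B" "finite B" "card B \<le> 0"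
    by (rule basis_of_rank_le[OF 0(3)])
  then show ?case by (intro exI[of _ B]) auto
next
  case (Suc n)
  note V = Suc.prems(1) and h = Suc.prems(2)
  show ?case
  proof (cases "\<forall>u\<in>V. h u u = 0")
    case True
    then have "h u v = 0" if "u \<in> V" "v \<in> V" for u v
      using herm_polar_zero[OF V h] that by blast
    then show ?thesis
      using basis_of_rank_le[OF Suc.prems(3)] by (metis subsetD)
  next
    case False
    then obtain v where v: "v \<in> V" "h v v \<noteq> 0" by auto
    define W where "W = {w \<in> V. h w v = 0}"
    have W: "subspace W"
      unfolding W_def subspace_def using V v(1)
      by (auto simp: herm_zero[OF V h] herm_add[OF V h] herm_scale[OF V h] subspace_0 subspace_add subspace_scale)
    have WV: "W \<subseteq> V" by (auto simp: W_def)
    have hW: "hermitian_on W h"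
      using h WV hermitian_on_subset by blast
    have vW: "v \<notin> W" using v by (simp add: W_def)
    have "rank_le W n"
      unfolding rank_le_def
    proof safe
      fix B assume B: "B \<subseteq> W" "independent B"
      then have "v \<notin> span B" using vW W span_minimal by blast
      then have i: "independent (insert v B)" using B independent_insertI by blast
      have "insert v B \<subseteq> V" using B WV v by auto
      then have *: "finite (insert v B) \<and> card (insert v B) \<le> Suc n" using rank_leD[OF Suc.prems(3)] i by (meson)
      then show "finite B" by simp
      have "v \<notin> B" using B vW by auto
      then show "card B \<le> n" using * card_insert_disjoint[of B v] by auto
    qed
    from Suc.IH[OF W hW this] obtain B where BB: "B \<subseteq> W \<and> independent B \<and> W \<subseteq> span B \<and> finite B \<and> (\<forall>u\<in>B. \<forall>v\<in>B. u \<noteq> v \<longrightarrow> h u v = 0)"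
      by (rule exE)
    note B = BB[THEN conjunct1] BB[THEN conjunct2, THEN conjunct1] BB[THEN conjunct2, THEN conjunct2, THEN conjunct1]
      BB[THEN conjunct2, THEN conjunct2, THEN conjunct2, THEN conjunct1]
    note o = BB[THEN conjunct2, THEN conjunct2, THEN conjunct2, THEN conjunct2]
    have 1: "insert v B \<subseteq> V" using B WV v by auto
    have 2: "independent (insert v B)" by (meson B(1,2) vW W span_minimal independent_insertI subsetD)
    have 3: "V \<subseteq> span (insert v B)"
    proof
      fix w assume w: "w \<in> V"
      have "w - (h w v / h v v) \<cdot> v \<in> W"
        unfolding W_def using V w v
        by (auto simp: herm_diff[OF V h] herm_scale[OF V h] subspace_diff subspace_scale)
      then show "w \<in> span (insert v B)" using B(3) span_insert by blast
    qed
    have 4: "\<forall>a\<in>insert v B. \<forall>b\<in>insert v B. a \<noteq> b \<longrightarrow> h a b = 0"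
    proof (intro ballI impI)
      fix a b assume ab: "a \<in> insert v B" "b \<in> insert v B" "a \<noteq> b"
      have "h w v = 0 \<and> h v w = 0" if "w \<in> B" for w
      proof -
        have w: "w \<in> V" "h w v = 0" using that B(1) by (auto simp: W_def)
        then show ?thesis using herm_sym[OF V h w(1) v(1)] by simp
      qed
      then show "h a b = 0" using ab o by auto
    qed
    show ?thesis using 1 2 3 4 B(4) by blast
  qed
qed

section \<open>Perturbation of positive subspaces and spectral flow\<close>

text \<open>Diagonal dominance: near \<open>l0\<close> the Gram matrix on \<open>B\<close> is close
  to a diagonal matrix with positive entries. Finitely many matrix entries control the whole span,
  so pointwise continuity is enough.\<close>

lemma eventually_pos_on_span:
  fixes H :: "real \<Rightarrow> 'b \<Rightarrow> 'b \<Rightarrow> complex"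
  assumes V: "subspace V" and H: "\<And>l. l \<in> L \<Longrightarrow> hermitian_on V (H l)" and B: "B \<subseteq> V" "finite B"
    and cont: "\<And>u v. u \<in> V \<Longrightarrow> v \<in> V \<Longrightarrow> continuous_on L (\<lambda>l. H l u v)"
    and l0: "l0 \<in> L" and o: "\<And>u v. u \<in> B \<Longrightarrow> v \<in> B \<Longrightarrow> u \<noteq> v \<Longrightarrow> H l0 u v = 0"
    and pos: "\<And>u. u \<in> B \<Longrightarrow> Re (H l0 u u) > 0"
  shows "\<exists>\<epsilon>>0. \<forall>l\<in>L. \<bar>l - l0\<bar> < \<epsilon> \<longrightarrow> (\<forall>v\<in>span B. v \<noteq> 0 \<longrightarrow> Re (H l v v) > 0)"
proof (cases "B = {}")
  case True
  then show ?thesis by (intro exI[of _ 1]) auto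
next
  case False
  define N where "N = real (card B)"
  have N: "N > 0" using False B by (simp add: N_def card_gt_0_iff)
  define d where "d = Min ((\<lambda>u. Re (H l0 u u)) ` B)"
  have d: "d > 0" and dle: "\<And>u. u \<in> B \<Longrightarrow> d \<le> Re (H l0 u u)"
    using False B pos by (auto simp: d_def Min_gr_iff)
  \<comment> \<open>With this tolerance the sum over all pairs perturbs the form by at most
    \<open>d / 2\<close> times the sum \<open>s\<close> of the squared coefficients, half of the
    value guaranteed at \<open>l0\<close>.\<close>
  have "eventually (\<lambda>l. \<forall>p\<in>B \<times> B. dist (H l (fst p) (snd p)) (H l0 (fst p) (snd p)) < d / (2 * N)) (at l0 within L)"
  proof (rule eventually_ball_finite)
    show "finite (B \<times> B)" using B by simp
    show "\<forall>p\<in>B \<times> B. eventually (\<lambda>l. dist (H l (fst p) (snd p)) (H l0 (fst p) (snd p)) < d / (2 * N)) (at l0 within L)"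
    proof
      fix p assume "p \<in> B \<times> B"
      then have "fst p \<in> V" "snd p \<in> V" using B(1) by (auto simp: mem_Times_iff)
      then have "continuous_on L (\<lambda>l. H l (fst p) (snd p))" by (rule cont)
      then have "((\<lambda>l. H l (fst p) (snd p)) \<longlongrightarrow> H l0 (fst p) (snd p)) (at l0 within L)"
        using l0 by (simp add: continuous_on_def)
      then show "eventually (\<lambda>l. dist (H l (fst p) (snd p)) (H l0 (fst p) (snd p)) < d / (2 * N)) (at l0 within L)"
        by (rule tendstoD) (use d N in simp)
    qed
  qed
  then obtain \<epsilon> where \<epsilon>: "\<epsilon> > 0"
    and close: "\<And>l. l \<in> L \<Longrightarrow> 0 < \<bar>l - l0\<bar> \<Longrightarrow> \<bar>l - l0\<bar> < \<epsilon> \<Longrightarrow> \<forall>p\<in>B \<times> B. dist (H l (fst p) (snd p)) (H l0 (fst p) (snd p)) < d / (2 * N)"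
    unfolding eventually_at by (auto simp: dist_real_def)
  show ?thesis
  proof (intro exI conjI ballI impI)
    show "\<epsilon> > 0" by fact
    fix l v assume l: "l \<in> L" "\<bar>l - l0\<bar> < \<epsilon>" and v: "v \<in> span B" "v \<noteq> 0"
    have e: "cmod (H l a b - H l0 a b) \<le> d / (2 * N)" if "a \<in> B" "b \<in> B" for a b
    proof (cases "l = l0")
      case True then show ?thesis using d N by simp
    next
      case False
      then have "\<forall>p\<in>B \<times> B. dist (H l (fst p) (snd p)) (H l0 (fst p) (snd p)) < d / (2 * N)"
        using l close by auto
      then have "dist (H l a b) (H l0 a b) < d / (2 * N)" using that by force
      then show ?thesis by (simp add: dist_norm)
    qed
    obtain c where c: "v = (\<Sum>b\<in>B. c b \<cdot> b)"
      using v(1) span_finite[OF B(2)] by auto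
    define s where "s = (\<Sum>b\<in>B. (cmod (c b))\<^sup>2)"
    have "s > 0"
    proof -
      have "\<exists>b\<in>B. c b \<noteq> 0" using c v(2) by (metis (mono_tags, lifting) scale_zero_left sum.neutral)
      then show ?thesis unfolding s_def 
        by (elim bexE) (rule sum_pos2[OF B(2)], auto)
    qed
    have each: "Re (c a * cnj (c b) * H l a b) \<ge> (if a = b then d * (cmod (c a))\<^sup>2 else 0) - d / (4*N) * ((cmod (c a))\<^sup>2 + (cmod (c b))\<^sup>2)"
      if ab: "a \<in> B" "b \<in> B" for a b
    proof -
      have "cmod (c a * cnj (c b) * (H l a b - H l0 a b)) \<le> cmod (c a) * cmod (c b) * (d / (2*N))"
        unfolding norm_mult complex_mod_cnj by (intro mult_left_mono e ab mult_nonneg_nonneg) auto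
      also have "\<dots> \<le> (((cmod (c a))\<^sup>2 + (cmod (c b))\<^sup>2) / 2) * (d / (2*N))"
        using d N sum_squares_bound[of "cmod (c a)" "cmod (c b)"] by (intro mult_right_mono) (auto simp: field_simps)
      finally have A: "\<bar>Re (c a * cnj (c b) * (H l a b - H l0 a b))\<bar> \<le> d / (4*N) * ((cmod (c a))\<^sup>2 + (cmod (c b))\<^sup>2)"
        using abs_Re_le_cmod[of "c a * cnj (c b) * (H l a b - H l0 a b)"] by (simp add: field_simps)
      have "Re (c a * cnj (c b) * H l0 a b) \<ge> (if a = b then d * (cmod (c a))\<^sup>2 else 0)"
      proof (cases "a = b")
        case True
        have "c a * cnj (c a) = of_real ((cmod (c a))\<^sup>2)" by (rule complex_norm_square[symmetric])
        then have "Re (c a * cnj (c a) * H l0 a a) = (cmod (c a))\<^sup>2 * Re (H l0 a a)"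
          by (metis Re_complex_of_real Im_complex_of_real mult_zero_left times_complex.simps(1) diff_zero)
        then show ?thesis unfolding True[symmetric] if_P[OF refl]
          using mult_right_mono[OF dle[OF ab(1)], of "(cmod (c a))\<^sup>2"] by (simp only: mult.commute zero_le_power2)
      qed (use o ab in simp)
      moreover have "Re (c a * cnj (c b) * H l a b)
          = Re (c a * cnj (c b) * H l0 a b) + Re (c a * cnj (c b) * (H l a b - H l0 a b))"
        unfolding plus_complex.sel(1)[symmetric] distrib_left[symmetric] by simp
      ultimately show ?thesis using A by linarith
    qed
    have "Re (H l v v) = (\<Sum>a\<in>B. \<Sum>b\<in>B. Re (c a * cnj (c b) * H l a b))"
      unfolding c by (simp add: herm_sum_both[OF V H[OF l(1)] B(2,1)])
    also have "\<dots> \<ge> (\<Sum>a\<in>B. \<Sum>b\<in>B. (if a = b then d * (cmod (c a))\<^sup>2 else 0) - d / (4*N) * ((cmod (c a))\<^sup>2 + (cmod (c b))\<^sup>2))"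
      by (intro sum_mono each)
    also have "(\<Sum>a\<in>B. \<Sum>b\<in>B. (if a = b then d * (cmod (c a))\<^sup>2 else 0) - d / (4*N) * ((cmod (c a))\<^sup>2 + (cmod (c b))\<^sup>2))
      = d * s - d / (4*N) * (2 * N * s)"
    proof -
      have "(\<Sum>a\<in>B. \<Sum>b\<in>B. if a = b then d * (cmod (c a))\<^sup>2 else 0) = d * s"
        using B(2) by (simp add: s_def sum_distrib_left)
      moreover have "(\<Sum>a\<in>B. \<Sum>b\<in>B. d / (4*N) * ((cmod (c a))\<^sup>2 + (cmod (c b))\<^sup>2)) = d / (4*N) * (2 * N * s)"
        unfolding sum_distrib_left[symmetric] sum.distrib by (simp add: s_def N_def sum_distrib_left[symmetric])
      ultimately show ?thesis by (simp only: sum_subtractf)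
    qed
    also have "\<dots> = d * s / 2" using N by (simp add: field_simps)
    finally show "Re (H l v v) > 0" using d \<open>s > 0\<close> by (smt (verit) divide_pos_pos mult_pos_pos)
  qed
qed

text \<open>A nonpositive subspace and a positive one meet only in \<open>0\<close>, so their dimensions add up.\<close>

lemma nonpos_card_bound:
  assumes V: "subspace V" "rank_le V (card B)" and E: "E \<subseteq> V" "independent E" "finite E"
    and B: "B \<subseteq> V" "independent B" "finite B" and P: "P \<subseteq> B"
    and nonpos: "\<And>v. v \<in> span E \<Longrightarrow> Re (h v v) \<le> 0" and pos: "\<And>v. v \<in> span P \<Longrightarrow> v \<noteq> 0 \<Longrightarrow> Re (h v v) > 0"
  shows "card E \<le> card (B - P)"
proof -
  have fP: "finite P" using P B finite_subset by auto
  have iP: "independent P" using independent_mono[OF B(2) P] .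
  have "span E \<inter> span P = {0}"
    using nonpos pos by (force intro: span_zero)
  from independent_Un_disjoint_span[OF E(2) iP fP this]
  have "card (E \<union> P) \<le> card B" "card (E \<union> P) = card E + card P"
    using rank_leD[OF V(2), of "E \<union> P"] E B P card_Un_disjoint[OF E(3) fP] by auto
  then show ?thesis using P B(3) fP by (simp add: card_Diff_subset)
qed

text \<open>Let \<open>l\<^sub>0\<close> be the first parameter with a nonpositive subspace of dimension \<open>d\<close>. The negative part at
  \<open>l\<^sub>0\<close> survives slightly to the left, where induction applies; the rest of \<open>d\<close> is the kernel at \<open>l\<^sub>0\<close>.\<close>

lemma spectral_flow_bound:
  fixes H :: "real \<Rightarrow> 'b \<Rightarrow> 'b \<Rightarrow> complex"
  assumes V: "subspace V" "rank_le V n" and H: "\<And>l. l \<in> {c..M} \<Longrightarrow> hermitian_on V (H l)"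
    and cont: "\<And>u v. u \<in> V \<Longrightarrow> v \<in> V \<Longrightarrow> continuous_on {c..M} (\<lambda>l. H l u v)"
    and pos: "\<And>v. v \<in> V \<Longrightarrow> v \<noteq> 0 \<Longrightarrow> Re (H c v v) > 0"
    and \<mu>: "\<mu> \<in> {c..M}" and E: "E \<subseteq> V" "independent E" and nonpos: "\<And>v. v \<in> span E \<Longrightarrow> Re (H \<mu> v v) \<le> 0"
  shows "\<exists>F K. finite F \<and> F \<subseteq> {c..\<mu>} \<and> card E \<le> (\<Sum>l\<in>F. card (K l)) \<and>
     (\<forall>l\<in>F. independent (K l) \<and> K l \<subseteq> {v \<in> V. \<forall>w\<in>V. H l v w = 0})"
  using \<mu> E nonpos
proof (induction "card E" arbitrary: E \<mu> rule: less_induct)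
  case (less E \<mu>)
  show ?case
  proof (cases "card E = 0")
    case True
    then show ?thesis by (intro exI[of _ "{}"]) auto
  next
    case False
    define S where "S = {l \<in> {c..\<mu>}. \<exists>D\<subseteq>V. independent D \<and> card D = card E \<and> (\<forall>v\<in>span D. Re (H l v v) \<le> 0)}"
    have "\<mu> \<in> S"
      unfolding S_def using less.prems by (intro CollectI conjI exI[of _ E] ballI) auto
    moreover have "bdd_below S" unfolding S_def by (rule bdd_belowI[of _ c]) auto
    moreover have "S \<subseteq> {c..M}" using less.prems(1) unfolding S_def by auto
    ultimately have S: "\<mu> \<in> S" "bdd_below S" "S \<subseteq> {c..M}" by this+
    define l0 where "l0 = Inf S"
    have l0c: "c \<le> l0" unfolding l0_def using S by (intro cInf_greatest) (auto simp: S_def)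
    have l0\<mu>: "l0 \<le> \<mu>" unfolding l0_def using S by (intro cInf_lower)
    have l0: "l0 \<in> {c..M}" using l0c l0\<mu> less.prems by auto
    obtain B where B: "B \<subseteq> V" "independent B" "V \<subseteq> span B" "finite B"
      and o: "\<forall>u\<in>B. \<forall>v\<in>B. u \<noteq> v \<longrightarrow> H l0 u v = 0"
      using orthogonal_basis_exists[OF V(1) H[OF l0] V(2)] by meson
    have VB: "rank_le V (card B)" using rank_le_span B by blast
    define Bp where "Bp = {u \<in> B. Re (H l0 u u) > 0}"
    define Bm where "Bm = {u \<in> B. Re (H l0 u u) < 0}"
    define Bz where "Bz = {u \<in> B. Re (H l0 u u) = 0}"
    have sub: "Bp \<subseteq> B" "Bm \<subseteq> B" "Bz \<subseteq> B" by (auto simp: Bp_def Bm_def Bz_def)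
    have fin: "finite Bp" "finite Bm" "finite Bz" using sub B(4) by (auto intro: finite_subset)
    obtain e1 where e1: "e1 > 0"
      "\<And>l v. l \<in> {c..M} \<Longrightarrow> \<bar>l - l0\<bar> < e1 \<Longrightarrow> v \<in> span Bp \<Longrightarrow> v \<noteq> 0 \<Longrightarrow> Re (H l v v) > 0"
    proof -
      have "Bp \<subseteq> V" using sub(1) B(1) by auto
      moreover have "\<And>u v. u \<in> Bp \<Longrightarrow> v \<in> Bp \<Longrightarrow> u \<noteq> v \<Longrightarrow> H l0 u v = 0"
        using o sub(1) by (meson subsetD)
      moreover have "\<And>u. u \<in> Bp \<Longrightarrow> Re (H l0 u u) > 0" by (simp add: Bp_def)
      ultimately have "\<exists>\<epsilon>>0. \<forall>l\<in>{c..M}. \<bar>l - l0\<bar> < \<epsilon> \<longrightarrow> (\<forall>v\<in>span Bp. v \<noteq> 0 \<longrightarrow> Re (H l v v) > 0)"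
        using eventually_pos_on_span[OF V(1) H _ fin(1) cont l0] by blast
      then show thesis using that by (meson)
    qed
    \<comment> \<open>Membership of the infimum \<open>l0\<close> in \<open>S\<close> is not at
      hand. There are, however, points of \<open>S\<close> arbitrarily close to the right of
      \<open>l0\<close>, where \<open>Bp\<close> still spans a positive subspace; the dimension
      count made there is a statement about \<open>Bp\<close> alone.\<close>
    have card0: "card E \<le> card (B - Bp)"
    proof -
      obtain l where l: "l \<in> S" "l < l0 + e1"
        using S e1(1) cInf_less_iff[of S "l0 + e1"] by (auto simp: l0_def)
      have "l0 \<le> l" unfolding l0_def using l S by (intro cInf_lower)
      then have lcM: "l \<in> {c..M}" "\<bar>l - l0\<bar> < e1" using l S(3) by auto
      obtain D where D: "D \<subseteq> V" "independent D" "card D = card E" "\<forall>v\<in>span D. Re (H l v v) \<le> 0"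
        using l(1) unfolding S_def by auto
      have "finite D" using rank_leD[OF V(2)] D by blast
      from nonpos_card_bound[OF V(1) VB D(1,2) this B(1,2,4) sub(1), of "H l"] D e1(2)[OF lcM]
      show ?thesis by auto
    qed
    have BB: "B - Bp = Bm \<union> Bz" "Bm \<inter> Bz = {}" by (auto simp: Bp_def Bm_def Bz_def)
    have card1: "card E \<le> card Bm + card Bz" using card0 BB fin by (simp add: card_Un_disjoint)
    have kerz: "Bz \<subseteq> {v \<in> V. \<forall>w\<in>V. H l0 v w = 0}"
    proof
      fix z assume z: "z \<in> Bz"
      then have zB: "z \<in> B" "z \<in> V" using sub B by auto
      have zz: "H l0 z z = 0" using z herm_real[OF V(1) H[OF l0] zB(2)] by (simp add: Bz_def)
      have "H l0 z w = 0" if "w \<in> V" for w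
      proof -
        obtain k where "w = (\<Sum>b\<in>B. k b \<cdot> b)" using \<open>w \<in> V\<close> B span_finite[OF B(4)] by auto
        then have "H l0 z w = (\<Sum>b\<in>B. H l0 z (k b \<cdot> b))"
          using herm_sum_right[OF V(1) H[OF l0] B(4), of "\<lambda>b. k b \<cdot> b" z] zB B(1)
          by (auto simp: subset_iff subspace_scale[OF V(1)])
        also have "\<dots> = 0"
          using zz o zB B(1) by (intro sum.neutral) (metis herm_scale_right[OF V(1) H[OF l0]] mult_zero_right subsetD)
        finally show ?thesis .
      qed
      then show "z \<in> {v \<in> V. \<forall>w\<in>V. H l0 v w = 0}" using zB by simp
    qed
    have iz: "independent Bz" using independent_mono[OF B(2)] sub by simp
    have im: "independent Bm" using independent_mono[OF B(2)] sub by simp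
    show ?thesis
    proof (cases "Bm = {}")
      case True
      then show ?thesis
        using card1 kerz iz l0c l0\<mu> by (intro exI[of _ "{l0}"] exI[of _ "\<lambda>_. Bz"]) auto
    next
      case False
      have "c < l0"
      proof (rule ccontr)
        assume "\<not> c < l0"
        then have "l0 = c" using l0c by simp
        moreover obtain u where "u \<in> Bm" using False by auto
        ultimately have "Re (H c u u) < 0" "u \<in> V" using sub B by (auto simp: Bm_def)
        moreover have "u \<noteq> 0" using \<open>u \<in> Bm\<close> im dependent_zero by blast
        ultimately show False using pos[of u] by linarith
      qed
      have BmV: "Bm \<subseteq> V" using sub B by auto
      obtain e2 where e2: "e2 > 0"
        "\<And>l v. l \<in> {c..M} \<Longrightarrow> \<bar>l - l0\<bar> < e2 \<Longrightarrow> v \<in> span Bm \<Longrightarrow> v \<noteq> 0 \<Longrightarrow> - Re (H l v v) > 0"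
      proof -
        have "\<And>u v. u \<in> Bm \<Longrightarrow> v \<in> Bm \<Longrightarrow> u \<noteq> v \<Longrightarrow> - H l0 u v = 0"
          using o sub(2) by (metis neg_0_equal_iff_equal subsetD)
        moreover have "\<And>u. u \<in> Bm \<Longrightarrow> Re (- H l0 u u) > 0" by (simp add: Bm_def)
        ultimately have "\<exists>\<epsilon>>0. \<forall>l\<in>{c..M}. \<bar>l - l0\<bar> < \<epsilon> \<longrightarrow> (\<forall>v\<in>span Bm. v \<noteq> 0 \<longrightarrow> Re (- H l v v) > 0)"
          using eventually_pos_on_span[OF V(1) hermitian_on_uminus[OF V(1) H] BmV fin(2) continuous_on_minus[OF cont] l0] by blast
        then show thesis using that by (metis uminus_complex.sel(1))
      qed
      define l1 where "l1 = max c (l0 - e2/2)"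
      have l1: "l1 \<in> {c..M}" "\<bar>l1 - l0\<bar> < e2" "l1 < l0"
        using e2(1) \<open>c < l0\<close> l0 by (auto simp: l1_def)
      have neg: "Re (H l1 v v) \<le> 0" if "v \<in> span Bm" for v
      proof (cases "v = 0")
        case True then show ?thesis using herm_zero[OF V(1) H[OF l1(1)] subspace_0[OF V(1)]] by simp
      next
        case False then show ?thesis using e2(2)[OF l1(1,2) that] by simp
      qed
      \<comment> \<open>Otherwise \<open>card E\<close> vectors of \<open>Bm\<close> would span a
        nonpositive subspace at \<open>l1\<close> and put \<open>l1\<close> into \<open>S\<close>,
        below its infimum.\<close>
      have "card Bm < card E"
      proof (rule ccontr)
        assume "\<not> card Bm < card E"
        then obtain D where D: "D \<subseteq> Bm" "card D = card E" using obtain_subset_with_card_n[of "card E" Bm] by auto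
        then have "l1 \<in> S" unfolding S_def
          using neg l1 l0\<mu> BmV independent_mono[OF im D(1)] span_mono[OF D(1)]
          by (intro CollectI conjI exI[of _ D] ballI) auto
        then have "l0 \<le> l1" unfolding l0_def using S by (intro cInf_lower)
        then show False using l1 by simp
      qed
      from less.hyps[OF this l1(1) BmV im neg] obtain F K where FK: "finite F" "F \<subseteq> {c..l1}"
        "card Bm \<le> (\<Sum>l\<in>F. card (K l))" "\<forall>l\<in>F. independent (K l) \<and> K l \<subseteq> {v \<in> V. \<forall>w\<in>V. H l v w = 0}" by blast
      \<comment> \<open>The kernels supplied by induction belong to parameters up to
        \<open>l1 < l0\<close>, so the kernel at \<open>l0\<close> is counted in addition to
        them.\<close>
      have l0F: "l0 \<notin> F" using FK l1 by auto
      have "(\<Sum>l\<in>F. card ((K(l0 := Bz)) l)) = (\<Sum>l\<in>F. card (K l))"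
        using l0F by (intro sum.cong) auto
      then have "card E \<le> (\<Sum>l\<in>insert l0 F. card ((K(l0 := Bz)) l))"
        using FK l0F card1 by simp
      moreover have "insert l0 F \<subseteq> {c..\<mu>}" using FK l1 l0c l0\<mu> by auto
      ultimately show ?thesis
        using FK iz kerz by (intro exI[of _ "insert l0 F"] exI[of _ "K(l0 := Bz)"]) auto
    qed
  qed
qed

end

section \<open>Linear initial value problems\<close>

text \<open>With the integrating factor \<open>exp (- K * (s - a))\<close> the function cannot
  increase; the mean value theorem replaces an integration of \<open>u'\<close>, which need not be
  continuous.\<close>

lemma gronwall_nonpos:
  fixes u u' :: "real \<Rightarrow> real"
  assumes der: "\<And>t. t \<in> {a..b} \<Longrightarrow> (u has_vector_derivative u' t) (at t within {a..b})"
    and le: "\<And>t. t \<in> {a..b} \<Longrightarrow> u' t \<le> K * u t" and ua: "u a \<le> 0" and t: "t \<in> {a..b}"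
  shows "u t \<le> 0"
proof -
  define \<phi> where "\<phi> s = exp (- K * (s - a)) * u s" for s
  have "(\<phi> has_derivative (\<lambda>h. h * (exp (- K * (s - a)) * (u' s - K * u s)))) (at s within {a..t})"
    if "s \<in> {a..t}" for s
  proof -
    have "(u has_vector_derivative u' s) (at s within {a..t})"
      using that t by (intro has_vector_derivative_within_subset[OF der]) auto
    then have "(\<phi> has_vector_derivative (exp (- K * (s - a)) * u' s + (- K * exp (- K * (s - a))) * u s)) (at s within {a..t})"
      unfolding \<phi>_def has_real_derivative_iff_has_vector_derivative[symmetric]
      by (auto intro!: derivative_eq_intros)
    then show ?thesis
      by (simp add: has_vector_derivative_def algebra_simps)
  qed
  then obtain s where s: "s \<in> {a..t}" "\<phi> t - \<phi> a = (t - a) * (exp (- K * (s - a)) * (u' s - K * u s))"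
    using mvt_very_simple[of a t \<phi> "\<lambda>s h. h * (exp (- K * (s - a)) * (u' s - K * u s))"] t by auto
  have "(t - a) * (exp (- K * (s - a)) * (u' s - K * u s)) \<le> 0"
    using s(1) t le[of s] by (intro mult_nonneg_nonpos) auto
  then have "\<phi> t \<le> 0" using s(2) ua by (simp add: \<phi>_def)
  then show ?thesis by (simp add: \<phi>_def mult_le_0_iff)
qed

lemma linear_ivp_unique:
  fixes z :: "real \<Rightarrow> 'a::euclidean_space"
  assumes der: "\<And>t. t \<in> {a..b} \<Longrightarrow> (z has_vector_derivative z' t) (at t within {a..b})"
    and le: "\<And>t. t \<in> {a..b} \<Longrightarrow> norm (z' t) \<le> K * norm (z t)" and za: "z a = 0" and t: "t \<in> {a..b}"
  shows "z t = 0"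
proof -
  have "z t \<bullet> z t \<le> 0"
  proof (rule gronwall_nonpos[of a b "\<lambda>t. z t \<bullet> z t" "\<lambda>t. z t \<bullet> z' t + z' t \<bullet> z t" "2 * K"])
    fix s assume s: "s \<in> {a..b}"
    show "((\<lambda>t. z t \<bullet> z t) has_vector_derivative z s \<bullet> z' s + z' s \<bullet> z s) (at s within {a..b})"
      using der[OF s] by (rule bounded_bilinear.has_vector_derivative[OF bounded_bilinear_inner])
         (rule der[OF s])
    have "z s \<bullet> z' s \<le> norm (z s) * (K * norm (z s))"
      using norm_cauchy_schwarz[of "z s" "z' s"] mult_left_mono[OF le[OF s], of "norm (z s)"] by simp
    then show "z s \<bullet> z' s + z' s \<bullet> z s \<le> 2 * K * (z s \<bullet> z s)"
      by (simp add: inner_commute dot_square_norm power2_eq_square algebra_simps)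
  qed (use za t in auto)
  then show ?thesis by (metis antisym inner_eq_zero_iff inner_ge_zero)
qed

text \<open>Picard iteration summed as a series: by linearity the increments \<open>d n\<close> obey
  their own recursion and are dominated by the terms of an exponential series, so one construction
  covers the whole interval. Continuity of \<open>F\<close> is required only along continuous
  curves, which avoids a topology on operators.\<close>

lemma linear_ivp_exists:
  fixes F :: "real \<Rightarrow> 'a::banach \<Rightarrow> 'a"
  assumes ab: "a \<le> b" and lin: "\<And>t. t \<in> {a..b} \<Longrightarrow> linear (F t)"
    and bound: "\<And>t z. t \<in> {a..b} \<Longrightarrow> norm (F t z) \<le> K * norm z" and K: "0 \<le> K"
    and cont: "\<And>f. continuous_on {a..b} f \<Longrightarrow> continuous_on {a..b} (\<lambda>t. F t (f t))"
  shows "\<exists>z. z a = z0 \<and> (\<forall>t\<in>{a..b}. (z has_vector_derivative F t (z t)) (at t within {a..b}))"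
proof -
  define d where "d = rec_nat (\<lambda>t. z0) (\<lambda>n f t. integral {a..t} (\<lambda>s. F s (f s)))"
  have d0: "d 0 t = z0" and dS: "d (Suc n) t = integral {a..t} (\<lambda>s. F s (d n s))" for n t
    by (simp_all add: d_def)
  have dc: "continuous_on {a..b} (d n)" for n
  proof (induction n)
    case 0
    show ?case unfolding d_def by simp
  next
    case (Suc n)
    have "continuous_on {a..b} (\<lambda>t. integral {a..t} (\<lambda>s. F s (d n s)))"
      by (intro indefinite_integral_continuous_1 integrable_continuous_real cont Suc)
    then show ?case unfolding dS[abs_def] .
  qed
  have Fint: "(\<lambda>s. F s (f s)) integrable_on {a..t}" if "continuous_on {a..b} f" "t \<in> {a..b}" for f t
    using that(2) by (intro integrable_continuous_real continuous_on_subset[OF cont[OF that(1)]]) auto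
  have dn: "norm (d n t) \<le> norm z0 * (K * (t - a)) ^ n / fact n" if "t \<in> {a..b}" for n t
    using that
  proof (induction n arbitrary: t)
    case 0
    then show ?case by (simp add: d0)
  next
    case (Suc n)
    define g where "g s = norm z0 * (K * (s - a)) ^ Suc n / fact (Suc n)" for s
    define g' where "g' s = K * (norm z0 * (K * (s - a)) ^ n / fact n)" for s
    have "(g' has_integral (g t - g a)) {a..t}"
    proof (rule fundamental_theorem_of_calculus)
      show "a \<le> t" using Suc.prems by simp
      fix s assume "s \<in> {a..t}"
      have "(g has_real_derivative (norm z0 * (of_nat (Suc n) * (K * (s - a)) ^ n * K) / fact (Suc n))) (at s within {a..t})"
        unfolding g_def by (rule derivative_eq_intros refl | simp)+
      also have "norm z0 * (of_nat (Suc n) * (K * (s - a)) ^ n * K) / fact (Suc n) = g' s"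
        unfolding g'_def fact_Suc by (simp add: field_simps del: of_nat_Suc)
      finally show "(g has_vector_derivative g' s) (at s within {a..t})"
        by (simp add: has_real_derivative_iff_has_vector_derivative)
    qed
    then have gi: "(g' has_integral g t) {a..t}" by (simp add: g_def)
    have "norm (d (Suc n) t) \<le> integral {a..t} g'"
      unfolding dS
    proof (rule integral_norm_bound_integral)
      show "(\<lambda>s. F s (d n s)) integrable_on {a..t}" using Fint dc Suc.prems by blast
      show "g' integrable_on {a..t}" using gi by blast
      fix s assume "s \<in> {a..t}"
      then have s: "s \<in> {a..b}" using Suc.prems by auto
      show "norm (F s (d n s)) \<le> g' s"
        unfolding g'_def using bound[OF s, of "d n s"] mult_left_mono[OF Suc.IH[OF s] K] by linarith
    qed
    also have "\<dots> = g t" using gi by (rule integral_unique)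
    finally show ?case by (simp add: g_def)
  qed
  define M where "M n = norm z0 * ((K * (b - a)) ^ n / fact n)" for n
  have dM: "norm (d n t) \<le> M n" if t: "t \<in> {a..b}" for n t
  proof -
    have "(K * (t - a)) ^ n \<le> (K * (b - a)) ^ n"
      using t K by (intro power_mono mult_left_mono) auto
    then have "norm z0 * (K * (t - a)) ^ n / fact n \<le> M n"
      unfolding M_def times_divide_eq_right by (intro divide_right_mono mult_left_mono) auto
    then show ?thesis using dn[OF t, of n] by linarith
  qed
  have Ms: "summable M"
    unfolding M_def using summable_exp_generic[of "K * (b - a)"]
    by (intro summable_mult) (simp add: scaleR_conv_of_real divide_inverse mult.commute)
  define z where "z t = (\<Sum>n. d n t)" for t
  have ul: "uniform_limit {a..b} (\<lambda>n t. \<Sum>i<n. d i t) z sequentially"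
    unfolding z_def using dM Ms by (intro Weierstrass_m_test) auto
  have zc: "continuous_on {a..b} z"
    using ul by (rule uniform_limit_theorem[rotated]) (auto intro!: always_eventually continuous_on_sum dc)
  have zeq: "z t = z0 + integral {a..t} (\<lambda>s. F s (z s))" if t: "t \<in> {a..b}" for t
  proof -
    let ?S = "\<lambda>n t. \<Sum>i<n. d i t"
    have Sc: "continuous_on {a..b} (?S n)" for n by (intro continuous_on_sum dc)
    have step: "?S (Suc n) t = z0 + integral {a..t} (\<lambda>s. F s (?S n s))" for n
    proof -
      have "integral {a..t} (\<lambda>s. F s (?S n s)) = integral {a..t} (\<lambda>s. \<Sum>i<n. F s (d i s))"
        using t by (intro integral_cong) (auto intro!: linear_sum lin)
      also have "\<dots> = (\<Sum>i<n. integral {a..t} (\<lambda>s. F s (d i s)))"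
        by (intro integral_sum Fint dc t) auto
      finally show ?thesis unfolding sum.lessThan_Suc_shift by (simp add: d0 dS)
    qed
    have "(\<lambda>n. integral {a..t} (\<lambda>s. F s (?S n s))) \<longlonglongrightarrow> integral {a..t} (\<lambda>s. F s (z s))"
    proof (rule tendstoI)
      fix e :: real assume e: "e > 0"
      \<comment> \<open>The summand 1 keeps the denominator positive when \<open>K\<close> or
        \<open>b - a\<close> is zero.\<close>
      define \<delta> where "\<delta> = e / (2 * (K * (b - a) + 1))"
      have Kb: "K * (b - a) + 1 > 0" using K ab by (simp add: add_nonneg_pos)
      have \<delta>: "\<delta> > 0" unfolding \<delta>_def using e Kb by simp
      have "eventually (\<lambda>n. \<forall>s\<in>{a..b}. dist (?S n s) (z s) < \<delta>) sequentially"
        using uniform_limitD[OF ul \<delta>] .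
      then show "eventually (\<lambda>n. dist (integral {a..t} (\<lambda>s. F s (?S n s))) (integral {a..t} (\<lambda>s. F s (z s))) < e) sequentially"
      proof eventually_elim
        case (elim n)
        have "norm (integral {a..t} (\<lambda>s. F s (?S n s) - F s (z s))) \<le> integral {a..t} (\<lambda>s. K * \<delta>)"
        proof (rule integral_norm_bound_integral)
          show "(\<lambda>s. F s (?S n s) - F s (z s)) integrable_on {a..t}"
            by (intro integrable_diff Fint Sc zc t)
          fix s assume "s \<in> {a..t}"
          then have s: "s \<in> {a..b}" using t by auto
          have "F s (?S n s) - F s (z s) = F s (?S n s - z s)" using linear_diff[OF lin[OF s]] by simp
          also have "norm \<dots> \<le> K * norm (?S n s - z s)" by (rule bound[OF s])
          also have "\<dots> \<le> K * \<delta>" using elim s K by (intro mult_left_mono) (auto simp: dist_norm intro: less_imp_le)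
          finally show "norm (F s (?S n s) - F s (z s)) \<le> K * \<delta>" .
        qed auto
        also have "\<dots> = (K * (t - a)) * \<delta>" using t by simp
        also have "\<dots> \<le> (K * (b - a)) * \<delta>" using t K \<delta> by (intro mult_right_mono mult_left_mono) auto
        also have "\<dots> \<le> (K * (b - a) + 1) * \<delta>" using \<delta> by (intro mult_right_mono) auto
        also have "\<dots> = e / 2"
        proof -
          have "D * (e / (2 * D)) = e / 2" if "D > 0" for D using that by simp
          then show ?thesis using Kb unfolding \<delta>_def by blast
        qed
        also have "\<dots> < e" using e by simp
        finally show ?case
          using integral_diff[OF Fint[OF Sc t] Fint[OF zc t], of n] by (simp add: dist_norm)
      qed
    qed
    then have "(\<lambda>n. ?S (Suc n) t) \<longlonglongrightarrow> z0 + integral {a..t} (\<lambda>s. F s (z s))"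
      unfolding step by (intro tendsto_add tendsto_const)
    moreover have "(\<lambda>n. ?S (Suc n) t) \<longlonglongrightarrow> z t"
      using tendsto_uniform_limitI[OF ul t] by (rule LIMSEQ_Suc)
    ultimately show ?thesis using LIMSEQ_unique by blast
  qed
  have "(z has_vector_derivative F t (z t)) (at t within {a..b})" if t: "t \<in> {a..b}" for t
  proof -
    have "((\<lambda>t. z0 + integral {a..t} (\<lambda>s. F s (z s))) has_vector_derivative 0 + F t (z t)) (at t within {a..b})"
      by (intro has_vector_derivative_add has_vector_derivative_const integral_has_vector_derivative cont zc t)
    then show ?thesis
      using has_vector_derivative_transform[OF t zeq] by simp
  qed
  moreover have "z a = z0" using zeq[of a] ab by simp
  ultimately show ?thesis by blast
qed

section \<open>Calculus of weak derivatives\<close>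

text \<open>On an interval of finite length this follows from the pointwise bound of the norm by one
  plus its square.\<close>

lemma L2_on_absolutely_integrable:
  assumes "L2_on T f"
  shows "f absolutely_integrable_on {0..T}"
proof -
  have "integrable (lebesgue_on {0..T}) f"
  proof (rule Bochner_Integration.integrable_bound)
    show "integrable (lebesgue_on {0..T}) (\<lambda>t. 1 + (norm (f t))\<^sup>2)"
      using assms by (auto simp: L2_on_def emeasure_restrict_space)
    show "f \<in> borel_measurable (lebesgue_on {0..T})" using assms by (simp add: L2_on_def)
    have "norm (f t) \<le> 1 + (norm (f t))\<^sup>2" for t
      using sum_squares_bound[of "norm (f t)" 1] norm_ge_zero[of "f t"] by (simp del: norm_ge_zero)
    then show "AE t in lebesgue_on {0..T}. norm (f t) \<le> norm (1 + (norm (f t))\<^sup>2)" by simp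
  qed
  then show ?thesis
    by (simp add: set_integrable_def integrable_restrict_space)
qed

lemma L2_on_integrable: "L2_on T f \<Longrightarrow> f integrable_on {0..T}"
  using L2_on_absolutely_integrable set_lebesgue_integral_eq_integral(1) by blast

lemma L2_on_integrable_sub:
  assumes "L2_on T f" "{s..t} \<subseteq> {0..T}"
  shows "f integrable_on {s..t}" "(\<lambda>x. norm (f x)) integrable_on {s..t}"
proof -
  show "f integrable_on {s..t}"
    using integrable_on_subinterval[OF L2_on_integrable[OF assms(1)]] assms(2) by blast
  have "(\<lambda>x. norm (f x)) integrable_on {0..T}"
    using L2_on_absolutely_integrable[OF assms(1)] unfolding absolutely_integrable_on_def by blast
  then show "(\<lambda>x. norm (f x)) integrable_on {s..t}"
    using integrable_on_subinterval assms(2) by blast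
qed

lemma L2_on_square_integrable:
  assumes "L2_on T f"
  shows "(\<lambda>x. (norm (f x))\<^sup>2) integrable_on {0..T}"
  using assms unfolding L2_on_def by (intro integrable_on_lebesgue_on) auto

lemma L2_on_bounded_by:
  assumes g: "L2_on T g" and h: "h \<in> borel_measurable (lebesgue_on {0..T})"
    and le: "\<And>t. t \<in> {0..T} \<Longrightarrow> norm (h t) \<le> C * norm (g t)"
  shows "L2_on T h"
  unfolding L2_on_def
proof (rule conjI[OF h], rule Bochner_Integration.integrable_bound)
  show "integrable (lebesgue_on {0..T}) (\<lambda>t. C\<^sup>2 * (norm (g t))\<^sup>2)"
    using g by (simp add: L2_on_def)
  show "(\<lambda>t. (norm (h t))\<^sup>2) \<in> borel_measurable (lebesgue_on {0..T})" using h by (intro borel_measurable_power borel_measurable_norm[THEN measurable_compose[rotated]])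
  have "(norm (h t))\<^sup>2 \<le> C\<^sup>2 * (norm (g t))\<^sup>2" if "t \<in> {0..T}" for t
    using power_mono[OF le[OF that], of 2] by (simp add: power_mult_distrib)
  then show "AE t in lebesgue_on {0..T}. norm ((norm (h t))\<^sup>2) \<le> norm (C\<^sup>2 * (norm (g t))\<^sup>2)"
    by (intro AE_I2) (auto simp: space_restrict_space)
qed

lemma L2_on_add:
  assumes f: "L2_on T f" and g: "L2_on T g"
  shows "L2_on T (\<lambda>t. f t + g t)"
proof -
  have m: "f \<in> borel_measurable (lebesgue_on {0..T})" "g \<in> borel_measurable (lebesgue_on {0..T})"
    using f g by (auto simp: L2_on_def)
  have fg: "(\<lambda>t. f t + g t) \<in> borel_measurable (lebesgue_on {0..T})" using m by (rule borel_measurable_add)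
  have "integrable (lebesgue_on {0..T}) (\<lambda>t. (norm (f t + g t))\<^sup>2)"
  proof (rule Bochner_Integration.integrable_bound)
    show "(\<lambda>t. (norm (f t + g t))\<^sup>2) \<in> borel_measurable (lebesgue_on {0..T})"
      using fg by (intro borel_measurable_power borel_measurable_norm[THEN measurable_compose[rotated]])
    show "integrable (lebesgue_on {0..T}) (\<lambda>t. 2 * (norm (f t))\<^sup>2 + 2 * (norm (g t))\<^sup>2)"
      using f g by (simp add: L2_on_def)
    have "(norm (f t + g t))\<^sup>2 \<le> 2 * (norm (f t))\<^sup>2 + 2 * (norm (g t))\<^sup>2" for t
      using power_mono[OF norm_triangle_ineq[of "f t" "g t"], of 2] sum_squares_bound[of "norm (f t)" "norm (g t)"]
      by (simp add: power2_sum)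
    then show "AE t in lebesgue_on {0..T}. norm ((norm (f t + g t))\<^sup>2) \<le> norm (2 * (norm (f t))\<^sup>2 + 2 * (norm (g t))\<^sup>2)"
      by simp
  qed
  then show ?thesis using fg by (simp add: L2_on_def)
qed

lemma L2_on_uminus: "L2_on T f \<Longrightarrow> L2_on T (\<lambda>t. - f t)"
  unfolding L2_on_def by auto

lemma L2_on_continuous:
  assumes "continuous_on {0..T} f"
  shows "L2_on T f"
  unfolding L2_on_def
proof
  show "f \<in> borel_measurable (lebesgue_on {0..T})"
    by (intro continuous_imp_measurable_on_sets_lebesgue assms) auto
  have "continuous_on {0..T} (\<lambda>t. (norm (f t))\<^sup>2)" using assms by (intro continuous_intros)
  then show "integrable (lebesgue_on {0..T}) (\<lambda>t. (norm (f t))\<^sup>2)"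
    by (rule continuous_imp_integrable_real)
qed

lemma weak_derivative_on_interval:
  assumes w: "weak_derivative_on T f g" and st: "0 \<le> s" "s \<le> t" "t \<le> T"
  shows "(g has_integral (f t - f s)) {s..t}"
proof -
  have "(g has_integral (f t - f 0)) {0..t}" "(g has_integral (f s - f 0)) {0..s}"
    using w st by (auto simp: weak_derivative_on_def)
  then have I: "integral {0..t} g = f t - f 0" "integral {0..s} g = f s - f 0" "g integrable_on {0..t}"
    by (auto intro: integral_unique has_integral_integrable)
  have "integral {0..s} g + integral {s..t} g = integral {0..t} g"
    using st by (intro Henstock_Kurzweil_Integration.integral_combine I) auto
  then have "integral {s..t} g = f t - f s"
    using I(1,2) by (simp add: algebra_simps)
  moreover have "g integrable_on {s..t}"
    using integrable_on_subinterval[OF I(3)] st by auto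
  ultimately show ?thesis
    by (simp add: has_integral_integrable_integral)
qed

lemma weak_derivative_on_continuous:
  assumes "weak_derivative_on T f g" "0 \<le> T"
  shows "continuous_on {0..T} f"
proof -
  have "g integrable_on {0..T}" using assms by (auto simp: weak_derivative_on_def intro: has_integral_integrable)
  then have "continuous_on {0..T} (\<lambda>t. f 0 + integral {0..t} g)"
    by (intro continuous_on_add continuous_on_const indefinite_integral_continuous_1)
  moreover have "f 0 + integral {0..t} g = f t" if "t \<in> {0..T}" for t
    using integral_unique[of g "f t - f 0" "{0..t}"] assms(1) that by (auto simp: weak_derivative_on_def)
  ultimately show ?thesis by (rule continuous_on_eq)
qed

lemma H1_on_continuous: "H1_on T f \<Longrightarrow> 0 \<le> T \<Longrightarrow> continuous_on {0..T} f"
  unfolding H1_on_def using weak_derivative_on_continuous by blast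

lemma weak_derivative_on_classical:
  assumes "\<And>t. t \<in> {0..T} \<Longrightarrow> (f has_vector_derivative g t) (at t within {0..T})"
  shows "weak_derivative_on T f g"
  unfolding weak_derivative_on_def
proof
  fix t assume t: "t \<in> {0..T}"
  show "(g has_integral (f t - f 0)) {0..t}"
    using t by (intro fundamental_theorem_of_calculus has_vector_derivative_within_subset[OF assms]) auto
qed

lemma weak_derivative_on_continuousD:
  assumes "weak_derivative_on T f g" "continuous_on {0..T} g" "t \<in> {0..T}"
  shows "(f has_vector_derivative g t) (at t within {0..T})"
proof (rule has_vector_derivative_transform[OF assms(3)])
  have "((\<lambda>t. f 0 + integral {0..t} g) has_vector_derivative 0 + g t) (at t within {0..T})"
    by (intro has_vector_derivative_add has_vector_derivative_const integral_has_vector_derivative assms)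
  then show "((\<lambda>t. f 0 + integral {0..t} g) has_vector_derivative g t) (at t within {0..T})" by simp
  show "f s = f 0 + integral {0..s} g" if "s \<in> {0..T}" for s
    using integral_unique[of g "f s - f 0" "{0..s}"] assms(1) that by (auto simp: weak_derivative_on_def)
qed

text \<open>An interval function that is \<open>o(K)\<close> uniformly is constant; this replaces differentiation
  almost everywhere in the product rule below.\<close>

lemma eq_if_small_oscillation:
  fixes D :: "real \<Rightarrow> 'a::real_normed_vector"
  assumes ab: "a \<le> b"
    and small: "\<And>\<epsilon>. \<epsilon> > 0 \<Longrightarrow> \<exists>\<delta>>0. \<forall>s t. a \<le> s \<and> s \<le> t \<and> t \<le> b \<and> t - s < \<delta> \<longrightarrow> norm (D t - D s) \<le> \<epsilon> * (K t - K s)"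
  shows "D b = D a"
proof (rule ccontr)
  assume ne: "D b \<noteq> D a"
  define \<epsilon> where "\<epsilon> = norm (D b - D a) / (2 * (\<bar>K b - K a\<bar> + 1))"
  have "0 < norm (D b - D a)" using ne by simp
  moreover have K1: "\<bar>K b - K a\<bar> + 1 > 0" by (rule add_nonneg_pos) auto
  ultimately have \<epsilon>: "\<epsilon> > 0" unfolding \<epsilon>_def by (intro divide_pos_pos mult_pos_pos) auto
  obtain \<delta> where \<delta>: "\<delta> > 0" and sm: "\<And>s t. a \<le> s \<Longrightarrow> s \<le> t \<Longrightarrow> t \<le> b \<Longrightarrow> t - s < \<delta> \<Longrightarrow> norm (D t - D s) \<le> \<epsilon> * (K t - K s)"
    using small[OF \<epsilon>] by blast
  obtain n :: nat where n: "(b - a) / \<delta> < real n" using reals_Archimedean2 by blast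
  have "0 \<le> (b - a) / \<delta>" using ab \<delta> by simp
  then have n0: "real n > 0" using n by linarith
  define p where "p i = a + (b - a) * (real i / real n)" for i
  have p0: "p 0 = a" "p n = b" using n0 by (simp_all add: p_def)
  have pb: "a \<le> p i" "p i \<le> p (Suc i)" "p i \<le> b" if "i \<le> n" for i
  proof -
    show "a \<le> p i" using ab by (simp add: p_def)
    show "p i \<le> p (Suc i)" unfolding p_def using ab n0
      by (intro add_left_mono mult_left_mono divide_right_mono) auto
    have "(b - a) * (real i / real n) \<le> (b - a) * 1"
      using that ab n0 by (intro mult_left_mono) auto
    then show "p i \<le> b" by (simp add: p_def)
  qed
  have pd: "p (Suc i) - p i < \<delta>" for i
  proof -
    have "p (Suc i) - p i = (b - a) / real n" using n0 by (simp add: p_def field_simps)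
    also have "\<dots> < \<delta>" using n n0 \<delta> by (simp add: field_simps)
    finally show ?thesis .
  qed
  have "D b - D a = (\<Sum>i<n. D (p (Suc i)) - D (p i))"
    using sum_lessThan_telescope[of "\<lambda>i. D (p i)" n] p0 by simp
  also have "norm \<dots> \<le> (\<Sum>i<n. \<epsilon> * (K (p (Suc i)) - K (p i)))"
    using pb pb(3)[OF Suc_leI] pd by (intro order_trans[OF norm_sum] sum_mono sm) auto
  also have "\<dots> = \<epsilon> * (K b - K a)"
    unfolding sum_distrib_left[symmetric] using sum_lessThan_telescope[of "\<lambda>i. K (p i)" n] p0 by simp
  also have "\<dots> \<le> \<epsilon> * (\<bar>K b - K a\<bar> + 1)" using \<epsilon> by (intro mult_left_mono) auto
  also have "\<dots> = norm (D b - D a) / 2"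
  proof -
    have "c / (2 * d) * d = c / 2" if "d > 0" for c d :: real using that by simp
    then show ?thesis unfolding \<epsilon>_def using K1 by blast
  qed
  finally show False using ne by simp
qed

context
  fixes \<beta> :: "'a::euclidean_space \<Rightarrow> 'b::euclidean_space \<Rightarrow> 'c::euclidean_space" (infixl "\<star>" 70)
  assumes bb: "bounded_bilinear \<beta>"
begin

interpretation bounded_bilinear \<beta> by (rule bb)

lemma measurable_prod:
  assumes "f \<in> borel_measurable M" "g \<in> borel_measurable M"
  shows "(\<lambda>t. f t \<star> g t) \<in> borel_measurable M"
  using assms by (rule borel_measurable_continuous_Pair)
    (intro continuous_on continuous_on_fst continuous_on_snd continuous_on_id)

lemma L2_on_prod_left:
  assumes f: "continuous_on {0..T} f" and g: "L2_on T g"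
  shows "L2_on T (\<lambda>t. f t \<star> g t)"
proof -
  obtain K where K: "\<And>a b. norm (a \<star> b) \<le> norm a * norm b * K" "K > 0" using pos_bounded by blast
  have "bounded (f ` {0..T})" by (intro compact_imp_bounded compact_continuous_image f) auto
  then obtain M where M: "\<And>t. t \<in> {0..T} \<Longrightarrow> norm (f t) \<le> M" unfolding bounded_iff by (metis imageI)
  show ?thesis
  proof (rule L2_on_bounded_by[OF g])
    show "(\<lambda>t. f t \<star> g t) \<in> borel_measurable (lebesgue_on {0..T})"
      using continuous_imp_measurable_on_sets_lebesgue[OF f] g unfolding L2_on_def by (intro measurable_prod) auto
    fix t assume t: "t \<in> {0..T}"
    have "norm (f t \<star> g t) \<le> norm (f t) * norm (g t) * K" by (rule K)
    also have "\<dots> \<le> M * norm (g t) * K" using K(2) M[OF t] by (intro mult_right_mono) auto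
    finally show "norm (f t \<star> g t) \<le> (M * K) * norm (g t)" by (simp add: mult_ac)
  qed
qed

text \<open>On a short interval from \<open>s\<close> to \<open>t\<close> the increment of the
  product is exactly the integral with \<open>f\<close> frozen at \<open>t\<close> and
  \<open>g\<close> frozen at \<open>s\<close>. By uniform continuity, unfreezing them costs at most
  \<epsilon> times the integral of \<open>k\<close>, the sum of the norms of both derivatives. The
  defect \<open>D\<close> is therefore negligible against the primitive of \<open>k\<close>, and so
  constant.\<close>

lemma weak_derivative_on_prod:
  assumes T: "0 \<le> T" and f: "L2_on T f'" "weak_derivative_on T f f'" and g: "L2_on T g'" "weak_derivative_on T g g'"
    and L: "L2_on T (\<lambda>t. f t \<star> g' t)" "L2_on T (\<lambda>t. f' t \<star> g t)"
  shows "weak_derivative_on T (\<lambda>t. f t \<star> g t) (\<lambda>t. f t \<star> g' t + f' t \<star> g t)"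
  unfolding weak_derivative_on_def
proof
  fix T' assume T': "T' \<in> {0..T}"
  let ?h = "\<lambda>t. f t \<star> g' t + f' t \<star> g t"
  obtain C where C: "\<And>a b. norm (a \<star> b) \<le> norm a * norm b * C" "C > 0" using pos_bounded by blast
  have fc: "continuous_on {0..T} f" and gc: "continuous_on {0..T} g"
    using weak_derivative_on_continuous f g T by blast+
  have hL: "L2_on T ?h" using L by (rule L2_on_add)
  have hint: "?h integrable_on {s..t}" if "{s..t} \<subseteq> {0..T}" for s t
    using L2_on_integrable_sub(1)[OF hL that] .
  define k where "k t = norm (f' t) + norm (g' t)" for t
  have kint: "k integrable_on {s..t}" if "{s..t} \<subseteq> {0..T}" for s t
    unfolding k_def using that f g by (intro integrable_add L2_on_integrable_sub) auto
  define D where "D t = f t \<star> g t - integral {0..t} ?h" for t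
  have "D T' = D 0"
  proof (rule eq_if_small_oscillation[where K = "\<lambda>t. integral {0..t} k"])
    fix \<epsilon> :: real assume \<epsilon>: "\<epsilon> > 0"
    have e: "\<epsilon> / C > 0" using \<epsilon> C by simp
    have "uniformly_continuous_on {0..T} f" "uniformly_continuous_on {0..T} g"
      using fc gc by (auto intro: compact_uniformly_continuous)
    then obtain d1 d2 where d: "d1 > 0" "d2 > 0"
      and d1: "\<And>s t. s \<in> {0..T} \<Longrightarrow> t \<in> {0..T} \<Longrightarrow> dist s t < d1 \<Longrightarrow> dist (f s) (f t) < \<epsilon> / C"
      and d2: "\<And>s t. s \<in> {0..T} \<Longrightarrow> t \<in> {0..T} \<Longrightarrow> dist s t < d2 \<Longrightarrow> dist (g s) (g t) < \<epsilon> / C"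
      unfolding uniformly_continuous_on_def using e by metis
    show "\<exists>\<delta>>0. \<forall>s t. 0 \<le> s \<and> s \<le> t \<and> t \<le> T' \<and> t - s < \<delta> \<longrightarrow>
       norm (D t - D s) \<le> \<epsilon> * (integral {0..t} k - integral {0..s} k)"
    proof (intro exI[of _ "min d1 d2"] conjI allI impI)
      show "min d1 d2 > 0" using d by simp
      fix s t assume st: "0 \<le> s \<and> s \<le> t \<and> t \<le> T' \<and> t - s < min d1 d2"
      then have sub: "{s..t} \<subseteq> {0..T}" "{0..t} \<subseteq> {0..T}" and stT: "0 \<le> s" "s \<le> t" "t \<le> T" using T' by auto
      have comb: "integral {0..s} q + integral {s..t} q = integral {0..t} q" if "q integrable_on {0..t}" for q :: "real \<Rightarrow> 'z::banach"
        using st that by (intro Henstock_Kurzweil_Integration.integral_combine) auto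
      have "((\<lambda>\<tau>. f t \<star> g' \<tau>) has_integral (f t \<star> (g t - g s))) {s..t}"
        by (rule has_integral_linear[OF weak_derivative_on_interval[OF g(2) stT] bounded_linear_right, unfolded o_def])
      moreover have "((\<lambda>\<tau>. f' \<tau> \<star> g s) has_integral ((f t - f s) \<star> g s)) {s..t}"
        by (rule has_integral_linear[OF weak_derivative_on_interval[OF f(2) stT] bounded_linear_left, unfolded o_def])
      ultimately have "((\<lambda>\<tau>. f t \<star> g' \<tau> + f' \<tau> \<star> g s) has_integral (f t \<star> g t - f s \<star> g s)) {s..t}"
        by (auto dest: has_integral_add simp: diff_left diff_right)
      then have I: "((\<lambda>\<tau>. (f t \<star> g' \<tau> + f' \<tau> \<star> g s) - ?h \<tau>) has_integral (f t \<star> g t - f s \<star> g s - integral {s..t} ?h)) {s..t}"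
        by (intro has_integral_diff integrable_integral hint sub)
      have "D t - D s = f t \<star> g t - f s \<star> g s - integral {s..t} ?h"
        using comb[OF hint[OF sub(2)]] by (simp add: D_def algebra_simps)
      also have "\<dots> = integral {s..t} (\<lambda>\<tau>. (f t \<star> g' \<tau> + f' \<tau> \<star> g s) - ?h \<tau>)"
        using I by (simp add: integral_unique)
      also have "norm \<dots> \<le> integral {s..t} (\<lambda>\<tau>. \<epsilon> * k \<tau>)"
      proof (rule integral_norm_bound_integral)
        show "(\<lambda>\<tau>. (f t \<star> g' \<tau> + f' \<tau> \<star> g s) - ?h \<tau>) integrable_on {s..t}" using I by blast
        show "(\<lambda>\<tau>. \<epsilon> * k \<tau>) integrable_on {s..t}"
          using integrable_on_cmult_left[OF kint[OF sub(1)], of \<epsilon>] by simp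
        fix \<tau> assume \<tau>: "\<tau> \<in> {s..t}"
        have a: "norm ((f t - f \<tau>) \<star> g' \<tau>) \<le> \<epsilon> * norm (g' \<tau>)"
        proof -
          have "norm (f t - f \<tau>) \<le> \<epsilon> / C" using d1[of t \<tau>] \<tau> st sub by (force simp: dist_norm dist_real_def)
          then have "norm (f t - f \<tau>) * norm (g' \<tau>) * C \<le> \<epsilon> / C * norm (g' \<tau>) * C"
            using C(2) by (intro mult_right_mono) auto
          then show ?thesis using C(1)[of "f t - f \<tau>" "g' \<tau>"] C(2) by simp
        qed
        have b: "norm (f' \<tau> \<star> (g s - g \<tau>)) \<le> \<epsilon> * norm (f' \<tau>)"
        proof -
          have "norm (g s - g \<tau>) \<le> \<epsilon> / C" using d2[of s \<tau>] \<tau> st sub by (force simp: dist_norm dist_real_def)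
          then have "norm (f' \<tau>) * norm (g s - g \<tau>) * C \<le> norm (f' \<tau>) * (\<epsilon> / C) * C"
            using C(2) by (intro mult_right_mono mult_left_mono) auto
          then show ?thesis using C(1)[of "f' \<tau>" "g s - g \<tau>"] C(2) by (simp add: mult.commute)
        qed
        have "(f t \<star> g' \<tau> + f' \<tau> \<star> g s) - ?h \<tau> = (f t - f \<tau>) \<star> g' \<tau> + f' \<tau> \<star> (g s - g \<tau>)"
          by (simp add: diff_left diff_right)
        then show "norm ((f t \<star> g' \<tau> + f' \<tau> \<star> g s) - ?h \<tau>) \<le> \<epsilon> * k \<tau>"
          using norm_triangle_ineq[of "(f t - f \<tau>) \<star> g' \<tau>" "f' \<tau> \<star> (g s - g \<tau>)"] a b by (simp add: k_def distrib_left)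
      qed
      also have "\<dots> = \<epsilon> * (integral {0..t} k - integral {0..s} k)"
        using comb[OF kint[OF sub(2)], symmetric] by simp
      finally show "norm (D t - D s) \<le> \<epsilon> * (integral {0..t} k - integral {0..s} k)" .
    qed
  qed (use T' in auto)
  then have "integral {0..T'} ?h = f T' \<star> g T' - f 0 \<star> g 0" by (simp add: D_def algebra_simps)
  then show "(?h has_integral f T' \<star> g T' - f 0 \<star> g 0) {0..T'}"
    using integrable_integral[OF hint, of 0 T'] T' by auto
qed

end

lemma H1_on_prod_derivative:
  assumes bb: "bounded_bilinear \<beta>" and T: "0 \<le> T"
    and f: "L2_on T f'" "weak_derivative_on T f f'" and g: "L2_on T g'" "weak_derivative_on T g g'"
  shows "L2_on T (\<lambda>t. \<beta> (f t) (g' t) + \<beta> (f' t) (g t))"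
    and "weak_derivative_on T (\<lambda>t. \<beta> (f t) (g t)) (\<lambda>t. \<beta> (f t) (g' t) + \<beta> (f' t) (g t))"
proof -
  have c: "continuous_on {0..T} f" "continuous_on {0..T} g"
    using weak_derivative_on_continuous f g T by blast+
  have 1: "L2_on T (\<lambda>t. \<beta> (f t) (g' t))" using L2_on_prod_left[OF bb c(1) g(1)] .
  have 2: "L2_on T (\<lambda>t. \<beta> (f' t) (g t))"
    using L2_on_prod_left[OF bounded_bilinear.flip[OF bb] c(2) f(1)] .
  show "L2_on T (\<lambda>t. \<beta> (f t) (g' t) + \<beta> (f' t) (g t))" using 1 2 by (rule L2_on_add)
  show "weak_derivative_on T (\<lambda>t. \<beta> (f t) (g t)) (\<lambda>t. \<beta> (f t) (g' t) + \<beta> (f' t) (g t))"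
    by (rule weak_derivative_on_prod[OF bb T f g 1 2])
qed

lemma H1_on_prod:
  assumes "bounded_bilinear \<beta>" "0 \<le> T" "H1_on T f" "H1_on T g"
  shows "H1_on T (\<lambda>t. \<beta> (f t) (g t))"
  using assms H1_on_prod_derivative unfolding H1_on_def by metis

lemma weak_derivative_on_add:
  assumes "weak_derivative_on T f f'" "weak_derivative_on T g g'"
  shows "weak_derivative_on T (\<lambda>t. f t + g t) (\<lambda>t. f' t + g' t)"
  unfolding weak_derivative_on_def
proof
  fix t assume t: "t \<in> {0..T}"
  have "((\<lambda>t. f' t + g' t) has_integral (f t - f 0) + (g t - g 0)) {0..t}"
    by (rule has_integral_add[OF bspec[OF assms(1)[unfolded weak_derivative_on_def] t] bspec[OF assms(2)[unfolded weak_derivative_on_def] t]])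
  moreover have "(f t - f 0) + (g t - g 0) = f t + g t - (f 0 + g 0)" by simp
  ultimately show "((\<lambda>t. f' t + g' t) has_integral f t + g t - (f 0 + g 0)) {0..t}" by (simp only:)
qed

lemma weak_derivative_on_diff:
  assumes "weak_derivative_on T f f'" "weak_derivative_on T g g'"
  shows "weak_derivative_on T (\<lambda>t. f t - g t) (\<lambda>t. f' t - g' t)"
  unfolding weak_derivative_on_def
proof
  fix t assume t: "t \<in> {0..T}"
  have "((\<lambda>t. f' t - g' t) has_integral (f t - f 0) - (g t - g 0)) {0..t}"
    by (rule has_integral_diff[OF bspec[OF assms(1)[unfolded weak_derivative_on_def] t] bspec[OF assms(2)[unfolded weak_derivative_on_def] t]])
  moreover have "(f t - f 0) - (g t - g 0) = f t - g t - (f 0 - g 0)" by simp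
  ultimately show "((\<lambda>t. f' t - g' t) has_integral f t - g t - (f 0 - g 0)) {0..t}" by (simp only:)
qed

lemma H1_on_add: "H1_on T f \<Longrightarrow> H1_on T g \<Longrightarrow> H1_on T (\<lambda>t. f t + g t)"
  unfolding H1_on_def using L2_on_add weak_derivative_on_add by blast

lemma H1_on_classical:
  assumes "\<And>t. t \<in> {0..T} \<Longrightarrow> (f has_vector_derivative g t) (at t within {0..T})" "continuous_on {0..T} g"
  shows "H1_on T f"
  unfolding H1_on_def using weak_derivative_on_classical[OF assms(1)] L2_on_continuous[OF assms(2)] by blast

section \<open>Cauchy-Schwarz inequality and homogeneous Volterra inequalities\<close>

lemma integral_Cauchy_Schwarz:
  fixes f g :: "real \<Rightarrow> real"
  assumes "(\<lambda>x. (f x)\<^sup>2) integrable_on S" "(\<lambda>x. (g x)\<^sup>2) integrable_on S" "(\<lambda>x. f x * g x) integrable_on S"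
  shows "(integral S (\<lambda>x. f x * g x))\<^sup>2 \<le> integral S (\<lambda>x. (f x)\<^sup>2) * integral S (\<lambda>x. (g x)\<^sup>2)"
proof -
  define A B I where "A = integral S (\<lambda>x. (f x)\<^sup>2)" and "B = integral S (\<lambda>x. (g x)\<^sup>2)"
    and "I = integral S (\<lambda>x. f x * g x)"
  have q: "0 \<le> \<theta>\<^sup>2 * A - 2 * \<theta> * I + B" for \<theta>
  proof -
    have "((\<lambda>x. \<theta>\<^sup>2 * (f x)\<^sup>2 - 2 * \<theta> * (f x * g x) + (g x)\<^sup>2) has_integral (\<theta>\<^sup>2 * A - 2 * \<theta> * I + B)) S"
      unfolding A_def B_def I_def
      by (intro has_integral_add has_integral_diff has_integral_mult_right integrable_integral assms)
    moreover have "\<theta>\<^sup>2 * (f x)\<^sup>2 - 2 * \<theta> * (f x * g x) + (g x)\<^sup>2 = (\<theta> * f x - g x)\<^sup>2" for x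
      unfolding power2_diff power_mult_distrib by (simp add: mult.assoc)
    ultimately have "((\<lambda>x. (\<theta> * f x - g x)\<^sup>2) has_integral (\<theta>\<^sup>2 * A - 2 * \<theta> * I + B)) S" by simp
    then show ?thesis by (rule has_integral_nonneg) simp
  qed
  have A: "A \<ge> 0" unfolding A_def by (intro integral_nonneg assms) auto
  have "I\<^sup>2 \<le> A * B"
  proof (cases "A = 0")
    case True
    \<comment> \<open>For \<open>A = 0\<close> the quadratic polynomial degenerates to an affine
      one, and the chosen argument gives it the value -1.\<close>
    have "I = 0"
    proof (rule ccontr)
      assume "I \<noteq> 0"
      then have "2 * ((B + 1) / (2 * I)) * I = B + 1" by simp
      then show False using q[of "(B + 1) / (2 * I)"] True by (simp only: mult_zero_right)
    qed
    then show ?thesis using True by simp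
  next
    case False
    then have "A > 0" using A by simp
    have "0 \<le> (I / A)\<^sup>2 * A - 2 * (I / A) * I + B" by (rule q)
    also have "\<dots> = B - I\<^sup>2 / A" using \<open>A > 0\<close> by (simp add: power2_eq_square field_simps)
    finally show ?thesis using \<open>A > 0\<close> by (simp add: field_simps)
  qed
  then show ?thesis by (simp add: A_def B_def I_def)
qed

text \<open>The kernel \<open>k\<close> is square integrable but possibly unbounded, so Gronwall
  does not apply to \<phi> itself. Squaring and Cauchy-Schwarz turn \<open>k\<close> into the
  constant \<open>A\<close> and leave a Gronwall inequality for the integral \<open>u\<close> of the
  squared norm of \<phi>.\<close>

lemma volterra_unique:
  fixes \<phi> :: "real \<Rightarrow> 'a::euclidean_space"
  assumes \<phi>: "continuous_on {0..T} \<phi>" and k: "L2_on T k" and C: "0 \<le> C"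
    and le: "\<And>t. t \<in> {0..T} \<Longrightarrow> norm (\<phi> t) \<le> C * integral {0..t} (\<lambda>s. norm (k s) * norm (\<phi> s))"
    and t: "t \<in> {0..T}"
  shows "\<phi> t = 0"
proof -
  define A where "A = integral {0..T} (\<lambda>s. (norm (k s))\<^sup>2)"
  define u where "u t = integral {0..t} (\<lambda>s. (norm (\<phi> s))\<^sup>2)" for t
  have \<phi>c: "continuous_on {0..T} (\<lambda>s. (norm (\<phi> s))\<^sup>2)" using \<phi> by (intro continuous_intros)
  have bnd: "(norm (\<phi> t))\<^sup>2 \<le> (C\<^sup>2 * A) * u t" if t: "t \<in> {0..T}" for t
  proof -
    have sub: "{0..t} \<subseteq> {0..T}" using t by auto
    have k2: "(\<lambda>s. (norm (k s))\<^sup>2) integrable_on {0..t}"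
      using integrable_on_subinterval[OF L2_on_square_integrable[OF k] sub] .
    have \<phi>2: "(\<lambda>s. (norm (\<phi> s))\<^sup>2) integrable_on {0..t}"
      using continuous_on_subset[OF \<phi>c sub] by (rule integrable_continuous_real)
    have "L2_on T (\<lambda>s. norm (\<phi> s) *\<^sub>R k s)"
      by (intro L2_on_prod_left[OF bounded_bilinear_scaleR _ k] continuous_on_norm \<phi>)
    from L2_on_integrable_sub(2)[OF this sub]
    have k\<phi>: "(\<lambda>s. norm (k s) * norm (\<phi> s)) integrable_on {0..t}" by (simp add: mult.commute)
    have "(norm (\<phi> t))\<^sup>2 \<le> (C * integral {0..t} (\<lambda>s. norm (k s) * norm (\<phi> s)))\<^sup>2"
      using le[OF t] by (intro power_mono) auto
    also have "\<dots> \<le> C\<^sup>2 * (integral {0..t} (\<lambda>s. (norm (k s))\<^sup>2) * u t)"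
      unfolding power_mult_distrib u_def by (intro mult_left_mono integral_Cauchy_Schwarz k2 \<phi>2 k\<phi>) auto
    also have "\<dots> \<le> C\<^sup>2 * (A * u t)"
      unfolding A_def u_def
      by (intro mult_left_mono mult_right_mono integral_subset_le sub k2 L2_on_square_integrable k integral_nonneg \<phi>2) auto
    finally show ?thesis by (simp add: mult.assoc)
  qed
  have "u t \<le> 0"
  proof (rule gronwall_nonpos[where a = 0 and u = u and t = t and u' = "\<lambda>t. (norm (\<phi> t))\<^sup>2" and b = T and K = "C\<^sup>2 * A"])
    show "(u has_vector_derivative (norm (\<phi> s))\<^sup>2) (at s within {0..T})" if "s \<in> {0..T}" for s
      unfolding u_def by (intro integral_has_vector_derivative \<phi>c that)
  qed (use bnd t in \<open>auto simp: u_def\<close>)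
  moreover have "0 \<le> C\<^sup>2 * A"
    unfolding A_def by (intro mult_nonneg_nonneg integral_nonneg L2_on_square_integrable k) auto
  ultimately have "(C\<^sup>2 * A) * u t \<le> 0" by (simp add: mult_nonneg_nonpos)
  then show ?thesis using bnd[OF t] by (smt (verit) norm_le_zero_iff power2_less_eq_zero_iff zero_le_power2)
qed

section \<open>Coefficients and the Hamiltonian system\<close>

abbreviation cmv :: "real^'n^'m \<Rightarrow> complex^'n \<Rightarrow> complex^'m" (infixr "\<odot>" 75) where
  "A \<odot> v \<equiv> cmat A *v v"

lemma cmv_nth: "(A \<odot> v) $ i = (\<Sum>j\<in>UNIV. of_real (A $ i $ j) * v $ j)"
  by (simp add: matrix_vector_mult_def map_matrix_def)

lemma bounded_bilinear_cmv: "bounded_bilinear (\<lambda>(A::real^'n^'m) v. A \<odot> v)"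
  unfolding bilinear_conv_bounded_bilinear[symmetric] bilinear_def
  by (auto intro!: linearI simp: vec_eq_iff cmv_nth sum.distrib algebra_simps sum_distrib_left scaleR_conv_of_real[where 'a = complex])

lemma bounded_bilinear_matrix_vector: "bounded_bilinear (\<lambda>(A::real^'n^'m) v. A *v v)"
  unfolding bilinear_conv_bounded_bilinear[symmetric] bilinear_def
  by (auto intro!: linearI simp: vec_eq_iff matrix_vector_mult_def sum.distrib algebra_simps sum_distrib_left)

lemma cmv_scale: "A \<odot> (c *s v) = c *s (A \<odot> v)"
  by (simp add: vec_eq_iff cmv_nth sum_distrib_left algebra_simps)

lemma cmv_assoc: "A \<odot> (B \<odot> v) = (A ** B) \<odot> v"
proof -
  have "(A \<odot> (B \<odot> v)) $ i = ((A ** B) \<odot> v) $ i" for i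
  proof -
    have "(A \<odot> (B \<odot> v)) $ i = (\<Sum>j\<in>UNIV. \<Sum>k\<in>UNIV. of_real (A $ i $ j) * of_real (B $ j $ k) * v $ k)"
      by (simp add: cmv_nth sum_distrib_left mult.assoc)
    also have "\<dots> = (\<Sum>k\<in>UNIV. \<Sum>j\<in>UNIV. of_real (A $ i $ j) * of_real (B $ j $ k) * v $ k)"
      by (rule sum.swap)
    also have "\<dots> = ((A ** B) \<odot> v) $ i"
      by (simp add: cmv_nth matrix_matrix_mult_def sum_distrib_right)
    finally show ?thesis .
  qed
  then show ?thesis by (simp add: vec_eq_iff)
qed

lemma cmv_one: "(mat 1 :: real^'n^'n) \<odot> v = v"
  by (simp add: vec_eq_iff cmv_nth mat_def if_distrib[of of_real] if_distrib[of "\<lambda>x. x * _"] cong: if_cong)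

lemma continuous_on_cmv:
  assumes "continuous_on S A" "continuous_on S f"
  shows "continuous_on S (\<lambda>t. A t \<odot> f t)"
  using assms by (rule bounded_bilinear.continuous_on[OF bounded_bilinear_cmv])

lemma cmv_bound:
  fixes A :: "real \<Rightarrow> real^'n^'m"
  assumes "continuous_on {a..b} A"
  obtains K where "K \<ge> 0" "\<And>t (v::complex^'n). t \<in> {a..b} \<Longrightarrow> norm (A t \<odot> v) \<le> K * norm v"
proof -
  obtain C where C: "\<And>(A::real^'n^'m) v. norm (A \<odot> v) \<le> norm A * norm v * C" "C > 0"
    using bounded_bilinear.pos_bounded[OF bounded_bilinear_cmv] by blast
  have "bounded (A ` {a..b})" by (intro compact_imp_bounded compact_continuous_image assms) auto
  then obtain M where M: "M > 0" "\<And>t. t \<in> {a..b} \<Longrightarrow> norm (A t) \<le> M" unfolding bounded_pos by (metis imageI)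
  show thesis
  proof (rule that)
    show "M * C \<ge> 0" using M C by simp
    fix t and v :: "complex^'n" assume "t \<in> {a..b}"
    then have "norm (A t) * norm v * C \<le> M * norm v * C"
      using M C by (intro mult_right_mono) auto
    then show "norm (A t \<odot> v) \<le> (M * C) * norm v" using C(1)[of "A t" v] by (simp add: mult_ac)
  qed
qed

lemma bounded_bilinear_hermitian: "bounded_bilinear hermitian_inner"
  unfolding bilinear_conv_bounded_bilinear[symmetric] bilinear_def hermitian_inner_def
  by (auto intro!: linearI simp: sum.distrib algebra_simps sum_distrib_left scaleR_conv_of_real[where 'a = complex])

interpretation hi: bounded_bilinear hermitian_inner
  by (rule bounded_bilinear_hermitian)

lemma hermitian_scale_left: "hermitian_inner (c *s u) v = c * hermitian_inner u v"
  by (simp add: hermitian_inner_def sum_distrib_left algebra_simps)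

lemma hermitian_sym: "hermitian_inner v u = cnj (hermitian_inner u v)"
  by (simp add: hermitian_inner_def mult.commute)

lemma Re_hermitian: "Re (hermitian_inner u v) = u \<bullet> v"
  by (simp add: hermitian_inner_def inner_vec_def inner_complex_def)

lemma hermitian_eq_zero: "(\<And>w. hermitian_inner u w = 0) \<Longrightarrow> u = 0"
  by (metis Re_hermitian inner_eq_zero_iff zero_complex.sel(1))

lemma hermitian_adjoint: "hermitian_inner (A \<odot> u) v = hermitian_inner u (transpose A \<odot> v)"
proof -
  have "hermitian_inner (A \<odot> u) v = (\<Sum>i\<in>UNIV. \<Sum>j\<in>UNIV. of_real (A $ i $ j) * u $ j * cnj (v $ i))"
    by (simp add: hermitian_inner_def cmv_nth sum_distrib_right)
  also have "\<dots> = (\<Sum>j\<in>UNIV. \<Sum>i\<in>UNIV. of_real (A $ i $ j) * u $ j * cnj (v $ i))"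
    by (rule sum.swap)
  also have "\<dots> = hermitian_inner u (transpose A \<odot> v)"
    by (simp add: hermitian_inner_def cmv_nth transpose_def sum_distrib_left mult_ac)
  finally show ?thesis .
qed

lemma scaleR_vec_scale: "(r *\<^sub>R v :: complex^'n) = complex_of_real r *s v"
  by (simp add: vec_eq_iff scaleR_conv_of_real[where 'a = complex])

text \<open>The derivative is carried as an argument, so that sums, multiples and restrictions come
  with theirs, and the pieces of a broken function can have different one-sided derivatives at a
  common node.\<close>

definition C1_on :: "real \<Rightarrow> real \<Rightarrow> (real \<Rightarrow> 'a::real_normed_vector) \<Rightarrow> (real \<Rightarrow> 'a) \<Rightarrow> bool" where
  "C1_on s t x u \<longleftrightarrow> continuous_on {s..t} u \<and> (\<forall>\<tau>\<in>{s..t}. (x has_vector_derivative u \<tau>) (at \<tau> within {s..t}))"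

lemma C1_on_continuous: "C1_on s t x u \<Longrightarrow> continuous_on {s..t} x"
  unfolding C1_on_def continuous_on_eq_continuous_within
  by (auto intro: has_vector_derivative_continuous)

lemma C1_on_add: "C1_on s t x u \<Longrightarrow> C1_on s t w v \<Longrightarrow> C1_on s t (\<lambda>\<tau>. x \<tau> + w \<tau>) (\<lambda>\<tau>. u \<tau> + v \<tau>)"
  and C1_on_diff: "C1_on s t x u \<Longrightarrow> C1_on s t w v \<Longrightarrow> C1_on s t (\<lambda>\<tau>. x \<tau> - w \<tau>) (\<lambda>\<tau>. u \<tau> - v \<tau>)"
  unfolding C1_on_def by (auto intro!: continuous_intros derivative_intros)

lemma C1_on_scale:
  assumes "C1_on s t x u"
  shows "C1_on s t (\<lambda>\<tau>. c *s x \<tau>) (\<lambda>\<tau>. c *s (u \<tau> :: complex^'n))"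
proof -
  have bl: "bounded_linear (\<lambda>v::complex^'n. c *s v)"
    unfolding linear_conv_bounded_linear[symmetric]
    by (rule linearI) (auto simp: vec_eq_iff algebra_simps)
  show ?thesis
    using assms unfolding C1_on_def
    by (auto intro: bounded_linear.continuous_on[OF bl] bounded_linear.has_vector_derivative[OF bl])
qed

lemma C1_on_subset: "C1_on s t x u \<Longrightarrow> {s'..t'} \<subseteq> {s..t} \<Longrightarrow> C1_on s' t' x u"
  unfolding C1_on_def by (meson continuous_on_subset has_vector_derivative_within_subset subsetD)

lemma integral_sq_zero:
  fixes x :: "real \<Rightarrow> 'a::real_normed_vector"
  assumes "s < t" "continuous_on {s..t} x" "integral {s..t} (\<lambda>\<tau>. (norm (x \<tau>))\<^sup>2) \<le> 0" "\<tau> \<in> {s..t}"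
  shows "x \<tau> = 0"
proof -
  have c: "continuous_on {s..t} (\<lambda>\<tau>. (norm (x \<tau>))\<^sup>2)" using assms by (intro continuous_intros)
  have "integral {s..t} (\<lambda>\<tau>. (norm (x \<tau>))\<^sup>2) \<ge> 0"
    by (intro integral_nonneg integrable_continuous_real c) auto
  then have "((\<lambda>\<tau>. (norm (x \<tau>))\<^sup>2) has_integral 0) (cbox s t)"
    using assms(3) integrable_integral[OF integrable_continuous_real[OF c]] by simp
  from has_integral_0_cbox_imp_0[OF _ _ this, of \<tau>] c assms(1,4) show ?thesis by auto
qed

text \<open>The setting of the variational argument. With y = P x' + Q x as a second unknown the
  equation is a first-order system whose coefficients are built from P, Q, R and the inverse of P,
  all continuous.\<close>

locale sturm_liouville =
  fixes T :: real and P Q R :: "real \<Rightarrow> real^'n^'n"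
  assumes T: "T > 0"
    and P: "continuous_on {0..T} P" and Q: "continuous_on {0..T} Q" and R: "continuous_on {0..T} R"
    and Psym: "\<And>t. t \<in> {0..T} \<Longrightarrow> transpose (P t) = P t"
    and Rsym: "\<And>t. t \<in> {0..T} \<Longrightarrow> transpose (R t) = R t"
    and Ppos: "\<And>t v. t \<in> {0..T} \<Longrightarrow> v \<noteq> 0 \<Longrightarrow> v \<bullet> (P t *v v) > 0"
begin

text \<open>Positive definiteness becomes uniform in \<open>t\<close> by compactness of
  \<open>{0..T}\<close> times the unit sphere.\<close>

lemma P_coercive_real: "\<exists>p>0. \<forall>t\<in>{0..T}. \<forall>v. p * (norm v)\<^sup>2 \<le> v \<bullet> (P t *v v)"
proof -
  let ?S = "{0..T} \<times> sphere (0::real^'n) 1"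
  have "compact ?S" by (intro compact_Times) auto
  moreover obtain e :: "real^'n" where "norm e = 1" using vector_choose_size[of 1] by auto
  then have "?S \<noteq> {}" using T by (auto intro!: exI[of _ 0])
  moreover have "continuous_on ?S (\<lambda>z. snd z \<bullet> (P (fst z) *v snd z))"
  proof (intro continuous_on_inner)
    have "continuous_on ?S (\<lambda>z. P (fst z))"
      by (rule continuous_on_compose2[OF P]) (auto intro: continuous_on_fst continuous_on_id)
    then show "continuous_on ?S (\<lambda>z. P (fst z) *v snd z)"
      by (rule bounded_bilinear.continuous_on[OF bounded_bilinear_matrix_vector]) (auto intro: continuous_on_snd continuous_on_id)
  qed (auto intro: continuous_on_snd continuous_on_id)
  ultimately obtain z where z: "z \<in> ?S" "\<And>w. w \<in> ?S \<Longrightarrow> snd z \<bullet> (P (fst z) *v snd z) \<le> snd w \<bullet> (P (fst w) *v snd w)"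
    using continuous_attains_inf[of ?S "\<lambda>z. snd z \<bullet> (P (fst z) *v snd z)"] by blast
  define p where "p = snd z \<bullet> (P (fst z) *v snd z)"
  have "p > 0" unfolding p_def using z(1) by (intro Ppos) auto
  moreover have "p * (norm v)\<^sup>2 \<le> v \<bullet> (P t *v v)" if t: "t \<in> {0..T}" for t v
  proof (cases "v = 0")
    case False
    define w where "w = v /\<^sub>R norm v"
    have v: "v = norm v *\<^sub>R w" using False by (simp add: w_def)
    have "norm w = 1" using False by (simp add: w_def)
    then have "p \<le> w \<bullet> (P t *v w)" using z(2)[of "(t, w)"] t by (simp add: p_def)
    then have "(norm v)\<^sup>2 * p \<le> (norm v)\<^sup>2 * (w \<bullet> (P t *v w))" by (intro mult_left_mono) auto
    also have "\<dots> = v \<bullet> (P t *v v)"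
      unfolding arg_cong[OF v, of "\<lambda>v. v \<bullet> (P t *v v)"] by (simp add: matrix_vector_mult_scaleR power2_eq_square)
    finally show ?thesis by (simp add: mult.commute)
  qed simp
  ultimately show ?thesis by blast
qed

lemma P_coercive: "\<exists>p>0. \<forall>t\<in>{0..T}. \<forall>v. p * (norm v)\<^sup>2 \<le> (P t \<odot> v) \<bullet> v"
proof -
  obtain p where p: "p > 0" "\<And>t v. t \<in> {0..T} \<Longrightarrow> p * (norm v)\<^sup>2 \<le> v \<bullet> (P t *v v)"
    using P_coercive_real by blast
  have "p * (norm v)\<^sup>2 \<le> (P t \<odot> v) \<bullet> v" if t: "t \<in> {0..T}" for t v
  proof -
    define a where "a = (\<chi> i. Re (v $ i))"
    define b where "b = (\<chi> i. Im (v $ i))"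
    have "(norm v)\<^sup>2 = (norm a)\<^sup>2 + (norm b)\<^sup>2"
      by (simp add: power2_norm_eq_inner inner_vec_def inner_complex_def a_def b_def sum.distrib)
    moreover have "(P t \<odot> v) \<bullet> v = a \<bullet> (P t *v a) + b \<bullet> (P t *v b)"
      by (simp add: inner_vec_def inner_complex_def a_def b_def sum.distrib cmv_nth matrix_vector_mult_def mult.commute)
    ultimately show ?thesis using p(2)[OF t, of a] p(2)[OF t, of b] by (simp add: distrib_left)
  qed
  then show ?thesis using p(1) by blast
qed

definition S where "S t = matrix_inv (P t)"

lemma S_left: "t \<in> {0..T} \<Longrightarrow> S t \<odot> (P t \<odot> v) = v"
  and S_right: "t \<in> {0..T} \<Longrightarrow> P t \<odot> (S t \<odot> v) = v"
proof -
  assume t: "t \<in> {0..T}"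
  have "v = 0" if "P t *v v = 0" for v using Ppos[OF t, of v] that by auto
  then have "\<exists>B. B ** P t = mat 1" using matrix_left_invertible_ker[of "P t"] by blast
  then have "\<exists>B. P t ** B = mat 1 \<and> B ** P t = mat 1" using invertible_left_inverse unfolding invertible_def by blast
  then have inv: "P t ** S t = mat 1" "S t ** P t = mat 1"
    unfolding S_def matrix_inv_def using someI_ex[of "\<lambda>B. P t ** B = mat 1 \<and> B ** P t = mat 1"] by auto
  show "S t \<odot> (P t \<odot> v) = v" "P t \<odot> (S t \<odot> v) = v"
    unfolding cmv_assoc inv by (simp_all only: cmv_one)
qed

text \<open>Coercivity bounds the change of \<open>S t \<odot> f t\<close> by the residual of
  \<open>f t = P t \<odot> w\<close> at the fixed vector \<open>w = S s \<odot> f s\<close>, divided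
  by \<open>p\<close>. So only the continuity of \<open>P\<close> is used, not that of matrix
  inversion.\<close>

lemma continuous_on_S_mult:
  assumes U: "U \<subseteq> {0..T}" and f: "continuous_on U f"
  shows "continuous_on U (\<lambda>t. S t \<odot> f t)"
proof -
  obtain p where p: "p > 0" "\<And>t v. t \<in> {0..T} \<Longrightarrow> p * (norm v)\<^sup>2 \<le> (P t \<odot> v) \<bullet> v"
    using P_coercive by blast
  have pn: "p * norm v \<le> norm (P t \<odot> v)" if "t \<in> {0..T}" for t v
  proof (cases "v = 0")
    case False
    have "p * (norm v)\<^sup>2 \<le> norm (P t \<odot> v) * norm v" using p(2)[OF that, of v] norm_cauchy_schwarz order_trans by blast
    then show ?thesis using False by (simp add: power2_eq_square mult.assoc[symmetric])
  qed simp
  show ?thesis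
    unfolding continuous_on_def
  proof
    fix s assume s: "s \<in> U"
    let ?w = "S s \<odot> f s"
    have "((\<lambda>t. f t - P t \<odot> ?w) \<longlongrightarrow> f s - P s \<odot> ?w) (at s within U)"
      using s f continuous_on_subset[OF P U]
      by (intro tendsto_diff bounded_bilinear.tendsto[OF bounded_bilinear_cmv] tendsto_const) (auto simp: continuous_on_def)
    then have lim: "((\<lambda>t. norm (f t - P t \<odot> ?w) / p) \<longlongrightarrow> 0) (at s within U)"
      using S_right[of s] s U tendsto_divide[OF tendsto_norm tendsto_const, of _ _ _ p] p(1) by fastforce
    have ev: "eventually (\<lambda>t. norm (S t \<odot> f t - ?w) \<le> norm (f t - P t \<odot> ?w) / p) (at s within U)"
      unfolding eventually_at_filter
    proof (intro always_eventually allI impI)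
      fix t assume "t \<in> U"
      then have t: "t \<in> {0..T}" using U by auto
      have "P t \<odot> (S t \<odot> f t - ?w) = f t - P t \<odot> ?w"
        using bounded_bilinear.diff_right[OF bounded_bilinear_cmv] S_right[OF t] by metis
      then show "norm (S t \<odot> f t - ?w) \<le> norm (f t - P t \<odot> ?w) / p"
        using pn[OF t, of "S t \<odot> f t - ?w"] p(1) by (simp add: pos_le_divide_eq mult.commute)
    qed
    have "((\<lambda>t. S t \<odot> f t - ?w) \<longlongrightarrow> 0) (at s within U)"
      by (intro Lim_null_comparison[OF ev] lim)
    then show "((\<lambda>t. S t \<odot> f t) \<longlongrightarrow> ?w) (at s within U)" by (rule LIM_zero_cancel)
  qed
qed

lemma continuous_on_S: "continuous_on {0..T} S"
proof -
  have "continuous_on {0..T} (\<lambda>t. S t $ i $ j)" for i j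
  proof -
    have "continuous_on {0..T} (\<lambda>t. Re ((S t \<odot> axis j 1) $ i))"
      by (intro continuous_on_Re continuous_on_component continuous_on_S_mult) auto
    then show ?thesis
      by (simp add: cmv_nth axis_def if_distrib cong: if_cong)
  qed
  then have "continuous_on {0..T} (\<lambda>t. \<chi> i j. S t $ i $ j)" by (intro continuous_on_vec_lambda)
  then show ?thesis by simp
qed

text \<open>Legendre transformation: \<open>mom\<close> is the momentum y as a function of x and its
  derivative, \<open>vel\<close> recovers the derivative from x and y, and \<open>frc\<close> is the
  value that the eigenvalue equation with parameter \<open>l\<close> prescribes for the derivative
  of y.\<close>

definition mom where "mom t x u = P t \<odot> u + Q t \<odot> x"
definition frc where "frc l t x u = transpose (Q t) \<odot> u + R t \<odot> x - l *\<^sub>R x" for l :: real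
definition vel where "vel t x y = S t \<odot> (y - Q t \<odot> x)"

lemma mom_vel: "t \<in> {0..T} \<Longrightarrow> mom t x (vel t x y) = y"
  by (simp add: mom_def vel_def S_right)

lemma vel_mom: "t \<in> {0..T} \<Longrightarrow> vel t x (mom t x u) = u"
  by (simp add: mom_def vel_def S_left)

lemmas cmv_simps = bounded_bilinear.add_right[OF bounded_bilinear_cmv] bounded_bilinear.diff_right[OF bounded_bilinear_cmv]
  bounded_bilinear.zero_right[OF bounded_bilinear_cmv] cmv_scale

lemma mom_add: "mom t (x + w) (u + v) = mom t x u + mom t w v"
  and mom_scale: "mom t (c *s x) (c *s u) = c *s mom t x u"
  and frc_add: "frc l t (x + w) (u + v) = frc l t x u + frc l t w v"
  and frc_diff: "frc l t (x - w) (u - v) = frc l t x u - frc l t w v"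
  and frc_scale: "frc l t (c *s x) (c *s u) = c *s frc l t x u"
  and vel_add: "vel t (x + w) (y + z) = vel t x y + vel t w z"
  and vel_diff: "vel t (x - w) (y - z) = vel t x y - vel t w z"
  and vel_scale: "vel t (c *s x) (c *s y) = c *s vel t x y"
  by (simp_all add: mom_def frc_def vel_def cmv_simps algebra_simps vec.scale_right_distrib vec.scale_right_diff_distrib
      scaleR_vec_scale vector_smult_assoc mult.commute)

lemma continuous_on_transpose: "continuous_on U A \<Longrightarrow> continuous_on U (\<lambda>t. transpose (A t) :: real^'n^'n)"
  unfolding transpose_def by (intro continuous_on_vec_lambda continuous_on_component)

lemma continuous_on_mom: "U \<subseteq> {0..T} \<Longrightarrow> continuous_on U x \<Longrightarrow> continuous_on U u \<Longrightarrow> continuous_on U (\<lambda>t. mom t (x t) (u t))"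
  and continuous_on_frc: "U \<subseteq> {0..T} \<Longrightarrow> continuous_on U x \<Longrightarrow> continuous_on U u \<Longrightarrow> continuous_on U (\<lambda>t. frc l t (x t) (u t))"
  and continuous_on_vel: "U \<subseteq> {0..T} \<Longrightarrow> continuous_on U x \<Longrightarrow> continuous_on U u \<Longrightarrow> continuous_on U (\<lambda>t. vel t (x t) (u t))"
proof -
  assume U: "U \<subseteq> {0..T}" and c: "continuous_on U x" "continuous_on U u"
  note PQR = continuous_on_subset[OF P U] continuous_on_subset[OF Q U] continuous_on_subset[OF R U]
  show "continuous_on U (\<lambda>t. mom t (x t) (u t))"
    unfolding mom_def by (intro continuous_on_add continuous_on_cmv PQR c)
  show "continuous_on U (\<lambda>t. frc l t (x t) (u t))"
    unfolding frc_def by (intro continuous_on_add continuous_on_diff continuous_on_cmv continuous_on_scaleR continuous_on_const continuous_on_transpose PQR c)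
  show "continuous_on U (\<lambda>t. vel t (x t) (u t))"
    unfolding vel_def by (intro continuous_on_S_mult U continuous_on_diff continuous_on_cmv PQR c)
qed

end

section \<open>Energy form and boundary value problems\<close>

context sturm_liouville
begin

text \<open>Density of the energy form shifted by \<open>l\<close>. The velocities \<open>u\<close>
  and \<open>v\<close> are independent arguments, so its algebraic properties are pointwise
  identities.\<close>

definition dens where "dens l t x u w v = hermitian_inner (mom t x u) v + hermitian_inner (frc l t x u) w"
definition bform where "bform l s t x u w v = integral {s..t} (\<lambda>\<tau>. dens l \<tau> (x \<tau>) (u \<tau>) (w \<tau>) (v \<tau>))"

lemma dens_expand:
  "dens l t x u w v = hermitian_inner (P t \<odot> u) v + hermitian_inner (Q t \<odot> x) v
     + hermitian_inner (transpose (Q t) \<odot> u) w + hermitian_inner (R t \<odot> x) w - of_real l * hermitian_inner x w"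
  by (simp add: dens_def mom_def frc_def hi.add_left hi.diff_left hi.scaleR_left scaleR_conv_of_real[where 'a = complex])

lemma dens_sym:
  assumes t: "t \<in> {0..T}"
  shows "dens l t w v x u = cnj (dens l t x u w v)"
proof -
  have a: "hermitian_inner (A \<odot> a) b = cnj (hermitian_inner (transpose A \<odot> b) a)" for A :: "real^'n^'n" and a b
    using hermitian_adjoint[of A a b] hermitian_sym[of a "transpose A \<odot> b"] by simp
  show ?thesis
    unfolding dens_expand
    using a[of "P t" v u] a[of "Q t" w u] a[of "transpose (Q t)" v x] a[of "R t" w x] hermitian_sym[of x w]
    by (simp add: Psym[OF t] Rsym[OF t] add_ac)
qed

lemma dens_add: "dens l t (x + x') (u + u') w v = dens l t x u w v + dens l t x' u' w v"
  and dens_scale: "dens l t (c *s x) (c *s u) w v = c * dens l t x u w v"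
  and dens_shift: "dens (l + m) t x u w v = dens l t x u w v - of_real m * hermitian_inner x w"
  unfolding dens_def mom_add mom_scale frc_add frc_scale
  by (simp_all add: hi.add_left hermitian_scale_left algebra_simps frc_def hi.diff_left hi.scaleR_left scaleR_conv_of_real[where 'a = complex])

lemma continuous_on_dens:
  assumes "U \<subseteq> {0..T}" "continuous_on U x" "continuous_on U u" "continuous_on U w" "continuous_on U v"
  shows "continuous_on U (\<lambda>t. dens l t (x t) (u t) (w t) (v t))"
  unfolding dens_def
  by (intro continuous_on_add hi.continuous_on continuous_on_mom continuous_on_frc assms)

lemma dens_integrable:
  assumes "{s..t} \<subseteq> {0..T}" "C1_on s t x u" "C1_on s t w v"
  shows "(\<lambda>\<tau>. dens l \<tau> (x \<tau>) (u \<tau>) (w \<tau>) (v \<tau>)) integrable_on {s..t}"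
  using assms C1_on_continuous[OF assms(2)] C1_on_continuous[OF assms(3)]
  by (intro integrable_continuous_real continuous_on_dens) (auto simp: C1_on_def)

lemma bform_add:
  assumes "{s..t} \<subseteq> {0..T}" "C1_on s t x u" "C1_on s t x' u'" "C1_on s t w v"
  shows "bform l s t (\<lambda>\<tau>. x \<tau> + x' \<tau>) (\<lambda>\<tau>. u \<tau> + u' \<tau>) w v = bform l s t x u w v + bform l s t x' u' w v"
  unfolding bform_def dens_add by (intro Henstock_Kurzweil_Integration.integral_add dens_integrable assms)

lemma bform_sym:
  assumes "{s..t} \<subseteq> {0..T}" "C1_on s t x u" "C1_on s t w v"
  shows "bform l s t w v x u = cnj (bform l s t x u w v)"
proof -
  have "cnj (bform l s t x u w v) = integral {s..t} (\<lambda>\<tau>. cnj (dens l \<tau> (x \<tau>) (u \<tau>) (w \<tau>) (v \<tau>)))"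
    unfolding bform_def
    using integral_linear[OF dens_integrable[OF assms] bounded_linear_cnj, of l] by (simp add: o_def)
  also have "\<dots> = bform l s t w v x u"
    unfolding bform_def using assms(1) by (intro integral_cong dens_sym[symmetric]) auto
  finally show ?thesis by simp
qed

lemma bform_scale: "bform l s t (\<lambda>\<tau>. c *s x \<tau>) (\<lambda>\<tau>. c *s u \<tau>) w v = c * bform l s t x u w v"
  unfolding bform_def dens_scale by simp

lemma bform_shift:
  assumes "{s..t} \<subseteq> {0..T}" "C1_on s t x u" "C1_on s t w v"
  shows "bform (l + m) s t x u w v = bform l s t x u w v - of_real m * integral {s..t} (\<lambda>\<tau>. hermitian_inner (x \<tau>) (w \<tau>))"
proof -
  have "(\<lambda>\<tau>. hermitian_inner (x \<tau>) (w \<tau>)) integrable_on {s..t}"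
    by (intro integrable_continuous_real hi.continuous_on C1_on_continuous[OF assms(2)] C1_on_continuous[OF assms(3)])
  then have "((\<lambda>\<tau>. dens l \<tau> (x \<tau>) (u \<tau>) (w \<tau>) (v \<tau>) - of_real m * hermitian_inner (x \<tau>) (w \<tau>)) has_integral
     bform l s t x u w v - of_real m * integral {s..t} (\<lambda>\<tau>. hermitian_inner (x \<tau>) (w \<tau>))) {s..t}"
    unfolding bform_def
    by (intro has_integral_diff has_integral_mult_right integrable_integral dens_integrable assms)
  then show ?thesis unfolding bform_def dens_shift by (rule integral_unique)
qed

lemma Re_bform:
  assumes "{s..t} \<subseteq> {0..T}" "C1_on s t x u" "C1_on s t w v"
  shows "((\<lambda>\<tau>. Re (dens l \<tau> (x \<tau>) (u \<tau>) (w \<tau>) (v \<tau>))) has_integral Re (bform l s t x u w v)) {s..t}"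
  using has_integral_linear[OF integrable_integral[OF dens_integrable[OF assms]] bounded_linear_Re]
  by (simp add: bform_def o_def)

text \<open>The mixed term from \<open>Q\<close> is absorbed by half of the coercivity of
  \<open>P\<close> on completing the square. Both constants are independent of
  \<open>l\<close>.\<close>

lemma dens_lower: "\<exists>p C. p > 0 \<and> (\<forall>l. \<forall>t\<in>{0..T}. \<forall>x u. p * (norm u)\<^sup>2 - (C + l) * (norm x)\<^sup>2 \<le> Re (dens l t x u x u))"
proof -
  obtain p where p: "p > 0" "\<And>t v. t \<in> {0..T} \<Longrightarrow> p * (norm v)\<^sup>2 \<le> (P t \<odot> v) \<bullet> v"
    using P_coercive by blast
  obtain KQ where KQ: "KQ \<ge> 0" "\<And>t v. t \<in> {0..T} \<Longrightarrow> norm (Q t \<odot> v) \<le> KQ * norm v"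
    using cmv_bound[OF Q] by metis
  obtain KR where KR: "KR \<ge> 0" "\<And>t v. t \<in> {0..T} \<Longrightarrow> norm (R t \<odot> v) \<le> KR * norm v"
    using cmv_bound[OF R] by metis
  have "p/2 * (norm u)\<^sup>2 - ((2 * KQ\<^sup>2 / p + KR) + l) * (norm x)\<^sup>2 \<le> Re (dens l t x u x u)"
    if t: "t \<in> {0..T}" for l t x u
  proof -
    have "Re (hermitian_inner (transpose (Q t) \<odot> u) x) = (Q t \<odot> x) \<bullet> u"
      using hermitian_adjoint[of "transpose (Q t)" u x] by (simp add: Re_hermitian inner_commute transpose_transpose)
    then have "Re (dens l t x u x u) = (P t \<odot> u) \<bullet> u + 2 * ((Q t \<odot> x) \<bullet> u) + (R t \<odot> x) \<bullet> x - l * (norm x)\<^sup>2"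
      by (simp add: dens_expand Re_hermitian dot_square_norm)
    moreover have "\<bar>(Q t \<odot> x) \<bullet> u\<bar> \<le> KQ * norm x * norm u"
      using Cauchy_Schwarz_ineq2[of "Q t \<odot> x" u] mult_right_mono[OF KQ(2)[OF t, of x], of "norm u"] by simp
    moreover have "\<bar>(R t \<odot> x) \<bullet> x\<bar> \<le> KR * (norm x)\<^sup>2"
      using Cauchy_Schwarz_ineq2[of "R t \<odot> x" x] mult_right_mono[OF KR(2)[OF t, of x], of "norm x"]
      by (simp add: power2_eq_square mult.assoc)
    moreover have "2 * (KQ * norm x * norm u) \<le> p/2 * (norm u)\<^sup>2 + 2 * KQ\<^sup>2 / p * (norm x)\<^sup>2"
    proof -
      have "0 \<le> (p * norm u - 2 * KQ * norm x)\<^sup>2 / (2 * p)" using p(1) by simp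
      also have "\<dots> = p/2 * (norm u)\<^sup>2 + 2 * KQ\<^sup>2 / p * (norm x)\<^sup>2 - 2 * (KQ * norm x * norm u)"
        using p(1) by (simp add: power2_eq_square field_simps)
      finally show ?thesis by simp
    qed
    ultimately show ?thesis using p(2)[OF t, of u] by (simp add: algebra_simps abs_le_iff)
  qed
  then show ?thesis using p(1) by (intro exI[of _ "p/2"] exI[of _ "2 * KQ\<^sup>2 / p + KR"]) auto
qed

text \<open>Adding the null Lagrangian \<open>(\<phi> |x|\<^sup>2)'\<close> with an affine \<open>\<phi>\<close> turns the energy density into a
  pointwise nonnegative expression.\<close>

lemma bform_lower:
  obtains p C where "p > 0"
    "\<And>l s t x u \<alpha> \<beta>. s \<le> t \<Longrightarrow> {s..t} \<subseteq> {0..T} \<Longrightarrow> C1_on s t x u \<Longrightarrow>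
      (\<And>\<tau>. \<tau> \<in> {s..t} \<Longrightarrow> (\<alpha> + \<beta> * \<tau>)\<^sup>2 \<le> p * (- (C + l) - \<beta> - 1)) \<Longrightarrow>
      (\<alpha> + \<beta> * t) * (norm (x t))\<^sup>2 - (\<alpha> + \<beta> * s) * (norm (x s))\<^sup>2 + integral {s..t} (\<lambda>\<tau>. (norm (x \<tau>))\<^sup>2)
        \<le> Re (bform l s t x u x u)"
proof -
  obtain p C where p: "p > 0" and low: "\<And>l t x u. t \<in> {0..T} \<Longrightarrow> p * (norm u)\<^sup>2 - (C + l) * (norm x)\<^sup>2 \<le> Re (dens l t x u x u)"
    using dens_lower by blast
  have main: "(\<alpha> + \<beta> * t) * (norm (x t))\<^sup>2 - (\<alpha> + \<beta> * s) * (norm (x s))\<^sup>2 + integral {s..t} (\<lambda>\<tau>. (norm (x \<tau>))\<^sup>2)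
        \<le> Re (bform l s t x u x u)"
    if st: "s \<le> t" "{s..t} \<subseteq> {0..T}" and C1: "C1_on s t x u"
      and small: "\<And>\<tau>. \<tau> \<in> {s..t} \<Longrightarrow> (\<alpha> + \<beta> * \<tau>)\<^sup>2 \<le> p * (- (C + l) - \<beta> - 1)" for l s t x u \<alpha> \<beta>
  proof -
    let ?g = "\<lambda>\<tau>. \<beta> * (norm (x \<tau>))\<^sup>2 + (\<alpha> + \<beta> * \<tau>) * (2 * (x \<tau> \<bullet> u \<tau>))"
    have "(?g has_integral (\<alpha> + \<beta> * t) * (x t \<bullet> x t) - (\<alpha> + \<beta> * s) * (x s \<bullet> x s)) {s..t}"
    proof (rule fundamental_theorem_of_calculus[OF st(1)])
      fix \<tau> assume "\<tau> \<in> {s..t}"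
      then have d: "(x has_vector_derivative u \<tau>) (at \<tau> within {s..t})" using C1 by (auto simp: C1_on_def)
      have "((\<lambda>\<tau>. x \<tau> \<bullet> x \<tau>) has_vector_derivative x \<tau> \<bullet> u \<tau> + u \<tau> \<bullet> x \<tau>) (at \<tau> within {s..t})"
        by (rule bounded_bilinear.has_vector_derivative[OF bounded_bilinear_inner d d])
      then have "((\<lambda>\<tau>. (\<alpha> + \<beta> * \<tau>) * (x \<tau> \<bullet> x \<tau>)) has_vector_derivative
          (\<alpha> + \<beta> * \<tau>) * (x \<tau> \<bullet> u \<tau> + u \<tau> \<bullet> x \<tau>) + \<beta> * (x \<tau> \<bullet> x \<tau>)) (at \<tau> within {s..t})"
        unfolding has_real_derivative_iff_has_vector_derivative[symmetric]
        by (auto intro!: derivative_eq_intros)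
      then show "((\<lambda>\<tau>. (\<alpha> + \<beta> * \<tau>) * (x \<tau> \<bullet> x \<tau>)) has_vector_derivative ?g \<tau>) (at \<tau> within {s..t})"
        by (simp add: inner_commute dot_square_norm add.commute)
    qed
    moreover have "((\<lambda>\<tau>. (norm (x \<tau>))\<^sup>2) has_integral integral {s..t} (\<lambda>\<tau>. (norm (x \<tau>))\<^sup>2)) {s..t}"
      by (intro integrable_integral integrable_continuous_real continuous_intros C1_on_continuous[OF C1])
    ultimately have "((\<lambda>\<tau>. ?g \<tau> + (norm (x \<tau>))\<^sup>2) has_integral ((\<alpha> + \<beta> * t) * (x t \<bullet> x t) - (\<alpha> + \<beta> * s) * (x s \<bullet> x s)
       + integral {s..t} (\<lambda>\<tau>. (norm (x \<tau>))\<^sup>2))) {s..t}"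
      by (rule has_integral_add)
    moreover have "?g \<tau> + (norm (x \<tau>))\<^sup>2 \<le> Re (dens l \<tau> (x \<tau>) (u \<tau>) (x \<tau>) (u \<tau>))" if \<tau>: "\<tau> \<in> {s..t}" for \<tau>
    proof -
      define \<phi> where "\<phi> = \<alpha> + \<beta> * \<tau>"
      \<comment> \<open>Here \<beta> comes from differentiating the affine weight, and the final 1
        pays for the integral of the squared norm on the left of the claim.\<close>
      define k where "k = - (C + l) - \<beta> - 1"
      \<comment> \<open>The assumption on the weight is the discriminant condition that \<phi>
        squared is at most \<open>p * k\<close>; the quadratic form in \<open>u \<tau>\<close> and
        \<open>x \<tau>\<close>, multiplied by \<open>p\<close>, then dominates this square.\<close>
      have "0 \<le> (norm (p *\<^sub>R u \<tau> - \<phi> *\<^sub>R x \<tau>))\<^sup>2" by simp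
      also have "\<dots> = p * (p * (norm (u \<tau>))\<^sup>2 - 2 * \<phi> * (x \<tau> \<bullet> u \<tau>)) + \<phi>\<^sup>2 * (norm (x \<tau>))\<^sup>2"
        unfolding power2_norm_eq_inner
        by (simp add: inner_diff_left inner_diff_right inner_commute[of "u \<tau>" "x \<tau>"] power2_eq_square algebra_simps)
      also have "\<dots> \<le> p * (p * (norm (u \<tau>))\<^sup>2 - 2 * \<phi> * (x \<tau> \<bullet> u \<tau>)) + (p * k) * (norm (x \<tau>))\<^sup>2"
        using small[OF \<tau>] unfolding \<phi>_def k_def
        by (intro add_left_mono mult_right_mono) auto
      also have "\<dots> = p * (p * (norm (u \<tau>))\<^sup>2 - 2 * \<phi> * (x \<tau> \<bullet> u \<tau>) + k * (norm (x \<tau>))\<^sup>2)" by (simp add: algebra_simps)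
      finally have "0 \<le> p * (norm (u \<tau>))\<^sup>2 - 2 * \<phi> * (x \<tau> \<bullet> u \<tau>) + k * (norm (x \<tau>))\<^sup>2"
        using p by (simp add: zero_le_mult_iff)
      moreover have "p * (norm (u \<tau>))\<^sup>2 - (C + l) * (norm (x \<tau>))\<^sup>2 \<le> Re (dens l \<tau> (x \<tau>) (u \<tau>) (x \<tau>) (u \<tau>))"
        using low \<tau> st by auto
      ultimately show ?thesis unfolding k_def \<phi>_def by (simp add: algebra_simps)
    qed
    ultimately have "(\<alpha> + \<beta> * t) * (x t \<bullet> x t) - (\<alpha> + \<beta> * s) * (x s \<bullet> x s) + integral {s..t} (\<lambda>\<tau>. (norm (x \<tau>))\<^sup>2)
       \<le> Re (bform l s t x u x u)"
      using has_integral_le[OF _ Re_bform[OF st(2) C1 C1]] by blast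
    then show ?thesis by (simp add: dot_square_norm)
  qed
  show thesis by (rule that[OF p main])
qed

text \<open>Quantitative absence of conjugate points: on the piece the Dirichlet form dominates the
  L^2 norm, so extremals are unique and minimizing.\<close>

definition good where
  "good l s t \<longleftrightarrow> 0 \<le> s \<and> s < t \<and> t \<le> T \<and>
    (\<forall>x u. C1_on s t x u \<longrightarrow> x s = 0 \<longrightarrow> x t = 0 \<longrightarrow> integral {s..t} (\<lambda>\<tau>. (norm (x \<tau>))\<^sup>2) \<le> Re (bform l s t x u x u))"

text \<open>The weight falls with slope \<open>- b\<close> from 0 at \<open>s\<close>; its boundary
  terms vanish with \<open>x\<close>. A large \<open>b\<close> outweighs \<open>C + l\<close>, and
  the price, a weight of size at most \<open>sqrt p\<close>, restricts the length of the interval.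
  The same length serves all \<open>l \<le> M\<close>.\<close>

lemma short_good: "\<exists>h>0. \<forall>l\<le>M. \<forall>s t. 0 \<le> s \<longrightarrow> s < t \<longrightarrow> t \<le> T \<longrightarrow> t - s \<le> h \<longrightarrow> good l s t"
proof -
  obtain p C where p: "p > 0" and low: "\<And>l s t x u \<alpha> \<beta>. s \<le> t \<Longrightarrow> {s..t} \<subseteq> {0..T} \<Longrightarrow> C1_on s t x u \<Longrightarrow>
      (\<And>\<tau>. \<tau> \<in> {s..t} \<Longrightarrow> (\<alpha> + \<beta> * \<tau>)\<^sup>2 \<le> p * (- (C + l) - \<beta> - 1)) \<Longrightarrow>
      (\<alpha> + \<beta> * t) * (norm (x t))\<^sup>2 - (\<alpha> + \<beta> * s) * (norm (x s))\<^sup>2 + integral {s..t} (\<lambda>\<tau>. (norm (x \<tau>))\<^sup>2)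
        \<le> Re (bform l s t x u x u)"
    using bform_lower by metis
  \<comment> \<open>The summand 2 makes \<open>- (C + l) + b - 1\<close> at least 1 for
    \<open>l \<le> M\<close>.\<close>
  define b where "b = max 0 (C + M) + 2"
  have b: "b > 0" "b \<ge> C + M + 2" by (auto simp: b_def)
  show ?thesis
  proof (intro exI[of _ "sqrt p / b"] conjI allI impI)
    show "sqrt p / b > 0" using p b by simp
    fix l s t assume l: "l \<le> M" and st: "0 \<le> s" "s < t" "t \<le> T" "t - s \<le> sqrt p / b"
    show "good l s t"
      unfolding good_def
    proof (intro conjI allI impI st)
      fix x u :: "real \<Rightarrow> complex^'n" assume C1: "C1_on s t x u" and z: "x s = 0" "x t = 0"
      have \<phi>: "(b * s + (- b) * \<tau>)\<^sup>2 \<le> p * (- (C + l) - (- b) - 1)" if \<tau>: "\<tau> \<in> {s..t}" for \<tau>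
      proof -
        have "b * (\<tau> - s) \<le> b * (sqrt p / b)" using \<tau> st b by (intro mult_left_mono) auto
        then have "(b * (\<tau> - s))\<^sup>2 \<le> (sqrt p)\<^sup>2" using \<tau> b by (intro power_mono) auto
        also have "\<dots> = p * 1" using p by simp
        also have "\<dots> \<le> p * (- (C + l) - (- b) - 1)" using p b l by (intro mult_left_mono) auto
        also have "(b * (\<tau> - s))\<^sup>2 = (b * s + (- b) * \<tau>)\<^sup>2" by (simp add: power2_eq_square algebra_simps)
        finally show ?thesis .
      qed
      have "s \<le> t" "{s..t} \<subseteq> {0..T}" using st by auto
      from low[of s t x u "b * s" "- b" l, OF this C1 \<phi>] show "integral {s..t} (\<lambda>\<tau>. (norm (x \<tau>))\<^sup>2) \<le> Re (bform l s t x u x u)"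
        using z by simp
    qed
  qed
qed

text \<open>One weight for the whole interval, rising linearly from \<open>- B\<close> at 0 to
  \<open>B\<close> at \<open>T\<close>. On the pieces of a partition its boundary terms telescope to
  \<open>B\<close> times the sum of the squared norms of both end values, enough to absorb a
  boundary form of that size.\<close>

lemma boundary_lower:
  assumes B: "B \<ge> 0"
  shows "\<exists>c. \<forall>l\<le>c. \<forall>s t x u. 0 \<le> s \<longrightarrow> s \<le> t \<longrightarrow> t \<le> T \<longrightarrow> C1_on s t x u \<longrightarrow>
    B * (2 * t / T - 1) * (norm (x t))\<^sup>2 - B * (2 * s / T - 1) * (norm (x s))\<^sup>2 + integral {s..t} (\<lambda>\<tau>. (norm (x \<tau>))\<^sup>2)
      \<le> Re (bform l s t x u x u)"
proof -
  obtain p C where p: "p > 0" and low: "\<And>l s t x u \<alpha> \<beta>. s \<le> t \<Longrightarrow> {s..t} \<subseteq> {0..T} \<Longrightarrow> C1_on s t x u \<Longrightarrow>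
      (\<And>\<tau>. \<tau> \<in> {s..t} \<Longrightarrow> (\<alpha> + \<beta> * \<tau>)\<^sup>2 \<le> p * (- (C + l) - \<beta> - 1)) \<Longrightarrow>
      (\<alpha> + \<beta> * t) * (norm (x t))\<^sup>2 - (\<alpha> + \<beta> * s) * (norm (x s))\<^sup>2 + integral {s..t} (\<lambda>\<tau>. (norm (x \<tau>))\<^sup>2)
        \<le> Re (bform l s t x u x u)"
    using bform_lower by metis
  show ?thesis
  \<comment> \<open>This threshold is the requirement that
    \<open>p * (- (C + l) - 2 * B / T - 1)\<close> be at least the square of \<open>B\<close>,
    solved for \<open>l\<close>.\<close>
  proof (intro exI[of _ "- C - 2 * B / T - 1 - B\<^sup>2 / p"] allI impI)
    fix l s t and x u :: "real \<Rightarrow> complex^'n" assume l: "l \<le> - C - 2 * B / T - 1 - B\<^sup>2 / p" and st: "0 \<le> s" "s \<le> t" "t \<le> T" and C1: "C1_on s t x u"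
    have \<phi>: "(- B + (2 * B / T) * \<tau>)\<^sup>2 \<le> p * (- (C + l) - 2 * B / T - 1)" if \<tau>: "\<tau> \<in> {s..t}" for \<tau>
    proof -
      have "\<bar>2 * \<tau> / T - 1\<bar> \<le> 1" using \<tau> st T by (auto simp: abs_le_iff field_simps)
      then have "\<bar>B * (2 * \<tau> / T - 1)\<bar> \<le> B" using B by (simp add: abs_mult mult_left_le)
      then have "(B * (2 * \<tau> / T - 1))\<^sup>2 \<le> B\<^sup>2" using abs_le_square_iff[of "B * (2 * \<tau> / T - 1)" B] B by simp
      also have "\<dots> = p * (B\<^sup>2 / p)" using p by simp
      also have "\<dots> \<le> p * (- (C + l) - 2 * B / T - 1)" using l p by (intro mult_left_mono) auto
      also have "B * (2 * \<tau> / T - 1) = - B + (2 * B / T) * \<tau>" by (simp add: algebra_simps)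
      finally show ?thesis .
    qed
    have "{s..t} \<subseteq> {0..T}" using st by auto
    from low[of s t x u "- B" "2 * B / T" l, OF st(2) this C1 \<phi>]
    show "B * (2 * t / T - 1) * (norm (x t))\<^sup>2 - B * (2 * s / T - 1) * (norm (x s))\<^sup>2 + integral {s..t} (\<lambda>\<tau>. (norm (x \<tau>))\<^sup>2)
      \<le> Re (bform l s t x u x u)"
      by (simp add: algebra_simps)
  qed
qed

section \<open>Initial and boundary value problems for the Hamiltonian system\<close>

definition sol where
  "sol l s t x y \<longleftrightarrow> (\<forall>\<tau>\<in>{s..t}. (x has_vector_derivative vel \<tau> (x \<tau>) (y \<tau>)) (at \<tau> within {s..t}) \<and>
     (y has_vector_derivative frc l \<tau> (x \<tau>) (vel \<tau> (x \<tau>) (y \<tau>))) (at \<tau> within {s..t}))"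

lemma sol_continuous: "sol l s t x y \<Longrightarrow> continuous_on {s..t} x \<and> continuous_on {s..t} y"
  unfolding sol_def continuous_on_eq_continuous_within
  by (auto intro: has_vector_derivative_continuous)

lemma sol_C1:
  assumes "sol l s t x y" "{s..t} \<subseteq> {0..T}"
  shows "C1_on s t x (\<lambda>\<tau>. vel \<tau> (x \<tau>) (y \<tau>))"
  unfolding C1_on_def
proof
  show "continuous_on {s..t} (\<lambda>\<tau>. vel \<tau> (x \<tau>) (y \<tau>))"
    using sol_continuous[OF assms(1)] by (intro continuous_on_vel assms) auto
  show "\<forall>\<tau>\<in>{s..t}. (x has_vector_derivative vel \<tau> (x \<tau>) (y \<tau>)) (at \<tau> within {s..t})"
    using assms(1) by (auto simp: sol_def)
qed

lemma sol_subset: "sol l s t x y \<Longrightarrow> {s'..t'} \<subseteq> {s..t} \<Longrightarrow> sol l s' t' x y"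
  unfolding sol_def by (meson has_vector_derivative_within_subset subsetD)

lemma sol_add: "sol l s t x y \<Longrightarrow> sol l s t x' y' \<Longrightarrow> sol l s t (\<lambda>\<tau>. x \<tau> + x' \<tau>) (\<lambda>\<tau>. y \<tau> + y' \<tau>)"
  and sol_diff: "sol l s t x y \<Longrightarrow> sol l s t x' y' \<Longrightarrow> sol l s t (\<lambda>\<tau>. x \<tau> - x' \<tau>) (\<lambda>\<tau>. y \<tau> - y' \<tau>)"
  unfolding sol_def vel_add frc_add vel_diff frc_diff
  by (auto intro!: has_vector_derivative_add has_vector_derivative_diff)

lemma sol_scale:
  assumes "sol l s t x y"
  shows "sol l s t (\<lambda>\<tau>. c *s x \<tau>) (\<lambda>\<tau>. c *s y \<tau>)"
proof -
  have bl: "bounded_linear (\<lambda>v::complex^'n. c *s v)"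
    unfolding linear_conv_bounded_linear[symmetric]
    by (rule linearI) (auto simp: vec_eq_iff algebra_simps)
  show ?thesis
    using assms unfolding sol_def vel_scale frc_scale
    by (auto intro: bounded_linear.has_vector_derivative[OF bl])
qed

text \<open>Along a solution y is differentiable, so the density is the derivative of
  \<open>hermitian_inner (y \<tau>) (w \<tau>)\<close>: the fundamental theorem of calculus does the
  integration by parts.\<close>

lemma green:
  assumes sol: "sol l s t x y" and st: "s \<le> t" "{s..t} \<subseteq> {0..T}" and C1: "C1_on s t w v"
  shows "bform l s t x (\<lambda>\<tau>. vel \<tau> (x \<tau>) (y \<tau>)) w v = hermitian_inner (y t) (w t) - hermitian_inner (y s) (w s)"
proof -
  have "((\<lambda>\<tau>. hermitian_inner (y \<tau>) (v \<tau>) + hermitian_inner (frc l \<tau> (x \<tau>) (vel \<tau> (x \<tau>) (y \<tau>))) (w \<tau>))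
      has_integral hermitian_inner (y t) (w t) - hermitian_inner (y s) (w s)) {s..t}"
    using sol C1 unfolding sol_def C1_on_def
    by (intro fundamental_theorem_of_calculus[OF st(1)] hi.has_vector_derivative) auto
  moreover have "dens l \<tau> (x \<tau>) (vel \<tau> (x \<tau>) (y \<tau>)) (w \<tau>) (v \<tau>)
      = hermitian_inner (y \<tau>) (v \<tau>) + hermitian_inner (frc l \<tau> (x \<tau>) (vel \<tau> (x \<tau>) (y \<tau>))) (w \<tau>)" if "\<tau> \<in> {s..t}" for \<tau>
    using that st by (simp add: dens_def mom_vel subset_iff)
  ultimately show ?thesis
    unfolding bform_def by (metis (no_types, lifting) integral_cong integral_unique)
qed

lemma flow_bound:
  obtains K where "K \<ge> 0" "\<And>t x y. t \<in> {0..T} \<Longrightarrow> norm (vel t x y, frc l t x (vel t x y)) \<le> K * norm (x, y)"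
proof -
  obtain KS where KS: "KS \<ge> 0" "\<And>t v. t \<in> {0..T} \<Longrightarrow> norm (S t \<odot> v) \<le> KS * norm v"
    using cmv_bound[OF continuous_on_S] by metis
  obtain KQ where KQ: "KQ \<ge> 0" "\<And>t v. t \<in> {0..T} \<Longrightarrow> norm (Q t \<odot> v) \<le> KQ * norm v"
    using cmv_bound[OF Q] by metis
  obtain KR where KR: "KR \<ge> 0" "\<And>t v. t \<in> {0..T} \<Longrightarrow> norm (R t \<odot> v) \<le> KR * norm v"
    using cmv_bound[OF R] by metis
  obtain KT where KT: "KT \<ge> 0" "\<And>t v. t \<in> {0..T} \<Longrightarrow> norm (transpose (Q t) \<odot> v) \<le> KT * norm v"
    using cmv_bound[OF continuous_on_transpose[OF Q]] by metis
  define V where "V = KS * (1 + KQ)"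
  have V: "V \<ge> 0" using KS KQ by (simp add: V_def)
  show thesis
  proof (rule that)
    show "V + (KT * V + KR + \<bar>l\<bar>) \<ge> 0" using V KT KR by simp
    fix t and x y :: "complex^'n" assume t: "t \<in> {0..T}"
    let ?n = "norm (x, y)"
    have n: "norm x \<le> ?n" "norm y \<le> ?n" using norm_fst_le[of x y] norm_snd_le[of y x] by auto
    have "norm (y - Q t \<odot> x) \<le> norm y + norm (Q t \<odot> x)" by (rule norm_triangle_ineq4)
    also have "\<dots> \<le> ?n + KQ * ?n" using n KQ(2)[OF t, of x] mult_left_mono[OF n(1) KQ(1)] by linarith
    finally have "KS * norm (y - Q t \<odot> x) \<le> KS * (?n + KQ * ?n)" using KS(1) by (rule mult_left_mono)
    then have v: "norm (vel t x y) \<le> V * ?n"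
      using KS(2)[OF t, of "y - Q t \<odot> x"] by (simp add: vel_def V_def algebra_simps)
    have "norm (frc l t x (vel t x y)) \<le> norm (transpose (Q t) \<odot> vel t x y) + norm (R t \<odot> x) + norm (l *\<^sub>R x)"
      unfolding frc_def using norm_triangle_ineq4 norm_triangle_ineq by (meson add_mono order_refl order_trans)
    also have "\<dots> \<le> KT * norm (vel t x y) + KR * norm x + \<bar>l\<bar> * norm x"
      using KT(2)[OF t, of "vel t x y"] KR(2)[OF t, of x] by simp
    also have "\<dots> \<le> KT * (V * ?n) + KR * ?n + \<bar>l\<bar> * ?n"
      by (intro add_mono mult_left_mono v n KT KR) auto
    finally have f: "norm (frc l t x (vel t x y)) \<le> (KT * V + KR + \<bar>l\<bar>) * ?n" by (simp add: algebra_simps)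
    have "norm (vel t x y, frc l t x (vel t x y)) \<le> norm (vel t x y) + norm (frc l t x (vel t x y))"
      by (simp add: norm_Pair sqrt_add_le_add_sqrt[THEN order_trans])
    then show "norm (vel t x y, frc l t x (vel t x y)) \<le> (V + (KT * V + KR + \<bar>l\<bar>)) * ?n"
      using v f by (simp add: algebra_simps)
  qed
qed

lemma ivp_unique:
  assumes "sol l s t x y" "sol l s t x' y'" "{s..t} \<subseteq> {0..T}" "x s = x' s" "y s = y' s" "\<tau> \<in> {s..t}"
  shows "x \<tau> = x' \<tau> \<and> y \<tau> = y' \<tau>"
proof -
  obtain K where K: "\<And>t x y. t \<in> {0..T} \<Longrightarrow> norm (vel t x y, frc l t x (vel t x y)) \<le> K * norm (x, y)"
    using flow_bound by metis
  define a where "a \<tau> = x \<tau> - x' \<tau>" for \<tau>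
  define b where "b \<tau> = y \<tau> - y' \<tau>" for \<tau>
  have ab: "sol l s t a b" unfolding a_def b_def using sol_diff assms by blast
  have "(a \<tau>, b \<tau>) = 0"
  proof (rule linear_ivp_unique[of s t "\<lambda>\<tau>. (a \<tau>, b \<tau>)" "\<lambda>\<tau>. (vel \<tau> (a \<tau>) (b \<tau>), frc l \<tau> (a \<tau>) (vel \<tau> (a \<tau>) (b \<tau>)))" K])
    show "((\<lambda>\<tau>. (a \<tau>, b \<tau>)) has_vector_derivative (vel \<tau> (a \<tau>) (b \<tau>), frc l \<tau> (a \<tau>) (vel \<tau> (a \<tau>) (b \<tau>)))) (at \<tau> within {s..t})"
      if "\<tau> \<in> {s..t}" for \<tau>
      using ab that by (intro has_vector_derivative_Pair) (auto simp: sol_def)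
    show "(a s, b s) = 0" using assms by (simp add: a_def b_def zero_prod_def)
  qed (use K assms in auto)
  then show ?thesis by (simp add: a_def b_def zero_prod_def)
qed

lemma ivp_exists:
  assumes "s \<le> t" "{s..t} \<subseteq> {0..T}"
  shows "\<exists>x y. sol l s t x y \<and> x s = a \<and> y s = b"
proof -
  obtain K where K: "K \<ge> 0" "\<And>t x y. t \<in> {0..T} \<Longrightarrow> norm (vel t x y, frc l t x (vel t x y)) \<le> K * norm (x, y)"
    using flow_bound by metis
  let ?F = "\<lambda>t z. (vel t (fst z) (snd z), frc l t (fst z) (vel t (fst z) (snd z)))"
  have "\<exists>z. z s = (a, b) \<and> (\<forall>\<tau>\<in>{s..t}. (z has_vector_derivative ?F \<tau> (z \<tau>)) (at \<tau> within {s..t}))"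
  proof (rule linear_ivp_exists[OF assms(1) _ _ K(1)])
    show "linear (?F \<tau>)" if "\<tau> \<in> {s..t}" for \<tau>
      by (rule linearI) (simp_all add: vel_add frc_add scaleR_vec_scale vel_scale frc_scale)
    show "norm (?F \<tau> z) \<le> K * norm z" if "\<tau> \<in> {s..t}" for \<tau> z
      using K(2)[of \<tau> "fst z" "snd z"] that assms by auto
    show "continuous_on {s..t} (\<lambda>\<tau>. ?F \<tau> (f \<tau>))" if "continuous_on {s..t} f" for f
      by (intro continuous_on_Pair continuous_on_vel continuous_on_frc assms continuous_on_fst continuous_on_snd that)
  qed
  then obtain z where z: "z s = (a, b)" "\<And>\<tau>. \<tau> \<in> {s..t} \<Longrightarrow> (z has_vector_derivative ?F \<tau> (z \<tau>)) (at \<tau> within {s..t})"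
    by blast
  have "sol l s t (\<lambda>\<tau>. fst (z \<tau>)) (\<lambda>\<tau>. snd (z \<tau>))"
    unfolding sol_def
    using bounded_linear.has_vector_derivative[OF bounded_linear_fst z(2)]
      bounded_linear.has_vector_derivative[OF bounded_linear_snd z(2)] by auto
  then show ?thesis using z(1) by (metis fst_conv snd_conv)
qed

text \<open>Green's identity makes the energy zero, so x vanishes by goodness. Then its velocity
  vanishes, and the momentum with it.\<close>

lemma bvp_zero:
  assumes g: "good l s t" and sol: "sol l s t x y" and z: "x s = 0" "x t = 0" and \<tau>: "\<tau> \<in> {s..t}"
  shows "x \<tau> = 0 \<and> y \<tau> = 0"
proof -
  have st: "s < t" "{s..t} \<subseteq> {0..T}" using g by (auto simp: good_def)
  note C1 = sol_C1[OF sol st(2)]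
  have "integral {s..t} (\<lambda>\<tau>. (norm (x \<tau>))\<^sup>2) \<le> Re (bform l s t x (\<lambda>\<tau>. vel \<tau> (x \<tau>) (y \<tau>)) x (\<lambda>\<tau>. vel \<tau> (x \<tau>) (y \<tau>)))"
    using g C1 z by (auto simp: good_def)
  also have "\<dots> = 0" using green[OF sol _ st(2) C1] st z by (simp add: hi.zero_right)
  finally have x0: "x \<tau> = 0" if "\<tau> \<in> {s..t}" for \<tau>
    using integral_sq_zero[OF st(1) C1_on_continuous[OF C1]] that by blast
  have "((\<lambda>_. 0) has_vector_derivative vel \<tau> (x \<tau>) (y \<tau>)) (at \<tau> within {s..t})"
    using sol \<tau> x0 by (intro has_vector_derivative_transform[OF \<tau>, of "\<lambda>_. 0" x]) (auto simp: sol_def)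
  then have "vel \<tau> (x \<tau>) (y \<tau>) = 0"
    using vector_derivative_unique_within_closed_interval[OF st(1) _ _ has_vector_derivative_const, of \<tau> 0] \<tau> by auto
  then have "y \<tau> = mom \<tau> 0 0" using mom_vel[of \<tau> "x \<tau>" "y \<tau>"] \<tau> st x0 by auto
  then show ?thesis using x0[OF \<tau>] by (simp add: mom_def cmv_simps)
qed

lemma bvp_unique:
  assumes "good l s t" "sol l s t x y" "sol l s t x' y'" "x s = x' s" "x t = x' t" "\<tau> \<in> {s..t}"
  shows "x \<tau> = x' \<tau>" "y \<tau> = y' \<tau>"
  using bvp_zero[OF assms(1) sol_diff[OF assms(2,3)]] assms(4-6) by auto

text \<open>Shooting: among solutions with \<open>x s = 0\<close>, the map from the initial momentum
  to the value at \<open>t\<close> is linear and injective, hence onto by equality of dimensions. A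
  particular solution adjusts the left value.\<close>

lemma bvp_exists:
  assumes g: "good l s t"
  shows "\<exists>x y. sol l s t x y \<and> x s = a \<and> x t = b"
proof -
  have st: "s \<le> t" "{s..t} \<subseteq> {0..T}" using g by (auto simp: good_def)
  have "\<forall>v. \<exists>x y. sol l s t x y \<and> x s = 0 \<and> y s = v" using ivp_exists[OF st] by blast
  then obtain X Y where XY: "\<And>v. sol l s t (X v) (Y v)" "\<And>v. X v s = 0" "\<And>v. Y v s = v" by metis
  have "linear (\<lambda>v. X v t)"
  proof (rule linearI)
    show "X (v + w) t = X v t + X w t" for v w
      using ivp_unique[OF XY(1) sol_add[OF XY(1) XY(1)] st(2), of "v + w" v w t] st by (simp add: XY)
    show "X (r *\<^sub>R v) t = r *\<^sub>R X v t" for r v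
      unfolding scaleR_vec_scale
      using ivp_unique[OF XY(1) sol_scale[OF XY(1)] st(2), of "of_real r *s v" "of_real r" v t] st by (simp add: XY)
  qed
  moreover have "inj (\<lambda>v. X v t)"
    unfolding linear_injective_0[OF \<open>linear (\<lambda>v. X v t)\<close>]
    using bvp_zero[OF g XY(1)] XY(2,3) st by (metis atLeastAtMost_iff order_refl)
  ultimately have "surj (\<lambda>v. X v t)" by (rule linear_injective_imp_surjective) (rule refl)
  obtain x0 y0 where s0: "sol l s t x0 y0" "x0 s = a" using ivp_exists[OF st, of l a 0] by blast
  obtain v where v: "b - x0 t = X v t" using \<open>surj (\<lambda>v. X v t)\<close> by (metis surjD)
  have "sol l s t (\<lambda>\<tau>. x0 \<tau> + X v \<tau>) (\<lambda>\<tau>. y0 \<tau> + Y v \<tau>)" using sol_add s0 XY by blast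
  moreover have "x0 s + X v s = a" "x0 t + X v t = b" using s0 XY v[symmetric] by auto
  ultimately show ?thesis by (intro exI[of _ "\<lambda>\<tau>. x0 \<tau> + X v \<tau>"] exI[of _ "\<lambda>\<tau>. y0 \<tau> + Y v \<tau>"]) auto
qed

text \<open>The difference from a competitor vanishes at both ends, so Green's identity kills the
  cross terms and the excess is the nonnegative Dirichlet energy of the difference.\<close>

lemma sol_minimizes:
  assumes g: "good l s t" and sol: "sol l s t x y" and C1: "C1_on s t w v" and e: "w s = x s" "w t = x t"
  shows "Re (bform l s t x (\<lambda>\<tau>. vel \<tau> (x \<tau>) (y \<tau>)) x (\<lambda>\<tau>. vel \<tau> (x \<tau>) (y \<tau>))) \<le> Re (bform l s t w v w v)"
proof -
  have st: "s < t" "{s..t} \<subseteq> {0..T}" using g by (auto simp: good_def)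
  define u where "u \<tau> = vel \<tau> (x \<tau>) (y \<tau>)" for \<tau>
  have C: "C1_on s t x u" unfolding u_def[abs_def] by (rule sol_C1[OF sol st(2)])
  let ?d = "\<lambda>\<tau>. w \<tau> - x \<tau>" and ?e = "\<lambda>\<tau>. v \<tau> - u \<tau>"
  have D: "C1_on s t ?d ?e" by (rule C1_on_diff[OF C1 C])
  have W: "w = (\<lambda>\<tau>. x \<tau> + ?d \<tau>)" "v = (\<lambda>\<tau>. u \<tau> + ?e \<tau>)" by auto
  have xd: "bform l s t x u ?d ?e = 0"
    unfolding u_def[abs_def]
    using green[OF sol less_imp_le[OF st(1)] st(2) D] e by (simp add: u_def hi.zero_right)
  have xw: "bform l s t x u w v = bform l s t x u x u"
  proof -
    have "bform l s t w v x u = bform l s t x u x u + bform l s t ?d ?e x u"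
      using bform_add[OF st(2) C D C, of l] by simp
    then show ?thesis
      using bform_sym[OF st(2) C D, of l] bform_sym[OF st(2) C1 C, of l] bform_sym[OF st(2) C C, of l] xd by simp
  qed
  have dw: "bform l s t ?d ?e w v = bform l s t ?d ?e ?d ?e"
  proof -
    have "bform l s t w v ?d ?e = bform l s t x u ?d ?e + bform l s t ?d ?e ?d ?e"
      using bform_add[OF st(2) C D D, of l] by simp
    then show ?thesis
      using bform_sym[OF st(2) C1 D, of l] bform_sym[OF st(2) D D, of l] xd by simp
  qed
  have "bform l s t w v w v = bform l s t x u w v + bform l s t ?d ?e w v"
    using bform_add[OF st(2) C D C1, of l] by simp
  then have "Re (bform l s t w v w v) = Re (bform l s t x u x u) + Re (bform l s t ?d ?e ?d ?e)"
    using xw dw by simp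
  moreover have "integral {s..t} (\<lambda>\<tau>. (norm (?d \<tau>))\<^sup>2) \<le> Re (bform l s t ?d ?e ?d ?e)"
    using g D e by (auto simp: good_def)
  moreover have "0 \<le> integral {s..t} (\<lambda>\<tau>. (norm (?d \<tau>))\<^sup>2)"
    by (intro integral_nonneg integrable_continuous_real continuous_intros C1_on_continuous[OF D]) auto
  ultimately show ?thesis by (simp add: u_def[abs_def])
qed

end

section \<open>Broken extremals\<close>

interpretation cfun: complex_space "\<lambda>(c::complex) (f::real \<Rightarrow> complex^'n) t. c *s f t"
  by unfold_locales

lemma sum_fun_apply: "(\<Sum>i\<in>I. f i) x = (\<Sum>i\<in>I. f i x :: 'a::ab_group_add)"
  by (induction I rule: infinite_finite_induct) auto

lemma (in vector_space) independent_if_image_independent: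
  assumes f: "Vector_Spaces.linear scale scale f" and B: "independent (f ` B)" "inj_on f B"
  shows "independent B"
proof
  assume "dependent B"
  then obtain a where a: "a \<in> B" "a \<in> span (B - {a})" unfolding dependent_def by blast
  interpret f: Vector_Spaces.linear scale scale f by fact
  have "f a \<in> span (f ` (B - {a}))" using a(2) f.span_image by blast
  also have "f ` (B - {a}) = f ` B - {f a}" using B(2) a(1) by (auto simp: inj_on_def)
  finally show False using B(1) a(1) unfolding dependent_def by blast
qed

text \<open>Here \<open>W\<close> is the essential condition on (x(0), x(T)), and
  \<open>\<eta>0\<close>, \<open>\<eta>T\<close> assign end momenta to such values. Their symmetry
  expresses that the assigned boundary vectors form an isotropic space.\<close>

locale boundary_condition = sturm_liouville T P Q R
  for T :: real and P Q R :: "real \<Rightarrow> real^'n^'n" +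
  fixes W :: "complex^'n \<Rightarrow> complex^'n \<Rightarrow> bool" and \<eta>0 \<eta>T :: "complex^'n \<Rightarrow> complex^'n \<Rightarrow> complex^'n"
  assumes W0: "W 0 0" and W_add: "W a b \<Longrightarrow> W c d \<Longrightarrow> W (a + c) (b + d)" and W_scale: "W a b \<Longrightarrow> W (k *s a) (k *s b)"
    and \<eta>0_add: "\<eta>0 (a + c) (b + d) = \<eta>0 a b + \<eta>0 c d" and \<eta>0_scale: "\<eta>0 (k *s a) (k *s b) = k *s \<eta>0 a b"
    and \<eta>T_add: "\<eta>T (a + c) (b + d) = \<eta>T a b + \<eta>T c d" and \<eta>T_scale: "\<eta>T (k *s a) (k *s b) = k *s \<eta>T a b"
    and \<eta>_sym: "W a b \<Longrightarrow> W c d \<Longrightarrow> hermitian_inner (\<eta>T a b) d - hermitian_inner (\<eta>0 a b) c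
        = cnj (hermitian_inner (\<eta>T c d) b - hermitian_inner (\<eta>0 c d) a)"
begin

text \<open>The sign is such that, added to the end terms of Green's identity, it replaces the
  momenta by their deviations from \<open>\<eta>T\<close> and \<open>\<eta>0\<close>. The natural
  boundary condition is the vanishing of these terms for all admissible \<open>c\<close>,
  \<open>d\<close>.\<close>

definition bd where "bd a b c d = hermitian_inner (\<eta>0 a b) c - hermitian_inner (\<eta>T a b) d"

lemma bd_add: "bd (a + a') (b + b') c d = bd a b c d + bd a' b' c d"
  and bd_scale: "bd (k *s a) (k *s b) c d = k * bd a b c d"
  by (simp_all add: bd_def \<eta>0_add \<eta>T_add \<eta>0_scale \<eta>T_scale hi.add_left hermitian_scale_left algebra_simps)

lemma bd_sym: "W a b \<Longrightarrow> W c d \<Longrightarrow> bd c d a b = cnj (bd a b c d)"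
  using \<eta>_sym[of c d a b] by (simp add: bd_def algebra_simps)

lemma bd_lower: "\<exists>B\<ge>0. \<forall>a b. - B * ((norm a)\<^sup>2 + (norm b)\<^sup>2) \<le> Re (bd a b a b)"
proof -
  have lin: "linear (\<lambda>z. (\<eta>0 (fst z) (snd z), \<eta>T (fst z) (snd z)))"
    by (rule linearI) (simp_all add: \<eta>0_add \<eta>T_add scaleR_vec_scale \<eta>0_scale \<eta>T_scale)
  then obtain B where B: "B > 0" "\<And>z. norm (\<eta>0 (fst z) (snd z), \<eta>T (fst z) (snd z)) \<le> B * norm z"
    using linear_bounded_pos by blast
  have "- (2 * B) * ((norm a)\<^sup>2 + (norm b)\<^sup>2) \<le> Re (bd a b a b)" for a b
  proof -
    let ?n = "norm (a, b)"
    have n: "norm a \<le> ?n" "norm b \<le> ?n" using norm_fst_le[of a b] norm_snd_le[of b a] by auto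
    have e: "norm (\<eta>0 a b) \<le> B * ?n" "norm (\<eta>T a b) \<le> B * ?n"
      using B(2)[of "(a, b)"] norm_fst_le[of "\<eta>0 a b" "\<eta>T a b"] norm_snd_le[of "\<eta>T a b" "\<eta>0 a b"] by auto
    have "\<bar>\<eta>0 a b \<bullet> a\<bar> \<le> (B * ?n) * ?n" "\<bar>\<eta>T a b \<bullet> b\<bar> \<le> (B * ?n) * ?n"
      using Cauchy_Schwarz_ineq2[of "\<eta>0 a b" a] Cauchy_Schwarz_ineq2[of "\<eta>T a b" b]
        mult_mono[OF e(1) n(1)] mult_mono[OF e(2) n(2)] B(1) by auto
    then have "- (2 * B) * ?n\<^sup>2 \<le> Re (bd a b a b)"
      by (simp add: bd_def Re_hermitian power2_eq_square abs_le_iff algebra_simps)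
    then show ?thesis by (simp add: norm_Pair)
  qed
  then show ?thesis using B(1) by (intro exI[of _ "2 * B"]) auto
qed

end

text \<open>One partition serves all parameters up to \<open>M\<close>, which puts all the forms
  \<open>H l\<close> on the same space of node values.\<close>

locale broken = boundary_condition T P Q R W \<eta>0 \<eta>T
  for T :: real and P Q R :: "real \<Rightarrow> real^'n^'n" and W \<eta>0 \<eta>T +
  fixes m :: nat and M :: real
  assumes m: "m > 0" and good0: "l \<le> M \<Longrightarrow> i < m \<Longrightarrow> good l (T * (real i / real m)) (T * (real (Suc i) / real m))"
begin

definition nd where "nd i = T * (real i / real m)"

lemma nd_0 [simp]: "nd 0 = 0" and nd_m [simp]: "nd m = T"
  using m by (simp_all add: nd_def)

lemma nd_inj [simp]: "nd i = nd j \<longleftrightarrow> i = j"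
  using m T by (simp add: nd_def)

lemma nd_le [simp]: "nd i \<le> nd j \<longleftrightarrow> i \<le> j"
  using m T by (simp add: nd_def divide_le_cancel)

lemma nd_mem: "i \<le> m \<Longrightarrow> nd i \<in> {0..T}"
  using nd_le[of 0 i] nd_le[of i m] by (simp del: nd_le)

lemma good: "l \<le> M \<Longrightarrow> i < m \<Longrightarrow> good l (nd i) (nd (Suc i))"
  using good0 by (simp add: nd_def)

lemma piece: "i < m \<Longrightarrow> {nd i..nd (Suc i)} \<subseteq> {0..T}"
  using nd_mem[of i] nd_mem[of "Suc i"] by auto

definition nodes where "nodes = nd ` {..m}"

text \<open>Node values are stored as functions vanishing off the nodes, so that they lie in the
  same complex vector space as the eigenfunctions and restriction to the nodes is an endomorphism of
  it.\<close>

definition V where "V = {v. (\<forall>t. t \<notin> nodes \<longrightarrow> v t = 0) \<and> W (v 0) (v T)}"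

lemma V_subspace: "cfun.subspace V"
  unfolding cfun.subspace_def V_def using W0 W_add W_scale by auto

lemma V_rank: "\<exists>n. cfun.rank_le V n"
proof -
  define e :: "real \<Rightarrow> 'n \<Rightarrow> real \<Rightarrow> complex^'n" where "e s k = (\<lambda>t. if t = s then axis k 1 else 0)" for s k
  have "v \<in> cfun.span (case_prod e ` (nodes \<times> UNIV))" if v: "v \<in> V" for v
  proof -
    have "v = (\<Sum>s\<in>nodes. \<Sum>k\<in>UNIV. (\<lambda>t. (v s $ k) *s e s k t))"
    proof
      fix t
      have "(\<Sum>s\<in>nodes. \<Sum>k\<in>UNIV. (\<lambda>t. (v s $ k) *s e s k t)) t = (\<Sum>s\<in>nodes. \<Sum>k\<in>UNIV. (v s $ k) *s e s k t)"
        by (simp add: sum_fun_apply)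
      also have "\<dots> = (\<Sum>s\<in>nodes. if s = t then (\<Sum>k\<in>UNIV. (v t $ k) *s axis k 1) else 0)"
        by (intro sum.cong refl) (auto simp: e_def)
      also have "\<dots> = (if t \<in> nodes then v t else 0)"
        by (simp add: nodes_def basis_expansion sum.delta)
      finally show "v t = (\<Sum>s\<in>nodes. \<Sum>k\<in>UNIV. (\<lambda>t. (v s $ k) *s e s k t)) t"
        using v by (auto simp: V_def)
    qed
    also have "\<dots> \<in> cfun.span (case_prod e ` (nodes \<times> UNIV))"
      by (intro cfun.span_sum cfun.span_scale cfun.span_base) auto
    finally show ?thesis .
  qed
  then have "V \<subseteq> cfun.span (case_prod e ` (nodes \<times> UNIV))" by blast
  moreover have "finite (case_prod e ` (nodes \<times> UNIV))" by (auto simp: nodes_def)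
  ultimately show ?thesis using cfun.rank_le_span by blast
qed

definition is_extremal where "is_extremal l v i x y \<longleftrightarrow> sol l (nd i) (nd (Suc i)) x y \<and> x (nd i) = v (nd i) \<and> x (nd (Suc i)) = v (nd (Suc i))"
definition extremal where "extremal l v i = (SOME p. is_extremal l v i (fst p) (snd p))"
definition X where "X l v i = fst (extremal l v i)"
definition Y where "Y l v i = snd (extremal l v i)"
definition U where "U l v i \<tau> = vel \<tau> (X l v i \<tau>) (Y l v i \<tau>)"

lemma extremal: assumes "l \<le> M" "i < m" shows "is_extremal l v i (X l v i) (Y l v i)"
proof -
  have "\<exists>p. is_extremal l v i (fst p) (snd p)"
    using bvp_exists[OF good[OF assms], of "v (nd i)" "v (nd (Suc i))"] by (auto simp: is_extremal_def)
  then show ?thesis unfolding X_def Y_def extremal_def by (rule someI_ex)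
qed

lemma X_sol: "l \<le> M \<Longrightarrow> i < m \<Longrightarrow> sol l (nd i) (nd (Suc i)) (X l v i) (Y l v i)"
  and X_left: "l \<le> M \<Longrightarrow> i < m \<Longrightarrow> X l v i (nd i) = v (nd i)"
  and X_right: "l \<le> M \<Longrightarrow> i < m \<Longrightarrow> X l v i (nd (Suc i)) = v (nd (Suc i))"
  using extremal unfolding is_extremal_def by blast+

lemma X_C1: "l \<le> M \<Longrightarrow> i < m \<Longrightarrow> C1_on (nd i) (nd (Suc i)) (X l v i) (U l v i)"
  unfolding U_def[abs_def] by (intro sol_C1[where l = l] X_sol piece)

text \<open>Removes the choice from \<open>extremal\<close>; linearity of the momenta in the node
  values follows.\<close>

lemma Y_eqI:
  assumes "l \<le> M" "i < m" "is_extremal l v i x y" "\<tau> \<in> {nd i..nd (Suc i)}"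
  shows "Y l v i \<tau> = y \<tau>"
  using bvp_unique(2)[OF good[OF assms(1,2)] X_sol[OF assms(1,2)] _ _ _ assms(4)] assms(3)
    X_left[OF assms(1,2)] X_right[OF assms(1,2)] by (auto simp: is_extremal_def)

lemma Y_add: "l \<le> M \<Longrightarrow> i < m \<Longrightarrow> \<tau> \<in> {nd i..nd (Suc i)} \<Longrightarrow> Y l (v + w) i \<tau> = Y l v i \<tau> + Y l w i \<tau>"
  and Y_scale: "l \<le> M \<Longrightarrow> i < m \<Longrightarrow> \<tau> \<in> {nd i..nd (Suc i)} \<Longrightarrow> Y l (\<lambda>t. c *s v t) i \<tau> = c *s Y l v i \<tau>"
proof -
  assume a: "l \<le> M" "i < m" "\<tau> \<in> {nd i..nd (Suc i)}"
  show "Y l (v + w) i \<tau> = Y l v i \<tau> + Y l w i \<tau>"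
    using a by (intro Y_eqI[where x = "\<lambda>\<tau>. X l v i \<tau> + X l w i \<tau>" and y = "\<lambda>\<tau>. Y l v i \<tau> + Y l w i \<tau>"])
      (auto simp: is_extremal_def X_left X_right intro!: sol_add X_sol)
  show "Y l (\<lambda>t. c *s v t) i \<tau> = c *s Y l v i \<tau>"
    using a by (intro Y_eqI[where x = "\<lambda>\<tau>. c *s X l v i \<tau>" and y = "\<lambda>\<tau>. c *s Y l v i \<tau>"])
      (auto simp: is_extremal_def X_left X_right intro!: sol_scale X_sol)
qed

text \<open>The energy of the broken extremals after Green's identity. In this form the second
  argument enters through its node values alone, and the coefficient of an interior node value is
  the jump of the momentum there.\<close>

definition H where
  "H l v w = (\<Sum>i<m. hermitian_inner (Y l v i (nd (Suc i))) (w (nd (Suc i))) - hermitian_inner (Y l v i (nd i)) (w (nd i)))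
     + bd (v 0) (v T) (w 0) (w T)"

lemma nd_ends: "nd i \<in> {nd i..nd (Suc i)}" "nd (Suc i) \<in> {nd i..nd (Suc i)}"
  by auto

lemma H_bform:
  assumes "l \<le> M"
  shows "H l v w = (\<Sum>i<m. bform l (nd i) (nd (Suc i)) (X l v i) (U l v i) (X l w i) (U l w i)) + bd (v 0) (v T) (w 0) (w T)"
proof -
  have "bform l (nd i) (nd (Suc i)) (X l v i) (U l v i) (X l w i) (U l w i)
     = hermitian_inner (Y l v i (nd (Suc i))) (w (nd (Suc i))) - hermitian_inner (Y l v i (nd i)) (w (nd i))" if "i < m" for i
    unfolding U_def[of l v, abs_def]
    using green[OF X_sol[OF assms that] _ piece[OF that] X_C1[OF assms that]] assms that by (simp add: X_left X_right)
  then show ?thesis unfolding H_def by (auto intro: sum.cong)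
qed

lemma H_hermitian:
  assumes l: "l \<le> M"
  shows "cfun.hermitian_on V (H l)"
proof (rule cfun.hermitian_onI)
  show "H l (u + v) w = H l u w + H l v w" for u v w
    using l by (simp add: H_def Y_add nd_ends hi.add_left bd_add sum.distrib[symmetric] add_diff_add)
  show "H l (\<lambda>t. c *s u t) v = c * H l u v" for c u v
    using l by (simp add: H_def Y_scale nd_ends hermitian_scale_left bd_scale sum_distrib_left right_diff_distrib distrib_left)
  show "H l v u = cnj (H l u v)" if "u \<in> V" "v \<in> V" for u v
  proof -
    have "bform l (nd i) (nd (Suc i)) (X l v i) (U l v i) (X l u i) (U l u i)
       = cnj (bform l (nd i) (nd (Suc i)) (X l u i) (U l u i) (X l v i) (U l v i))" if "i < m" for i
      using l that by (intro bform_sym piece X_C1)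
    moreover have "bd (v 0) (v T) (u 0) (u T) = cnj (bd (u 0) (u T) (v 0) (v T))"
      using that by (intro bd_sym) (auto simp: V_def)
    ultimately show ?thesis unfolding H_bform[OF l] by simp
  qed
qed

text \<open>Competitors are arbitrary broken C^1 functions. They include the extremals of another
  parameter and the restrictions of a global C^1 function to the pieces.\<close>

lemma H_min:
  assumes l: "l \<le> M" and C1: "\<And>i. i < m \<Longrightarrow> C1_on (nd i) (nd (Suc i)) (x i) (u i)"
    and e: "\<And>i. i < m \<Longrightarrow> x i (nd i) = v (nd i)" "\<And>i. i < m \<Longrightarrow> x i (nd (Suc i)) = v (nd (Suc i))"
  shows "Re (H l v v) \<le> (\<Sum>i<m. Re (bform l (nd i) (nd (Suc i)) (x i) (u i) (x i) (u i))) + Re (bd (v 0) (v T) (v 0) (v T))"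
proof -
  have "Re (bform l (nd i) (nd (Suc i)) (X l v i) (U l v i) (X l v i) (U l v i))
     \<le> Re (bform l (nd i) (nd (Suc i)) (x i) (u i) (x i) (u i))" if "i < m" for i
    unfolding U_def[abs_def]
    using sol_minimizes[OF good[OF l that] X_sol[OF l that] C1[OF that]] e[OF that] X_left[OF l that] X_right[OF l that] by simp
  then show ?thesis unfolding H_bform[OF l] by (auto intro: sum_mono)
qed

text \<open>As a minimum of affine functions of the spectral parameter, \<open>\<lambda> \<mapsto> H\<^sub>\<lambda>(v, v)\<close> is concave, hence
  continuous; this spares us the dependence of solutions on the parameter.\<close>

lemma H_concave: "convex_on {..<M} (\<lambda>l. - Re (H l v v))"
  unfolding convex_on_def
proof (intro conjI ballI allI impI)
  fix l1 l2 a b :: real assume l12: "l1 \<in> {..<M}" "l2 \<in> {..<M}" and ab: "0 \<le> a" "0 \<le> b" "a + b = 1"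
  define l where "l = a *\<^sub>R l1 + b *\<^sub>R l2"
  have "l \<in> {..<M}" unfolding l_def using l12 ab convex_real_interval(4)[of M] by (simp add: convex_def)
  then have l: "l \<le> M" by simp
  define J where "J = (\<Sum>i<m. Re (integral {nd i..nd (Suc i)} (\<lambda>\<tau>. hermitian_inner (X l v i \<tau>) (X l v i \<tau>))))"
  have up: "Re (H k v v) \<le> Re (H l v v) - (k - l) * J" if k: "k \<le> M" for k
  proof -
    have "Re (bform k (nd i) (nd (Suc i)) (X l v i) (U l v i) (X l v i) (U l v i))
       = Re (bform l (nd i) (nd (Suc i)) (X l v i) (U l v i) (X l v i) (U l v i))
         - (k - l) * Re (integral {nd i..nd (Suc i)} (\<lambda>\<tau>. hermitian_inner (X l v i \<tau>) (X l v i \<tau>)))" if "i < m" for i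
      using bform_shift[OF piece[OF that] X_C1[OF l that, of v] X_C1[OF l that, of v], of l "k - l"] by simp
    then have "(\<Sum>i<m. Re (bform k (nd i) (nd (Suc i)) (X l v i) (U l v i) (X l v i) (U l v i)))
      = (\<Sum>i<m. Re (bform l (nd i) (nd (Suc i)) (X l v i) (U l v i) (X l v i) (U l v i))) - (k - l) * J"
      by (simp add: sum_subtractf sum_distrib_left J_def)
    moreover have "Re (H k v v) \<le> (\<Sum>i<m. Re (bform k (nd i) (nd (Suc i)) (X l v i) (U l v i) (X l v i) (U l v i))) + Re (bd (v 0) (v T) (v 0) (v T))"
      by (rule H_min[OF k]) (use l in \<open>simp_all add: X_C1 X_left X_right\<close>)
    ultimately show ?thesis using H_bform[OF l, of v v] by simp
  qed
  have "a * Re (H l1 v v) + b * Re (H l2 v v) \<le> a * (Re (H l v v) - (l1 - l) * J) + b * (Re (H l v v) - (l2 - l) * J)"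
    using up[of l1] up[of l2] l12 ab by (intro add_mono mult_left_mono) auto
  also have "\<dots> = (a + b) * Re (H l v v) - ((a * l1 + b * l2) - (a + b) * l) * J" by (simp add: algebra_simps)
  also have "\<dots> = Re (H l v v)" using ab by (simp add: l_def)
  finally show "- Re (H (a *\<^sub>R l1 + b *\<^sub>R l2) v v) \<le> a * - Re (H l1 v v) + b * - Re (H l2 v v)"
    by (simp add: l_def)
qed auto

text \<open>Convexity yields continuity on open sets, hence the open half-line below
  \<open>M\<close>. Polarization extends it from the diagonal to all of \<open>V\<close>.\<close>

lemma H_continuous:
  assumes v: "v \<in> V" and w: "w \<in> V"
  shows "continuous_on {..<M} (\<lambda>l. H l v w)"
proof -
  have q: "continuous_on {..<M} (\<lambda>l. Re (H l v v))" for v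
    using continuous_on_minus[OF convex_on_continuous[OF _ H_concave[of v]]] by simp
  have re: "continuous_on {..<M} (\<lambda>l. Re (H l v w))" if "w \<in> V" for w
  proof -
    have "continuous_on {..<M} (\<lambda>l. (Re (H l (v + w) (v + w)) - Re (H l v v) - Re (H l w w)) / 2)"
      by (intro continuous_intros q) auto
    then show ?thesis
      by (rule continuous_on_eq) (use cfun.herm_polar(1)[OF V_subspace H_hermitian v that] in auto)
  qed
  have "continuous_on {..<M} (\<lambda>l. Im (H l v w))"
    using re[OF cfun.subspace_scale[OF V_subspace w, of \<i>]]
    by (rule continuous_on_eq) (use cfun.herm_polar(2)[OF V_subspace H_hermitian v w] in auto)
  then have "continuous_on {..<M} (\<lambda>l. Complex (Re (H l v w)) (Im (H l v w)))"
    using re[OF w] by (intro continuous_on_Complex)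
  then show ?thesis by simp
qed

text \<open>The bound \<open>B\<close> for the boundary form is fed into
  \<open>boundary_lower\<close>. After telescoping, its end terms compensate \<open>bd\<close> and
  the L^2 norms of the pieces remain; if the form is not positive, all pieces of the extremal
  vanish, and so do the node values.\<close>

lemma H_pos: "\<exists>c. \<forall>l\<le>c. l \<le> M \<longrightarrow> (\<forall>v\<in>V. v \<noteq> 0 \<longrightarrow> Re (H l v v) > 0)"
proof -
  obtain B where B: "B \<ge> 0" "\<And>a b. - B * ((norm a)\<^sup>2 + (norm b)\<^sup>2) \<le> Re (bd a b a b)"
    using bd_lower by blast
  obtain c where c: "\<And>l s t x u. l \<le> c \<Longrightarrow> 0 \<le> s \<Longrightarrow> s \<le> t \<Longrightarrow> t \<le> T \<Longrightarrow> C1_on s t x u \<Longrightarrow>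
    B * (2 * t / T - 1) * (norm (x t))\<^sup>2 - B * (2 * s / T - 1) * (norm (x s))\<^sup>2 + integral {s..t} (\<lambda>\<tau>. (norm (x \<tau>))\<^sup>2)
      \<le> Re (bform l s t x u x u)"
    using boundary_lower[OF B(1)] by metis
  have "Re (H l v v) > 0" if l: "l \<le> c" "l \<le> M" and v: "v \<in> V" "v \<noteq> 0" for l v
  proof (rule ccontr)
    assume neg: "\<not> Re (H l v v) > 0"
    define I where "I i = integral {nd i..nd (Suc i)} (\<lambda>\<tau>. (norm (X l v i \<tau>))\<^sup>2)" for i
    define g where "g i = B * (2 * nd i / T - 1) * (norm (v (nd i)))\<^sup>2" for i
    have I0: "0 \<le> I i" if "i < m" for i
      unfolding I_def
      by (intro integral_nonneg integrable_continuous_real continuous_intros C1_on_continuous[OF X_C1] l that) auto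
    have "g (Suc i) - g i + I i \<le> Re (bform l (nd i) (nd (Suc i)) (X l v i) (U l v i) (X l v i) (U l v i))" if i: "i < m" for i
      using c[OF l(1) _ _ _ X_C1[OF l(2) i, of v]] nd_mem[of i] nd_mem[of "Suc i"] i l by (simp add: g_def I_def X_left X_right)
    then have "(\<Sum>i<m. g (Suc i) - g i + I i) \<le> (\<Sum>i<m. Re (bform l (nd i) (nd (Suc i)) (X l v i) (U l v i) (X l v i) (U l v i)))"
      by (intro sum_mono) auto
    moreover have "(\<Sum>i<m. g (Suc i) - g i + I i) = g m - g 0 + (\<Sum>i<m. I i)"
      by (simp add: sum.distrib sum_lessThan_telescope)
    moreover have "g m - g 0 = B * ((norm (v 0))\<^sup>2 + (norm (v T))\<^sup>2)"
      using T by (simp add: g_def algebra_simps)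
    ultimately have "(\<Sum>i<m. I i) \<le> Re (H l v v)"
      using B(2)[of "v 0" "v T"] unfolding H_bform[OF l(2)] by simp
    then have "(\<Sum>i<m. I i) = 0" using neg I0 by (smt (verit) lessThan_iff sum_nonneg)
    then have Iz: "I i = 0" if "i < m" for i
      using that I0 sum_nonneg_eq_0_iff[of "{..<m}" I] by auto
    have XZ: "X l v i \<tau> = 0" if "i < m" "\<tau> \<in> {nd i..nd (Suc i)}" for i \<tau>
      using integral_sq_zero[of "nd i" "nd (Suc i)" "X l v i" \<tau>] Iz[OF that(1)] that C1_on_continuous[OF X_C1[OF l(2) that(1)]]
        good[OF l(2) that(1)] by (auto simp: I_def good_def)
    have "v (nd i) = 0" if "i \<le> m" for i
    proof (cases "i = m")
      case True
      then obtain k where k: "m = Suc k" using m by (cases m) auto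
      then show ?thesis using XZ[of k "nd (Suc k)"] X_right[OF l(2), of k v] True nd_ends by simp
    next
      case False
      then show ?thesis using XZ[of i "nd i"] X_left[OF l(2), of i v] that nd_ends by simp
    qed
    then have "v t = 0" for t using v(1) by (cases "t \<in> nodes") (auto simp: V_def nodes_def)
    then show False using v(2) by auto
  qed
  then show ?thesis by blast
qed

section \<open>Kernels of the node forms, and the variational count on a partition\<close>

text \<open>Eigenfunctions described by the essential condition \<open>W\<close> together with the
  natural condition, the form in which a kernel vector of \<open>H l\<close> delivers them.\<close>

definition eigf where
  "eigf l = {x. (\<forall>t. t \<notin> {0..T} \<longrightarrow> x t = 0) \<and> (\<exists>y. sol l 0 T x y \<and> W (x 0) (x T) \<and>
     (\<forall>c d. W c d \<longrightarrow> hermitian_inner (y T - \<eta>T (x 0) (x T)) d = hermitian_inner (y 0 - \<eta>0 (x 0) (x T)) c))}"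

definition node_map where "node_map x = (\<lambda>t. if t \<in> nodes then x t else (0::complex^'n))"

lemma node_map_linear: "Vector_Spaces.linear (\<lambda>c f t. c *s f t) (\<lambda>c f t. c *s f t) node_map"
  by unfold_locales (auto simp: node_map_def fun_eq_iff vec_eq_iff algebra_simps)

lemma node_map_ends: "node_map x 0 = x 0" "node_map x T = x T" "i \<le> m \<Longrightarrow> node_map x (nd i) = x (nd i)"
proof -
  have "nd 0 \<in> nodes" "nd m \<in> nodes" "i \<le> m \<Longrightarrow> nd i \<in> nodes" unfolding nodes_def by (blast intro: atMost_iff[THEN iffD2])+
  then show "node_map x 0 = x 0" "node_map x T = x T" "i \<le> m \<Longrightarrow> node_map x (nd i) = x (nd i)" by (simp_all add: node_map_def)
qed

text \<open>Testing with a vector supported at one interior node shows that the momentum has no jump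
  there, so the pieces belong to one solution. Testing with end values gives the natural boundary
  condition.\<close>

lemma kernel_eigf:
  assumes l: "l \<le> M" and v: "v \<in> V" and ker: "\<And>w. w \<in> V \<Longrightarrow> H l v w = 0"
  shows "\<exists>x\<in>eigf l. node_map x = v"
proof -
  have match: "Y l v i (nd (Suc i)) = Y l v (Suc i) (nd (Suc i))" if i: "Suc i < m" for i
  proof -
    have "hermitian_inner (Y l v i (nd (Suc i)) - Y l v (Suc i) (nd (Suc i))) a = 0" for a
    proof -
      define w where "w t = (if t = nd (Suc i) then a else 0)" for t
      have w: "w (nd k) = (if k = Suc i then a else 0)" for k by (simp add: w_def)
      have wT: "w 0 = 0" "w T = 0" using w[of 0] w[of m] i by auto
      then have "w \<in> V" using W0 i by (auto simp: V_def nodes_def w_def)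
      then have "0 = H l v w" using ker by simp
      also have "\<dots> = (\<Sum>k<m. (if k = i then hermitian_inner (Y l v k (nd (Suc k))) a else 0)
          - (if k = Suc i then hermitian_inner (Y l v k (nd k)) a else 0))"
        unfolding H_def wT by (auto simp: w hi.zero_right bd_def intro!: sum.cong)
      also have "\<dots> = hermitian_inner (Y l v i (nd (Suc i))) a - hermitian_inner (Y l v (Suc i) (nd (Suc i))) a"
        using i by (simp add: sum_subtractf sum.delta)
      finally show ?thesis by (simp add: hi.diff_left)
    qed
    then show ?thesis using hermitian_eq_zero by (metis eq_iff_diff_eq_0)
  qed
  have 0: "{0..T} \<subseteq> {0..T}" "0 \<le> T" using T by auto
  \<comment> \<open>Instead of gluing the pieces, a solution on the whole interval is started from
    the data of the first piece and identified with each piece in turn; differentiability at the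
    nodes is then automatic.\<close>
  obtain x y where xy: "sol l 0 T x y" "x 0 = v 0" "y 0 = Y l v 0 0"
    using ivp_exists[OF 0(2,1)] by blast
  have agree: "x \<tau> = X l v i \<tau> \<and> y \<tau> = Y l v i \<tau>" if "i < m" "\<tau> \<in> {nd i..nd (Suc i)}" for i \<tau>
    using that
  proof (induction i arbitrary: \<tau>)
    case 0
    show ?case
      using ivp_unique[OF sol_subset[OF xy(1) piece[OF 0(1)]] X_sol[OF l 0(1)] piece[OF 0(1)] _ _ 0(2), of v]
        xy X_left[OF l 0(1), of v] by simp
  next
    case (Suc i)
    have i: "i < m" using Suc by simp
    have "x (nd (Suc i)) = X l v i (nd (Suc i)) \<and> y (nd (Suc i)) = Y l v i (nd (Suc i))"
      using Suc.IH[OF i nd_ends(2)] .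
    then have "x (nd (Suc i)) = X l v (Suc i) (nd (Suc i))" "y (nd (Suc i)) = Y l v (Suc i) (nd (Suc i))"
      using X_right[OF l i] X_left[OF l Suc.prems(1)] match[OF Suc.prems(1)] by auto
    then show ?case
      using ivp_unique[OF sol_subset[OF xy(1) piece[OF Suc.prems(1)]] X_sol[OF l Suc.prems(1)] piece[OF Suc.prems(1)] _ _ Suc.prems(2)] by blast
  qed
  obtain k where k: "m = Suc k" using m by (cases m) auto
  have km: "k < m" using k by simp
  have yT: "y T = Y l v k T" using agree[OF km nd_ends(2)] k nd_m by simp
  have xnd: "x (nd i) = v (nd i)" if "i \<le> m" for i
  proof (cases "i = m")
    case True
    then show ?thesis using agree[OF km nd_ends(2)] X_right[OF l km, of v] k by simp
  next
    case False
    then have "i < m" using that by simp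
    then show ?thesis using agree[OF _ nd_ends(1)] X_left[OF l, of i v] by simp
  qed
  have xT: "x T = v T" using xnd[of m] by simp
  \<comment> \<open>Eigenfunctions are represented by their extension by zero. Derivatives within
    \<open>{0..T}\<close> are unaffected.\<close>
  define x' where "x' t = (if t \<in> {0..T} then x t else 0)" for t
  have x': "x' t = x t" if "t \<in> {0..T}" for t using that by (simp add: x'_def)
  have "sol l 0 T x' y"
    unfolding sol_def
  proof
    fix \<tau> assume \<tau>: "\<tau> \<in> {0..T}"
    have d: "(x has_vector_derivative vel \<tau> (x \<tau>) (y \<tau>)) (at \<tau> within {0..T})"
      "(y has_vector_derivative frc l \<tau> (x \<tau>) (vel \<tau> (x \<tau>) (y \<tau>))) (at \<tau> within {0..T})"
      using xy(1) \<tau> by (auto simp: sol_def)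
    then show "(x' has_vector_derivative vel \<tau> (x' \<tau>) (y \<tau>)) (at \<tau> within {0..T}) \<and>
        (y has_vector_derivative frc l \<tau> (x' \<tau>) (vel \<tau> (x' \<tau>) (y \<tau>))) (at \<tau> within {0..T})"
      unfolding x'[OF \<tau>] using has_vector_derivative_transform[OF \<tau> x' d(1)] by blast
  qed
  moreover have "x' 0 = v 0" "x' T = v T" using xy xT 0 by (auto simp: x'_def)
  moreover have "hermitian_inner (y T - \<eta>T (v 0) (v T)) d = hermitian_inner (y 0 - \<eta>0 (v 0) (v T)) c" if W: "W c d" for c d
  proof -
    define w where "w t = (if t = 0 then c else if t = T then d else 0)" for t
    have w: "w (nd i) = (if i = 0 then c else if i = m then d else 0)" for i
      using nd_inj[of i 0] nd_inj[of i m] by (simp add: w_def del: nd_inj)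
    have wT: "w 0 = c" "w T = d" using w[of 0] w[of m] m by auto
    have "0 \<in> nodes" "T \<in> nodes" unfolding nodes_def using nd_0 nd_m by (metis atMost_iff image_eqI order_refl zero_le)+
    then have "w \<in> V" using W wT by (auto simp: V_def w_def)
    then have "0 = H l v w" using ker by simp
    \<comment> \<open>The end contributions are kept as separate conditionals because for
      \<open>m = 1\<close> they come from the same piece.\<close>
    also have "\<dots> = (\<Sum>i<m. (if i = k then hermitian_inner (Y l v i (nd (Suc i))) d else 0)
       - (if i = 0 then hermitian_inner (Y l v i (nd i)) c else 0)) + bd (v 0) (v T) c d"
    proof -
      have "w (nd (Suc i)) = (if i = k then d else 0)" "w (nd i) = (if i = 0 then c else 0)" if "i < m" for i
      proof -
        have "Suc i = m \<longleftrightarrow> i = k" "i \<noteq> m" using k that by auto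
        then show "w (nd (Suc i)) = (if i = k then d else 0)" "w (nd i) = (if i = 0 then c else 0)"
          using w[of "Suc i"] w[of i] by simp_all
      qed
      then show ?thesis unfolding H_def wT by (auto simp: hi.zero_right intro!: sum.cong)
    qed
    also have "\<dots> = hermitian_inner (y T) d - hermitian_inner (y 0) c + bd (v 0) (v T) c d"
    proof -
      have "nd (Suc k) = T" unfolding k[symmetric] by simp
      then show ?thesis using m km yT xy(3) by (simp add: sum_subtractf sum.delta)
    qed
    finally show ?thesis by (simp add: bd_def hi.diff_left algebra_simps)
  qed
  ultimately have "x' \<in> eigf l" using v by (auto simp: eigf_def x'_def V_def)
  moreover have "node_map x' = v"
  proof
    fix t show "node_map x' t = v t"
    proof (cases "t \<in> nodes")
      case True
      then obtain i where "i \<le> m" "t = nd i" by (auto simp: nodes_def)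
      then show ?thesis using xnd x' nd_mem True by (simp add: node_map_def)
    qed (use v in \<open>auto simp: V_def node_map_def\<close>)
  qed
  ultimately show ?thesis by blast
qed

lemma bform_split:
  assumes "C1_on 0 T x u"
  shows "bform l 0 T x u x u = (\<Sum>i<m. bform l (nd i) (nd (Suc i)) x u x u)"
proof -
  have "k \<le> m \<Longrightarrow> bform l 0 (nd k) x u x u = (\<Sum>i<k. bform l (nd i) (nd (Suc i)) x u x u)" for k
  proof (induction k)
    case 0
    show ?case by (simp add: bform_def)
  next
    case (Suc k)
    have sub: "{0..nd (Suc k)} \<subseteq> {0..T}" using nd_mem[OF Suc.prems] by auto
    have "0 \<le> nd k" using nd_mem[of k] Suc by simp
    moreover have "(\<lambda>\<tau>. dens l \<tau> (x \<tau>) (u \<tau>) (x \<tau>) (u \<tau>)) integrable_on {0..nd (Suc k)}"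
      using C1_on_subset[OF assms sub] sub by (intro dens_integrable)
    ultimately have "bform l 0 (nd k) x u x u + bform l (nd k) (nd (Suc k)) x u x u = bform l 0 (nd (Suc k)) x u x u"
      unfolding bform_def by (intro Henstock_Kurzweil_Integration.integral_combine) auto
    then show ?case using Suc by simp
  qed
  from this[of m] show ?thesis by simp
qed

text \<open>Restriction to the nodes is injective on the span of \<open>E\<close>: for a function
  vanishing at all nodes the energy is nonpositive by assumption and dominates the L^2 norm by
  goodness. By minimality \<open>H \<mu>\<close> is nonpositive on the image, which has the same
  dimension, and the spectral flow bound applies.\<close>

lemma minmax_broken:
  assumes \<mu>: "\<mu> < M" and E: "cfun.independent E"
    and Ex: "\<And>x. x \<in> cfun.span E \<Longrightarrow> (\<forall>t. t \<notin> {0..T} \<longrightarrow> x t = 0) \<and> W (x 0) (x T) \<and>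
      (\<exists>u. C1_on 0 T x u \<and> Re (bform \<mu> 0 T x u x u) + Re (bd (x 0) (x T) (x 0) (x T)) \<le> 0)"
  shows "\<exists>F K. finite F \<and> F \<subseteq> {..\<mu>} \<and> card E \<le> (\<Sum>l\<in>F. card (K l)) \<and>
     (\<forall>l\<in>F. cfun.independent (K l) \<and> K l \<subseteq> eigf l)"
proof -
  interpret N: Vector_Spaces.linear "\<lambda>c f t. c *s f t" "\<lambda>c f t. c *s f t" node_map by (rule node_map_linear)
  have \<mu>M: "\<mu> \<le> M" using \<mu> by simp
  have inj: "inj_on node_map (cfun.span E)"
    unfolding N.inj_on_iff_eq_0[OF cfun.subspace_span]
  proof (intro ballI impI)
    fix x assume x: "x \<in> cfun.span E" "node_map x = 0"
    obtain u where C1: "C1_on 0 T x u" and le: "Re (bform \<mu> 0 T x u x u) + Re (bd (x 0) (x T) (x 0) (x T)) \<le> 0"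
      using Ex[OF x(1)] by blast
    have nz: "x (nd i) = 0" if "i \<le> m" for i using node_map_ends(3)[OF that, of x] x(2) by simp
    have "x 0 = 0" "x T = 0" using nz[of 0] nz[of m] by auto
    then have bd0: "bd (x 0) (x T) (x 0) (x T) = 0" by (simp add: bd_def hi.zero_right)
    have C1i: "C1_on (nd i) (nd (Suc i)) x u" if "i < m" for i using C1_on_subset[OF C1 piece[OF that]] .
    define I where "I i = integral {nd i..nd (Suc i)} (\<lambda>\<tau>. (norm (x \<tau>))\<^sup>2)" for i
    have "I i \<le> Re (bform \<mu> (nd i) (nd (Suc i)) x u x u)" if "i < m" for i
      using good[OF \<mu>M that] C1i[OF that] nz[of i] nz[of "Suc i"] that by (auto simp: good_def I_def)
    then have "(\<Sum>i<m. I i) \<le> Re (bform \<mu> 0 T x u x u)"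
      unfolding bform_split[OF C1] Re_sum by (intro sum_mono) auto
    then have "(\<Sum>i<m. I i) \<le> 0" using le bd0 by simp
    moreover have I0: "0 \<le> I i" if "i < m" for i
      unfolding I_def
      by (intro integral_nonneg integrable_continuous_real continuous_intros C1_on_continuous[OF C1i] that) auto
    ultimately have Iz: "I i = 0" if "i < m" for i
      using that sum_nonneg_eq_0_iff[of "{..<m}" I] sum_nonneg[of "{..<m}" I] by force
    have "x t = 0" for t
    proof (cases "t \<in> {0..T}")
      case True
      \<comment> \<open>Index of a piece containing \<open>t\<close>; the minimum with
        \<open>m - 1\<close> takes care of \<open>t = T\<close>.\<close>
      define i where "i = min (nat \<lfloor>t * real m / T\<rfloor>) (m - 1)"
      have i: "i < m" using m by (auto simp: i_def)
      have q: "0 \<le> t * real m / T" using True T by simp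
      have "real i \<le> t * real m / T" using q by (simp add: i_def min_le_iff_disj) linarith
      then have 1: "nd i \<le> t" using T m by (simp add: nd_def field_simps)
      have "t * real m / T \<le> real (Suc i)"
      proof (cases "nat \<lfloor>t * real m / T\<rfloor> \<le> m - 1")
        case True
        then show ?thesis using q by (simp add: i_def min_absorb1) linarith
      next
        case False
        have "t * real m / T \<le> real m" using \<open>t \<in> {0..T}\<close> T mult_right_mono[of t T "real m"] by (simp add: pos_divide_le_eq mult.commute)
        then show ?thesis using False m by (simp add: i_def)
      qed
      then have 2: "t \<le> nd (Suc i)" using T m by (simp add: nd_def field_simps)
      show ?thesis
        using integral_sq_zero[of "nd i" "nd (Suc i)" x t] Iz[OF i] C1_on_continuous[OF C1i[OF i]] 1 2 good[OF \<mu>M i]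
        by (auto simp: I_def good_def)
    qed (use Ex[OF x(1)] in auto)
    then show "x = 0" by auto
  qed
  have iE: "cfun.independent (node_map ` E)" by (rule N.independent_injective_image[OF E inj])
  have cE: "card (node_map ` E) = card E"
    by (rule card_image) (rule inj_on_subset[OF inj cfun.span_superset])
  have EV: "node_map ` E \<subseteq> V"
  proof
    fix v assume "v \<in> node_map ` E"
    then obtain x where x: "x \<in> cfun.span E" "v = node_map x" using cfun.span_base by blast
    then show "v \<in> V" using Ex[OF x(1)] node_map_ends(1,2)[of x] by (auto simp: V_def node_map_def)
  qed
  have nonpos: "Re (H \<mu> v v) \<le> 0" if "v \<in> cfun.span (node_map ` E)" for v
  proof -
    from that have "v \<in> node_map ` cfun.span E" unfolding N.span_image .
    then obtain x where x: "v = node_map x" "x \<in> cfun.span E" by (rule imageE)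
    obtain u where C1: "C1_on 0 T x u" and le: "Re (bform \<mu> 0 T x u x u) + Re (bd (x 0) (x T) (x 0) (x T)) \<le> 0"
      using Ex[OF x(2)] by blast
    have "Re (H \<mu> v v) \<le> (\<Sum>i<m. Re (bform \<mu> (nd i) (nd (Suc i)) x u x u)) + Re (bd (v 0) (v T) (v 0) (v T))"
      using x node_map_ends(3)[of _ x] C1_on_subset[OF C1 piece] by (intro H_min[OF \<mu>M]) auto
    also have "\<dots> = Re (bform \<mu> 0 T x u x u) + Re (bd (x 0) (x T) (x 0) (x T))"
      unfolding bform_split[OF C1] Re_sum x(1) node_map_ends by simp
    finally show ?thesis using le by simp
  qed
  obtain c0 where c0: "\<And>l v. l \<le> c0 \<Longrightarrow> l \<le> M \<Longrightarrow> v \<in> V \<Longrightarrow> v \<noteq> 0 \<Longrightarrow> Re (H l v v) > 0" using H_pos by blast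
  \<comment> \<open>The minimum with \<mu> ensures that \<open>{c..\<mu>}\<close> contains \<mu>
    even if positivity already holds beyond it.\<close>
  define c where "c = min c0 \<mu>"
  obtain n where n: "cfun.rank_le V n" using V_rank by blast
  have "\<exists>F K. finite F \<and> F \<subseteq> {c..\<mu>} \<and> card (node_map ` E) \<le> (\<Sum>l\<in>F. card (K l)) \<and>
     (\<forall>l\<in>F. cfun.independent (K l) \<and> K l \<subseteq> {v \<in> V. \<forall>w\<in>V. H l v w = 0})"
  proof (rule cfun.spectral_flow_bound[OF V_subspace n _ _ _ _ EV iE])
    show "cfun.hermitian_on V (H l)" if "l \<in> {c..\<mu>}" for l using H_hermitian that \<mu> by auto
    show "continuous_on {c..\<mu>} (\<lambda>l. H l u v)" if "u \<in> V" "v \<in> V" for u v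
      by (rule continuous_on_subset[OF H_continuous[OF that]]) (use \<mu> in auto)
    show "Re (H c v v) > 0" if "v \<in> V" "v \<noteq> 0" for v using c0 that \<mu> by (auto simp: c_def)
    show "\<mu> \<in> {c..\<mu>}" by (simp add: c_def)
  qed (use nonpos in auto)
  then obtain F K where FK: "finite F" "F \<subseteq> {c..\<mu>}" "card E \<le> (\<Sum>l\<in>F. card (K l))"
    "\<And>l. l \<in> F \<Longrightarrow> cfun.independent (K l)" "\<And>l. l \<in> F \<Longrightarrow> K l \<subseteq> {v \<in> V. \<forall>w\<in>V. H l v w = 0}"
    unfolding cE by blast
  \<comment> \<open>Lift each kernel vector to an eigenfunction with these node values. Independence
    lifts along with it, because \<open>node_map\<close> sends the chosen functions back to the
    independent set \<open>K l\<close>.\<close>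
  have "\<exists>K'. cfun.independent K' \<and> K' \<subseteq> eigf l \<and> card K' = card (K l)" if l: "l \<in> F" for l
  proof -
    have lM: "l \<le> M" using l FK(2) \<mu> by auto
    have "\<forall>v\<in>K l. \<exists>x. x \<in> eigf l \<and> node_map x = v"
      using kernel_eigf[OF lM] FK(5)[OF l] by blast
    then obtain f where f: "\<And>v. v \<in> K l \<Longrightarrow> f v \<in> eigf l \<and> node_map (f v) = v" by metis
    have im: "node_map ` f ` K l = K l" using f by force
    have inj: "inj_on f (K l)" using f by (metis inj_onI)
    have "inj_on node_map (f ` K l)" using f by (auto simp: inj_on_def)
    then have "cfun.independent (f ` K l)"
      using cfun.independent_if_image_independent[OF node_map_linear, of "f ` K l"] FK(4)[OF l] im by simp
    then show ?thesis using f card_image[OF inj] by (intro exI[of _ "f ` K l"]) auto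
  qed
  then obtain K' where "\<And>l. l \<in> F \<Longrightarrow> cfun.independent (K' l) \<and> K' l \<subseteq> eigf l \<and> card (K' l) = card (K l)" by metis
  then show ?thesis using FK(1-3) by (intro exI[of _ F] exI[of _ K']) auto
qed

end

section \<open>Eigenfunctions as solutions of the Hamiltonian system\<close>

lemma sigma_finite_lebesgue: "sigma_finite_measure (lebesgue :: 'a::euclidean_space measure)"
proof
  obtain A :: "'a set set" where "countable A" "A \<subseteq> sets lborel" "\<Union>A = space lborel" "\<forall>a\<in>A. emeasure lborel a \<noteq> \<infinity>"
    using lborel.sigma_finite_countable by blast
  then show "\<exists>A::'a set set. countable A \<and> A \<subseteq> sets lebesgue \<and> \<Union>A = space lebesgue \<and> (\<forall>a\<in>A. emeasure lebesgue a \<noteq> \<infinity>)"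
    by (intro exI[of _ A]) (auto simp: subset_iff)
qed

text \<open>The assumption says that integrals over half-lines vanish for the extension by zero.
  Half-lines are stable under intersection and generate the Borel sets; Lebesgue sets differ from
  these by null sets, and a density whose integrals all vanish is zero almost everywhere.\<close>

lemma zero_indefinite_integral_AE:
  fixes d :: "real \<Rightarrow> 'a::euclidean_space"
  assumes d: "L2_on T d" and z: "\<And>t. t \<in> {0..T} \<Longrightarrow> (d has_integral 0) {0..t}"
  shows "AE t in lebesgue_on {0..T}. d t = 0"
proof -
  define e where "e t = indicator {0..T} t *\<^sub>R d t" for t
  have int: "integrable lebesgue e"
    using L2_on_absolutely_integrable[OF d] by (simp add: set_integrable_def e_def[abs_def])
  have sint: "set_integrable lebesgue A e" if "A \<in> sets lebesgue" for A
    unfolding set_integrable_def using integrable_mult_indicator[OF that int] .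
  let ?N = "\<lambda>A. set_lebesgue_integral lebesgue A e = 0"
  let ?G = "range (\<lambda>a::real. {..a})"
  have sets: "sigma_sets UNIV ?G = sets (borel :: real measure)"
    unfolding borel_eq_atMost by simp
  have base: "?N {..a}" for a
  proof -
    have "set_lebesgue_integral lebesgue {..a} e = set_lebesgue_integral lebesgue {0..min a T} d"
      unfolding set_lebesgue_integral_def e_def
      by (intro Bochner_Integration.integral_cong refl) (auto simp: indicator_def)
    also have "\<dots> = 0"
    proof (cases "0 \<le> min a T")
      case True
      then have "{0..min a T} \<subseteq> {0..T}" by auto
      then have "set_integrable lebesgue {0..min a T} d"
        using set_integrable_subset[OF L2_on_absolutely_integrable[OF d]] by auto
      from set_lebesgue_integral_eq_integral(2)[OF this] show ?thesis
        using integral_unique[OF z, of "min a T"] True by auto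
    next
      case False
      then have "{0..min a T} = {}" by simp
      then show ?thesis by (simp add: set_lebesgue_integral_def)
    qed
    finally show ?thesis .
  qed
  have tot: "?N UNIV"
  proof -
    have "set_lebesgue_integral lebesgue UNIV e = set_lebesgue_integral lebesgue {..T} e"
      unfolding set_lebesgue_integral_def e_def
      by (intro Bochner_Integration.integral_cong refl) (auto simp: indicator_def)
    then show ?thesis using base by simp
  qed
  have leb: "A \<in> sets lebesgue" if "A \<in> sigma_sets UNIV ?G" for A
    using that unfolding sets by (simp add: sets_completionI_sets)
  have borel: "?N A" if "A \<in> sigma_sets UNIV ?G" for A
  proof (rule sigma_sets_induct_disjoint[of ?G UNIV A ?N])
    show "Int_stable ?G"
    proof (rule Int_stableI)
      fix a b assume "a \<in> ?G" "b \<in> ?G"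
      then obtain x y where "a = {..x}" "b = {..y}" by auto
      then have "a \<inter> b = {..min x y}" by auto
      then show "a \<inter> b \<in> ?G" by auto
    qed
    show "?N A" if "A \<in> ?G" for A using that base by auto
    show "?N {}" by (simp add: set_lebesgue_integral_def)
    show "?N (UNIV - A)" if A: "A \<in> sigma_sets UNIV ?G" "?N A" for A
    proof -
      have "set_lebesgue_integral lebesgue (A \<union> (UNIV - A)) e
          = set_lebesgue_integral lebesgue A e + set_lebesgue_integral lebesgue (UNIV - A) e"
        using leb[OF A(1)] by (intro set_integral_Un sint) auto
      then show ?thesis using A(2) tot by simp
    qed
    show "?N (\<Union>i. A i)" if A: "disjoint_family A" "range A \<subseteq> sigma_sets UNIV ?G" "\<And>i. ?N (A i)" for A :: "nat \<Rightarrow> real set"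
    proof -
      have m: "A i \<in> sets lebesgue" for i using A(2) leb by auto
      have "set_lebesgue_integral lebesgue (\<Union>i. A i) e = (\<Sum>i. set_lebesgue_integral lebesgue (A i) e)"
        using A(1) m by (intro lebesgue_integral_countable_add sint sets.countable_nat_UN) (auto simp: disjoint_family_on_def)
      then show ?thesis using A(3) by simp
    qed
  qed (use that in auto)
  have "AE t in lebesgue. e t = 0"
  proof (rule sigma_finite_measure.density_zero[OF sigma_finite_lebesgue int])
    fix A :: "real set" assume A: "A \<in> sets lebesgue"
    obtain S N N' where S: "A = S \<union> N" "N \<subseteq> N'" "N' \<in> null_sets lborel" "S \<in> sets lborel"
      using sets_completionE[OF A] .
    have N': "N' \<in> null_sets lebesgue" using S(3) null_sets_completionI by blast
    have Sl: "S \<in> sets lebesgue" using S(4) by (simp add: sets_completionI_sets)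
    have "set_lebesgue_integral lebesgue A e = set_lebesgue_integral lebesgue S e"
    proof (rule set_integral_cong_set)
      show "AE x in lebesgue. (x \<in> S) = (x \<in> A)"
        by (rule AE_I'[OF N']) (use S in auto)
    qed (use sint[OF A] sint[OF Sl] in \<open>auto simp: set_integrable_def set_borel_measurable_def\<close>)
    also have "\<dots> = 0" using borel[of S] S(4) unfolding sets by simp
    finally show "set_lebesgue_integral lebesgue A e = 0" .
  qed
  then have "AE t in lebesgue. t \<in> {0..T} \<longrightarrow> d t = 0"
    by (rule AE_mp) (auto simp: e_def intro!: AE_I2)
  then show ?thesis by (subst AE_restrict_space_iff) auto
qed

text \<open>Since \<open>weak_deriv\<close> is an arbitrary choice of representative, statements
  about it can be transferred only almost everywhere; this supplies the transfer.\<close>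

lemma weak_derivative_on_AE_unique:
  assumes "L2_on T g" "L2_on T h" "weak_derivative_on T f g" "weak_derivative_on T f h"
  shows "AE t in lebesgue_on {0..T}. g t = h t"
proof -
  have "L2_on T (\<lambda>t. g t + - h t)" using assms by (intro L2_on_add L2_on_uminus)
  then have "L2_on T (\<lambda>t. g t - h t)" by simp
  moreover have "((\<lambda>t. g t - h t) has_integral 0) {0..t}" if "t \<in> {0..T}" for t
    using weak_derivative_on_diff[OF assms(3,4)] that by (auto simp: weak_derivative_on_def)
  ultimately have "AE t in lebesgue_on {0..T}. g t - h t = 0"
    by (rule zero_indefinite_integral_AE)
  then show ?thesis by simp
qed

lemma weak_derivative_on_cong:
  assumes "\<And>t. t \<in> {0..T} \<Longrightarrow> f t = f' t" "\<And>t. t \<in> {0..T} \<Longrightarrow> g t = g' t"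
  shows "weak_derivative_on T f g \<longleftrightarrow> weak_derivative_on T f' g'"
proof -
  have "(g has_integral f t - f 0) {0..t} \<longleftrightarrow> (g' has_integral f' t - f' 0) {0..t}" if "t \<in> {0..T}" for t
  proof -
    have "f t - f 0 = f' t - f' 0" using assms(1)[of t] assms(1)[of 0] that by simp
    moreover have "(g has_integral c) {0..t} \<longleftrightarrow> (g' has_integral c) {0..t}" for c
      using assms(2) that by (intro has_integral_cong) auto
    ultimately show ?thesis by (simp only:)
  qed
  then show ?thesis unfolding weak_derivative_on_def by (simp only: Ball_def cong: imp_cong)
qed

lemma weak_derivative_on_AE_cong:
  assumes ae: "AE t in lebesgue_on {0..T}. g t = h t" and w: "weak_derivative_on T f g"
  shows "weak_derivative_on T f h"
  unfolding weak_derivative_on_def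
proof
  fix t assume t: "t \<in> {0..T}"
  have "AE t in lebesgue. t \<in> {0..T} \<longrightarrow> g t = h t"
    using ae by (subst (asm) AE_restrict_space_iff) auto
  then obtain N where N: "N \<in> null_sets lebesgue" "{t \<in> space lebesgue. \<not> (t \<in> {0..T} \<longrightarrow> g t = h t)} \<subseteq> N"
    by (rule AE_E3) auto
  show "(h has_integral f t - f 0) {0..t}"
  proof (rule has_integral_spike)
    show "negligible N" using N(1) by (simp add: negligible_iff_null_sets)
    show "(g has_integral f t - f 0) {0..t}" using w t by (simp add: weak_derivative_on_def)
    show "h x = g x" if "x \<in> {0..t} - N" for x using N(2) that t by auto
  qed
qed

locale sturm_liouville_H1 = sturm_liouville T P Q R
  for T :: real and P Q R :: "real \<Rightarrow> real^'n^'n" +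
  assumes P_H1: "H1_on T P" and Q_H1: "H1_on T Q"
begin

text \<open>If \<open>P \<xi>\<close> is in \<open>H\<^sup>1\<close>, the candidate derivative of \<open>\<xi>\<close> is \<open>P\<^sup>-\<^sup>1 ((P \<xi>)' - P' \<xi>)\<close>; its
  primitive agrees with \<open>\<xi>\<close> because the difference solves a homogeneous Volterra equation.\<close>

lemma H1_on_divide:
  assumes \<xi>: "continuous_on {0..T} \<xi>" and \<eta>: "H1_on T (\<lambda>t. P t \<odot> \<xi> t)"
  shows "H1_on T \<xi>"
proof -
  have T0: "0 \<le> T" using T by simp
  obtain P' where P': "L2_on T P'" "weak_derivative_on T P P'" using P_H1 unfolding H1_on_def by blast
  obtain \<eta>' where \<eta>': "L2_on T \<eta>'" "weak_derivative_on T (\<lambda>t. P t \<odot> \<xi> t) \<eta>'" using \<eta> unfolding H1_on_def by blast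
  have L2P: "L2_on T (\<lambda>t. P' t \<odot> f t)" if "continuous_on {0..T} f" for f :: "real \<Rightarrow> complex^'n"
    using L2_on_prod_left[OF bounded_bilinear.flip[OF bounded_bilinear_cmv] that P'(1)] .
  define g where "g t = S t \<odot> (\<eta>' t + - (P' t \<odot> \<xi> t))" for t
  have g: "L2_on T g"
    unfolding g_def[abs_def]
    by (intro L2_on_prod_left[OF bounded_bilinear_cmv continuous_on_S] L2_on_add L2_on_uminus \<eta>' L2P \<xi>)
  define \<zeta> where "\<zeta> t = \<xi> 0 + integral {0..t} g" for t
  have \<zeta>: "weak_derivative_on T \<zeta> g"
    unfolding weak_derivative_on_def
  proof
    fix t assume "t \<in> {0..T}"
    then have "g integrable_on {0..t}" by (intro L2_on_integrable_sub(1)[OF g]) auto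
    then show "(g has_integral \<zeta> t - \<zeta> 0) {0..t}" by (simp add: \<zeta>_def integrable_integral)
  qed
  have \<zeta>c: "continuous_on {0..T} \<zeta>" by (rule weak_derivative_on_continuous[OF \<zeta> T0])
  define \<phi> where "\<phi> t = \<zeta> t - \<xi> t" for t
  have \<phi>c: "continuous_on {0..T} \<phi>" unfolding \<phi>_def by (intro continuous_on_diff \<zeta>c \<xi>)
  have "weak_derivative_on T (\<lambda>t. P t \<odot> \<zeta> t - P t \<odot> \<xi> t) (\<lambda>t. (P t \<odot> g t + P' t \<odot> \<zeta> t) - \<eta>' t)"
    by (intro weak_derivative_on_diff H1_on_prod_derivative(2)[OF bounded_bilinear_cmv T0] P' g \<zeta> \<eta>')
  \<comment> \<open>By the choice of \<open>g\<close> the terms with \<open>\<eta>'\<close> cancel,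
    which leaves the homogeneous equation that the derivative of P \<phi> is P' \<phi>.\<close>
  then have w: "weak_derivative_on T (\<lambda>t. P t \<odot> \<phi> t) (\<lambda>t. P' t \<odot> \<phi> t)"
    by (rule weak_derivative_on_cong[THEN iffD1, rotated -1]) (simp_all add: \<phi>_def g_def S_right cmv_simps)
  obtain p where p: "p > 0" "\<And>t v. t \<in> {0..T} \<Longrightarrow> p * (norm v)\<^sup>2 \<le> (P t \<odot> v) \<bullet> v"
    using P_coercive by blast
  obtain C where C: "\<And>(A::real^'n^'n) v. norm (A \<odot> v) \<le> norm A * norm v * C" "C > 0"
    using bounded_bilinear.pos_bounded[OF bounded_bilinear_cmv] by blast
  have le: "norm (\<phi> t) \<le> C / p * integral {0..t} (\<lambda>s. norm (P' s) * norm (\<phi> s))" if t: "t \<in> {0..T}" for t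
  proof -
    have sub: "{0..t} \<subseteq> {0..T}" using t by auto
    have "\<phi> 0 = 0" by (simp add: \<phi>_def \<zeta>_def)
    then have I: "((\<lambda>s. P' s \<odot> \<phi> s) has_integral P t \<odot> \<phi> t) {0..t}"
      using w t by (auto simp: weak_derivative_on_def cmv_simps)
    have "L2_on T (\<lambda>s. norm (\<phi> s) *\<^sub>R P' s)"
      by (intro L2_on_prod_left[OF bounded_bilinear_scaleR _ P'(1)] continuous_on_norm \<phi>c)
    from L2_on_integrable_sub(2)[OF this sub]
    have Ii: "(\<lambda>s. norm (P' s) * norm (\<phi> s)) integrable_on {0..t}" by (simp add: mult.commute)
    have "norm (P t \<odot> \<phi> t) = norm (integral {0..t} (\<lambda>s. P' s \<odot> \<phi> s))" using I by (simp add: integral_unique)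
    also have "\<dots> \<le> integral {0..t} (\<lambda>s. C * (norm (P' s) * norm (\<phi> s)))"
    proof (rule integral_norm_bound_integral)
      show "(\<lambda>s. P' s \<odot> \<phi> s) integrable_on {0..t}" using I by blast
      show "(\<lambda>s. C * (norm (P' s) * norm (\<phi> s))) integrable_on {0..t}"
        using integrable_on_cmult_left[OF Ii, of C] by simp
      show "norm (P' s \<odot> \<phi> s) \<le> C * (norm (P' s) * norm (\<phi> s))" for s using C(1)[of "P' s" "\<phi> s"] by (simp add: mult.commute)
    qed
    finally have 1: "norm (P t \<odot> \<phi> t) \<le> C * integral {0..t} (\<lambda>s. norm (P' s) * norm (\<phi> s))" by simp
    have "p * norm (\<phi> t) \<le> norm (P t \<odot> \<phi> t)"
    proof (cases "\<phi> t = 0")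
      case False
      have "p * (norm (\<phi> t))\<^sup>2 \<le> norm (P t \<odot> \<phi> t) * norm (\<phi> t)" using p(2)[OF t, of "\<phi> t"] norm_cauchy_schwarz order_trans by blast
      then show ?thesis using False by (simp add: power2_eq_square mult.assoc[symmetric])
    qed simp
    then show ?thesis using 1 p(1) by (simp add: field_simps)
  qed
  have "\<phi> t = 0" if "t \<in> {0..T}" for t
    by (rule volterra_unique[OF \<phi>c P'(1) _ le that]) (use C p in auto)
  then have "weak_derivative_on T \<xi> g"
    using \<zeta> by (subst weak_derivative_on_cong[of T \<xi> \<zeta> g g]) (auto simp: \<phi>_def)
  then show ?thesis using g unfolding H1_on_def by blast
qed

lemma dot_eq:
  assumes "\<And>t. t \<in> {0..T} \<Longrightarrow> (x has_vector_derivative g t) (at t within {0..T})" "t \<in> {0..T}"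
  shows "dot T x t = g t"
  unfolding dot_def using vector_derivative_within_closed_interval[OF T assms(2) assms(1)[OF assms(2)]] .

text \<open>The eigenvalue equation, given almost everywhere, turns into a pointwise one: it
  identifies the weak derivative of y with a continuous function, so y is classically
  differentiable. The product rule in H^1 makes y weakly differentiable in the first place.\<close>

lemma eigenspace_sol:
  assumes "x \<in> eigenspace T P Q R \<Lambda> l"
  shows "sol l 0 T x (quasi_deriv T P Q x)" "boundary_vec T P Q x \<in> \<Lambda>" "\<And>t. t \<notin> {0..T} \<Longrightarrow> x t = 0"
proof -
  have T0: "0 \<le> T" using T by simp
  have x: "H2_on T x" and ae: "AE t in lebesgue_on {0..T}. SL_op T P Q R x t = complex_of_real l *s x t"
    using assms by (auto simp: eigenspace_def SL_dom_def)
  show "boundary_vec T P Q x \<in> \<Lambda>" "\<And>t. t \<notin> {0..T} \<Longrightarrow> x t = 0"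
    using assms by (auto simp: eigenspace_def SL_dom_def)
  obtain g where g: "H1_on T g" "weak_derivative_on T x g" using x unfolding H2_on_def by blast
  have gc: "continuous_on {0..T} g" using H1_on_continuous[OF g(1) T0] .
  have xd: "(x has_vector_derivative g t) (at t within {0..T})" if "t \<in> {0..T}" for t
    using weak_derivative_on_continuousD[OF g(2) gc that] .
  have dot: "dot T x t = g t" if "t \<in> {0..T}" for t by (rule dot_eq[OF xd that])
  let ?y = "quasi_deriv T P Q x"
  have y: "?y t = mom t (x t) (g t)" if "t \<in> {0..T}" for t
    using dot[OF that] by (simp add: quasi_deriv_def mom_def)
  have "H1_on T (\<lambda>t. P t \<odot> g t + Q t \<odot> x t)"
    using g(1) H1_on_classical[OF xd gc]
    by (intro H1_on_add H1_on_prod[OF bounded_bilinear_cmv T0] P_H1 Q_H1)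
  then obtain h where h: "L2_on T h" "weak_derivative_on T (\<lambda>t. P t \<odot> g t + Q t \<odot> x t) h"
    unfolding H1_on_def by blast
  then have "weak_derivative_on T ?y h"
    using y by (subst weak_derivative_on_cong[of T ?y "\<lambda>t. P t \<odot> g t + Q t \<odot> x t" h h]) (auto simp: mom_def)
  then have wd: "L2_on T (weak_deriv T ?y) \<and> weak_derivative_on T ?y (weak_deriv T ?y)"
    unfolding weak_deriv_def using h(1) someI_ex[of "\<lambda>g. L2_on T g \<and> weak_derivative_on T ?y g"] by blast
  have "AE t in lebesgue_on {0..T}. weak_deriv T ?y t = frc l t (x t) (g t)"
    using ae
  proof (rule AE_mp, intro AE_I2 impI)
    fix t assume "t \<in> space (lebesgue_on {0..T})" and e: "SL_op T P Q R x t = complex_of_real l *s x t"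
    then have "t \<in> {0..T}" by simp
    then show "weak_deriv T ?y t = frc l t (x t) (g t)"
      using e dot by (simp add: SL_op_def frc_def scaleR_vec_scale algebra_simps)
  qed
  then have "weak_derivative_on T ?y (\<lambda>t. frc l t (x t) (g t))"
    by (rule weak_derivative_on_AE_cong) (use wd in simp)
  moreover have "continuous_on {0..T} (\<lambda>t. frc l t (x t) (g t))"
    by (intro continuous_on_frc gc weak_derivative_on_continuous[OF g(2) T0]) auto
  ultimately have yd: "(?y has_vector_derivative frc l t (x t) (g t)) (at t within {0..T})" if "t \<in> {0..T}" for t
    by (rule weak_derivative_on_continuousD[OF _ _ that])
  have "vel t (x t) (?y t) = g t" if "t \<in> {0..T}" for t
    unfolding y[OF that] by (rule vel_mom[OF that])
  then show "sol l 0 T x ?y" using xd yd by (simp add: sol_def)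
qed

text \<open>The issue is that x lies in H^2: P x' = y - Q x is in H^1, and
  \<open>H1_on_divide\<close> removes the factor P.\<close>

lemma sol_eigenspace:
  assumes sol: "sol l 0 T x y" and x0: "\<And>t. t \<notin> {0..T} \<Longrightarrow> x t = 0"
    and b: "vjoin (vjoin (y 0) (x 0)) (vjoin (y T) (x T)) \<in> \<Lambda>"
  shows "x \<in> eigenspace T P Q R \<Lambda> l"
proof -
  have T0: "0 \<le> T" and sub: "{0..T} \<subseteq> {0..T}" using T by auto
  define g where "g t = vel t (x t) (y t)" for t
  have C1: "C1_on 0 T x g" unfolding g_def[abs_def] by (rule sol_C1[OF sol sub])
  have gc: "continuous_on {0..T} g" and xd: "\<And>t. t \<in> {0..T} \<Longrightarrow> (x has_vector_derivative g t) (at t within {0..T})"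
    using C1 by (auto simp: C1_on_def)
  have xc: "continuous_on {0..T} x" using C1_on_continuous[OF C1] .
  have fc: "continuous_on {0..T} (\<lambda>t. frc l t (x t) (g t))" by (intro continuous_on_frc sub gc xc)
  have yd: "\<And>t. t \<in> {0..T} \<Longrightarrow> (y has_vector_derivative frc l t (x t) (g t)) (at t within {0..T})"
    using sol by (auto simp: sol_def g_def)
  have Pg: "P t \<odot> g t = y t + - (Q t \<odot> x t)" if "t \<in> {0..T}" for t
    using S_right[OF that] by (simp add: g_def vel_def)
  have "H1_on T (\<lambda>t. y t + - (Q t \<odot> x t))"
  proof (intro H1_on_add)
    show "H1_on T y" using H1_on_classical[OF yd fc] .
    have "H1_on T (\<lambda>t. Q t \<odot> ((-1) *s x t))"
      by (intro H1_on_prod[OF bounded_bilinear_cmv T0 Q_H1] H1_on_classical[of T "\<lambda>t. (-1) *s x t" "\<lambda>t. (-1) *s g t"])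
         (use C1_on_scale[OF C1, of "-1"] in \<open>auto simp: C1_on_def\<close>)
    then show "H1_on T (\<lambda>t. - (Q t \<odot> x t))" by (simp add: bounded_bilinear.minus_right[OF bounded_bilinear_cmv])
  qed
  then obtain k where k: "L2_on T k" "weak_derivative_on T (\<lambda>t. y t + - (Q t \<odot> x t)) k" unfolding H1_on_def by blast
  then have "weak_derivative_on T (\<lambda>t. P t \<odot> g t) k"
    using Pg by (subst weak_derivative_on_cong[of T "\<lambda>t. P t \<odot> g t" "\<lambda>t. y t + - (Q t \<odot> x t)" k k]) auto
  then have "H1_on T (\<lambda>t. P t \<odot> g t)" using k(1) unfolding H1_on_def by blast
  then have "H1_on T g" by (rule H1_on_divide[OF gc])
  then have H2: "H2_on T x" unfolding H2_on_def using weak_derivative_on_classical[OF xd] by blast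
  have dot: "dot T x t = g t" if "t \<in> {0..T}" for t by (rule dot_eq[OF xd that])
  let ?y = "quasi_deriv T P Q x"
  have y: "?y t = y t" if "t \<in> {0..T}" for t
    using dot[OF that] mom_vel[OF that, of "x t" "y t"] by (simp add: quasi_deriv_def mom_def g_def)
  have w: "weak_derivative_on T ?y (\<lambda>t. frc l t (x t) (g t))"
    using weak_derivative_on_classical[OF yd] y
    by (subst weak_derivative_on_cong[of T ?y y]) auto
  have f2: "L2_on T (\<lambda>t. frc l t (x t) (g t))" by (rule L2_on_continuous[OF fc])
  have wd: "L2_on T (weak_deriv T ?y) \<and> weak_derivative_on T ?y (weak_deriv T ?y)"
    unfolding weak_deriv_def using w f2 someI_ex[of "\<lambda>g. L2_on T g \<and> weak_derivative_on T ?y g"] by blast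
  have "AE t in lebesgue_on {0..T}. weak_deriv T ?y t = frc l t (x t) (g t)"
    using weak_derivative_on_AE_unique wd w f2 by blast
  then have "AE t in lebesgue_on {0..T}. SL_op T P Q R x t = complex_of_real l *s x t"
  proof (rule AE_mp, intro AE_I2 impI)
    fix t assume "t \<in> space (lebesgue_on {0..T})" and e: "weak_deriv T ?y t = frc l t (x t) (g t)"
    then have "t \<in> {0..T}" by simp
    then show "SL_op T P Q R x t = complex_of_real l *s x t"
      using e dot by (simp add: SL_op_def frc_def scaleR_vec_scale)
  qed
  moreover have "boundary_vec T P Q x \<in> \<Lambda>"
    using b y[of 0] y[of T] T0 by (simp add: boundary_vec_def)
  ultimately show ?thesis using H2 x0 by (auto simp: eigenspace_def SL_dom_def)
qed

end

section \<open>Lagrangian subspaces\<close>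

text \<open>Projection to the end values of x. Its kernel is \<open>Dirichlet\<close>, and the image
  of \<Lambda> is the essential part of the boundary condition.\<close>

definition boundary_trace :: "'n::finite bspace \<Rightarrow> complex^('n + 'n)" where
  "boundary_trace w = vjoin (vbot (vtop w)) (vbot (vbot w))"

text \<open>The Lagrangian property without dimensions. Its last clause, a membership test by
  pairing with \<Lambda>, is what recovers the boundary condition from a vanishing first
  variation.\<close>

definition max_isotropic :: "'n::finite bspace set \<Rightarrow> bool" where
  "max_isotropic \<Lambda> \<longleftrightarrow> vec.subspace \<Lambda> \<and> (\<forall>u\<in>\<Lambda>. \<forall>v\<in>\<Lambda>. Omega u v = 0) \<and>
     (\<forall>u. (\<forall>v\<in>\<Lambda>. Omega u v = 0) \<longrightarrow> u \<in> \<Lambda>)"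

lemma vtop_vjoin [simp]: "vtop (vjoin u v) = u" and vbot_vjoin [simp]: "vbot (vjoin u v) = v"
  by (simp_all add: vtop_def vbot_def vjoin_def vec_eq_iff)

lemma vjoin_vtop_vbot [simp]: "vjoin (vtop w) (vbot w) = w"
  by (simp add: vtop_def vbot_def vjoin_def vec_eq_iff split: sum.split)

lemma vjoin_eq_iff [simp]: "vjoin a b = vjoin c d \<longleftrightarrow> a = c \<and> b = d"
  by (metis vtop_vjoin vbot_vjoin)

lemma vtop_add [simp]: "vtop (u + v) = vtop u + vtop v" and vbot_add [simp]: "vbot (u + v) = vbot u + vbot v"
  and vtop_scale [simp]: "vtop (c *s u) = c *s vtop u" and vbot_scale [simp]: "vbot (c *s u) = c *s vbot u"
  and vtop_zero [simp]: "vtop 0 = 0" and vbot_zero [simp]: "vbot 0 = 0"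
  by (simp_all add: vtop_def vbot_def vec_eq_iff)

lemma vjoin_add: "vjoin a b + vjoin c d = vjoin (a + c) (b + d :: 'a::ab_semigroup_add^'n)"
  and vjoin_scale: "k *s vjoin p q = vjoin (k *s p) (k *s q :: complex^'n)"
  and vjoin_zero [simp]: "vjoin 0 0 = (0 :: complex^('m::finite + 'n::finite))"
  by (simp_all add: vjoin_def vec_eq_iff split: sum.split)

lemma trace_linear: "Vector_Spaces.linear (*s) (*s) boundary_trace"
  by unfold_locales (simp_all add: boundary_trace_def vjoin_add vjoin_scale)

lemma sum_UNIV_Plus: "(\<Sum>i\<in>(UNIV :: ('m::finite + 'n::finite) set). f i) = (\<Sum>k\<in>UNIV. f (Inl k)) + (\<Sum>k\<in>UNIV. f (Inr k))"
  by (subst UNIV_Plus_UNIV[symmetric]) (simp add: sum.Plus del: UNIV_Plus_UNIV)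

lemma hermitian_split: "hermitian_inner u v = hermitian_inner (vtop u) (vtop v) + hermitian_inner (vbot u) (vbot v)"
  by (simp add: hermitian_inner_def sum_UNIV_Plus vtop_def vbot_def)

lemma J_mat_mult: "J_mat *v z = vjoin (- vbot z) (vtop z)"
proof -
  have "(J_mat *v z) $ i = vjoin (- vbot z) (vtop z) $ i" for i
    by (cases i) (simp_all add: matrix_vector_mult_def J_mat_def sum_UNIV_Plus vjoin_def vtop_def vbot_def
        if_distrib[of "\<lambda>x. x * _"] cong: if_cong)
  then show ?thesis by (simp add: vec_eq_iff)
qed

lemma omega_eq: "omega u v = hermitian_inner (vtop u) (vbot v) - hermitian_inner (vbot u) (vtop v)"
  unfolding omega_def J_mat_mult by (subst hermitian_split) (simp add: hi.minus_left)

lemma Omega_eq: "Omega u v = hermitian_inner (vbot (vtop u)) (vtop (vtop v)) - hermitian_inner (vtop (vtop u)) (vbot (vtop v))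
    + hermitian_inner (vtop (vbot u)) (vbot (vbot v)) - hermitian_inner (vbot (vbot u)) (vtop (vbot v))"
  unfolding Omega_def omega_eq by simp

text \<open>With \<open>\<Omega>(u, v) = \<langle>K u, v\<rangle>\<close> and \<open>K\<^sup>2 = -1\<close>, the orthogonal complement of \<open>\<Lambda>\<close> with respect to \<open>\<Omega>\<close>
  meets \<open>K \<Lambda>\<close> only in \<open>0\<close>.\<close>

lemma Lag_max_isotropic:
  assumes L: "\<Lambda> \<in> (Lag :: 'n::finite bspace set set)"
  shows "max_isotropic \<Lambda>"
proof -
  have sub: "vec.subspace \<Lambda>" and iso: "\<And>u v. u \<in> \<Lambda> \<Longrightarrow> v \<in> \<Lambda> \<Longrightarrow> Omega u v = 0" and d: "vec.dim \<Lambda> = 2 * CARD('n)"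
    using L by (auto simp: Lag_def)
  define S where "S = {u. \<forall>v\<in>\<Lambda>. Omega u v = 0}"
  define K :: "'n bspace \<Rightarrow> 'n bspace" where
    "K u = vjoin (vjoin (vbot (vtop u)) ((-1) *s vtop (vtop u))) (vjoin ((-1) *s vbot (vbot u)) (vtop (vbot u)))" for u
  have S: "vec.subspace S"
    unfolding vec.subspace_def S_def
    by (auto simp: Omega_eq hi.zero_left hi.add_left hermitian_scale_left algebra_simps)
       (metis (no_types, opaque_lifting) distrib_left right_diff_distrib mult_zero_right)
  interpret K: Vector_Spaces.linear "(*s)" "(*s)" K
    by unfold_locales (simp_all add: K_def vjoin_add vjoin_scale vector_smult_assoc vec.scale_right_distrib)
  have KL: "vec.subspace (K ` \<Lambda>)" using K.subspace_image sub by blast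
  have KK: "Omega (K u) v = - hermitian_inner u v" for u v
    by (simp add: Omega_eq K_def hermitian_split[of u v] hermitian_split[of "vtop u" "vtop v"]
        hermitian_split[of "vbot u" "vbot v"] hi.minus_left)
  have "u = 0" if "u \<in> \<Lambda>" "K u \<in> S" for u
  proof -
    have "hermitian_inner u u = 0" using that KK[of u u] by (simp add: S_def)
    then have "u \<bullet> u = 0" by (metis Re_hermitian zero_complex.sel(1))
    then show ?thesis by simp
  qed
  moreover have "K 0 = 0" by (rule K.zero)
  ultimately have "S \<inter> K ` \<Lambda> \<subseteq> {0}" by fastforce
  then have z: "vec.dim (S \<inter> K ` \<Lambda>) = 0" by simp
  have "K u = 0 \<Longrightarrow> u = 0" for u
    using vjoin_zero by (simp add: K_def vjoin_zero[symmetric] del: vjoin_zero) (metis vjoin_vtop_vbot vjoin_zero)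
  then have "inj K" using K.inj_iff_eq_0 by blast
  then have "vec.dim (K ` \<Lambda>) = 2 * CARD('n)"
    using vec.dim_image_eq[OF K.linear_axioms inj_on_subset[OF _ subset_UNIV]] d by auto
  then have "vec.dim S + 2 * CARD('n) \<le> vec.dim (UNIV :: 'n bspace set)"
    using vec.dim_sums_Int[OF S KL] z vec.dim_subset[OF subset_UNIV, of "{x + y |x y. x \<in> S \<and> y \<in> K ` \<Lambda>}"] by simp
  then have "vec.dim S \<le> vec.dim \<Lambda>"
    using d unfolding vec_dim_card by simp
  moreover have "\<Lambda> \<subseteq> S" using iso by (auto simp: S_def)
  ultimately have "\<Lambda> = S" using vec.subspace_dim_equal[OF sub S] by blast
  then show ?thesis using sub iso unfolding max_isotropic_def S_def by blast
qed

text \<open>Puts the Dirichlet condition on the same footing as \<Lambda>, so that one variational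
  count serves both.\<close>

lemma Dirichlet_max_isotropic: "max_isotropic (Dirichlet :: 'n::finite bspace set)"
  unfolding max_isotropic_def
proof (intro conjI allI impI ballI)
  show "vec.subspace (Dirichlet :: 'n bspace set)"
    by (auto simp: vec.subspace_def Dirichlet_def)
  show "Omega u v = 0" if "u \<in> Dirichlet" "v \<in> Dirichlet" for u v :: "'n bspace"
    using that by (simp add: Dirichlet_def Omega_eq hi.zero_left hi.zero_right)
  fix u :: "'n bspace" assume u: "\<forall>v\<in>Dirichlet. Omega u v = 0"
  have "hermitian_inner (vbot (vtop u)) a = 0" for a
    using u[rule_format, of "vjoin (vjoin a 0) (vjoin 0 0)"] by (simp add: Dirichlet_def Omega_eq hi.zero_right del: vjoin_zero)
  moreover have "hermitian_inner (vbot (vbot u)) a = 0" for a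
    using u[rule_format, of "vjoin (vjoin 0 0) (vjoin a 0)"] by (simp add: Dirichlet_def Omega_eq hi.zero_right del: vjoin_zero)
  ultimately show "u \<in> Dirichlet" unfolding Dirichlet_def using hermitian_eq_zero by blast
qed

text \<open>Rank and nullity of the trace on \<Lambda>, where the layer enters: at most 2n - r
  linear conditions on end values separate the form domain of \<Lambda> from the Dirichlet
  one.\<close>

lemma trace_rank:
  assumes L: "\<Lambda> \<in> (layer r :: 'n::finite bspace set set)"
  shows "vec.dim (boundary_trace ` \<Lambda>) \<le> 2 * CARD('n) - r"
proof -
  have sub: "vec.subspace \<Lambda>" and d: "vec.dim \<Lambda> = 2 * CARD('n)" and r: "vec.dim (\<Lambda> \<inter> Dirichlet) = r"
    using L by (auto simp: layer_def Lag_def)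
  interpret t: Vector_Spaces.linear "(*s)" "(*s)" "boundary_trace :: 'n bspace \<Rightarrow> _" by (rule trace_linear)
  obtain B1 where B1: "B1 \<subseteq> \<Lambda> \<inter> Dirichlet" "vec.independent B1" "\<Lambda> \<inter> Dirichlet \<subseteq> vec.span B1" "card B1 = r"
    using vec.basis_exists[of "\<Lambda> \<inter> Dirichlet"] r by metis
  obtain B where B: "B1 \<subseteq> B" "B \<subseteq> \<Lambda>" "vec.independent B" "\<Lambda> \<subseteq> vec.span B"
    using vec.maximal_independent_subset_extend[of B1 \<Lambda>] B1 by blast
  have fin: "finite B" using B(3) by (rule vec.finiteI_independent)
  have cB: "card B = 2 * CARD('n)" using vec.basis_card_eq_dim[OF B(2,4,3)] d by simp
  have "boundary_trace b = 0" if "b \<in> B1" for b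
    using that B1(1) by (auto simp: boundary_trace_def Dirichlet_def)
  then have "boundary_trace ` B \<subseteq> insert 0 (boundary_trace ` (B - B1))" by auto
  then have "vec.span (boundary_trace ` B) \<subseteq> vec.span (boundary_trace ` (B - B1))"
    using vec.span_mono by (metis vec.span_insert_0)
  then have "boundary_trace ` \<Lambda> \<subseteq> vec.span (boundary_trace ` (B - B1))"
    using t.spans_image[OF B(4)] by blast
  then have "vec.dim (boundary_trace ` \<Lambda>) \<le> card (boundary_trace ` (B - B1))"
    by (rule vec.dim_le_card) (use fin in auto)
  also have "\<dots> \<le> card (B - B1)" using fin by (intro card_image_le) auto
  also have "\<dots> = 2 * CARD('n) - r" using B(1) B1(4) cB fin finite_subset by (metis card_Diff_subset)
  finally show ?thesis .
qed

text \<open>A linear right inverse of the trace on \<Lambda>, split into components. It is linear on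
  all pairs, but only its values over the trace of \<Lambda> matter.\<close>

lemma boundary_section:
  fixes \<Lambda> :: "'n::finite bspace set"
  assumes L: "max_isotropic \<Lambda>"
  obtains \<eta>0 \<eta>T :: "complex^'n \<Rightarrow> complex^'n \<Rightarrow> complex^'n"
  where "\<And>a b. vjoin a b \<in> boundary_trace ` \<Lambda> \<Longrightarrow> vjoin (vjoin (\<eta>0 a b) a) (vjoin (\<eta>T a b) b) \<in> \<Lambda>"
    "\<And>a b c d. \<eta>0 (a + c) (b + d) = \<eta>0 a b + \<eta>0 c d" "\<And>k a b. \<eta>0 (k *s a) (k *s b) = k *s \<eta>0 a b"
    "\<And>a b c d. \<eta>T (a + c) (b + d) = \<eta>T a b + \<eta>T c d" "\<And>k a b. \<eta>T (k *s a) (k *s b) = k *s \<eta>T a b"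
proof -
  have sub: "vec.subspace \<Lambda>" using L by (simp add: max_isotropic_def)
  obtain g where g: "range g \<subseteq> \<Lambda>" "Vector_Spaces.linear (*s) (*s) g" "\<And>v. v \<in> boundary_trace ` \<Lambda> \<Longrightarrow> boundary_trace (g v) = v"
    using vec.linear_exists_right_inverse_on[OF trace_linear sub] by blast
  interpret g: Vector_Spaces.linear "(*s)" "(*s)" g by (rule g(2))
  show thesis
  proof (rule that[of "\<lambda>a b. vtop (vtop (g (vjoin a b)))" "\<lambda>a b. vtop (vbot (g (vjoin a b)))"])
    fix a b assume "vjoin a b \<in> boundary_trace ` \<Lambda>"
    from g(3)[OF this] have "vbot (vtop (g (vjoin a b))) = a" "vbot (vbot (g (vjoin a b))) = b"
      by (simp_all add: boundary_trace_def)
    then have "vjoin (vjoin (vtop (vtop (g (vjoin a b)))) a) (vjoin (vtop (vbot (g (vjoin a b)))) b) = g (vjoin a b)"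
      by (metis vjoin_vtop_vbot)
    then show "vjoin (vjoin (vtop (vtop (g (vjoin a b)))) a) (vjoin (vtop (vbot (g (vjoin a b)))) b) \<in> \<Lambda>"
      using g(1) by auto
  qed (simp_all add: vjoin_add[symmetric] vjoin_scale[symmetric] g.add g.scale)
qed

text \<open>Two lifts of the same end values differ by a vector \<open>u\<close> whose x-components
  vanish, so its pairing with \<Lambda> involves only end values in the trace. Maximal isotropy
  makes the vanishing of this pairing equivalent to membership.\<close>

lemma max_isotropic_natural:
  fixes \<Lambda> :: "'n::finite bspace set"
  assumes L: "max_isotropic \<Lambda>" and \<eta>: "vjoin (vjoin e0 a) (vjoin eT b) \<in> \<Lambda>"
  shows "vjoin (vjoin y0 a) (vjoin yT b) \<in> \<Lambda> \<longleftrightarrow>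
    (\<forall>c d. vjoin c d \<in> boundary_trace ` \<Lambda> \<longrightarrow> hermitian_inner (yT - eT) d = hermitian_inner (y0 - e0) c)"
proof -
  define u :: "'n bspace" where "u = vjoin (vjoin (y0 - e0) 0) (vjoin (yT - eT) 0)"
  have sub: "vec.subspace \<Lambda>" using L by (simp add: max_isotropic_def)
  have eq: "vjoin (vjoin y0 a) (vjoin yT b) = u + vjoin (vjoin e0 a) (vjoin eT b)"
    by (simp add: u_def vjoin_add)
  have "vjoin (vjoin y0 a) (vjoin yT b) \<in> \<Lambda> \<longleftrightarrow> u \<in> \<Lambda>"
    unfolding eq using vec.subspace_add[OF sub _ \<eta>] vec.subspace_diff[OF sub _ \<eta>, of "u + vjoin (vjoin e0 a) (vjoin eT b)"] by auto
  also have "\<dots> \<longleftrightarrow> (\<forall>v\<in>\<Lambda>. Omega u v = 0)" using L by (auto simp: max_isotropic_def)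
  also have "\<dots> \<longleftrightarrow> (\<forall>v\<in>\<Lambda>. hermitian_inner (yT - eT) (vbot (vbot v)) = hermitian_inner (y0 - e0) (vbot (vtop v)))"
    by (simp add: Omega_eq u_def hi.zero_left)
  also have "\<dots> \<longleftrightarrow> (\<forall>c d. vjoin c d \<in> boundary_trace ` \<Lambda> \<longrightarrow> hermitian_inner (yT - eT) d = hermitian_inner (y0 - e0) c)"
    by (auto simp: boundary_trace_def)
  finally show ?thesis .
qed

section \<open>Variational characterization of eigenvalue counts\<close>

locale lagrangian = sturm_liouville_H1 T P Q R
  for T :: real and P Q R :: "real \<Rightarrow> real^'n^'n" +
  fixes \<Lambda> :: "'n bspace set" and \<eta>0 \<eta>T :: "complex^'n \<Rightarrow> complex^'n \<Rightarrow> complex^'n"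
  assumes L: "max_isotropic \<Lambda>"
    and sec: "\<And>a b. vjoin a b \<in> boundary_trace ` \<Lambda> \<Longrightarrow> vjoin (vjoin (\<eta>0 a b) a) (vjoin (\<eta>T a b) b) \<in> \<Lambda>"
    and e0_add: "\<And>a b c d. \<eta>0 (a + c) (b + d) = \<eta>0 a b + \<eta>0 c d" and e0_scale: "\<And>k a b. \<eta>0 (k *s a) (k *s b) = k *s \<eta>0 a b"
    and eT_add: "\<And>a b c d. \<eta>T (a + c) (b + d) = \<eta>T a b + \<eta>T c d" and eT_scale: "\<And>k a b. \<eta>T (k *s a) (k *s b) = k *s \<eta>T a b"
begin

lemma subspace_L: "vec.subspace \<Lambda>" using L by (simp add: max_isotropic_def)

lemma subspace_trace: "vec.subspace (boundary_trace ` \<Lambda>)"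
proof -
  interpret t: Vector_Spaces.linear "(*s)" "(*s)" "boundary_trace :: 'n bspace \<Rightarrow> _" by (rule trace_linear)
  show ?thesis by (rule t.subspace_image[OF subspace_L])
qed

sublocale boundary_condition T P Q R "\<lambda>a b. vjoin a b \<in> boundary_trace ` \<Lambda>" \<eta>0 \<eta>T
proof
  show "vjoin 0 0 \<in> boundary_trace ` \<Lambda>" using vec.subspace_0[OF subspace_trace] by simp
  show "vjoin (a + c) (b + d) \<in> boundary_trace ` \<Lambda>" if "vjoin a b \<in> boundary_trace ` \<Lambda>" "vjoin c d \<in> boundary_trace ` \<Lambda>" for a b c d
    using vec.subspace_add[OF subspace_trace that] by (simp add: vjoin_add)
  show "vjoin (k *s a) (k *s b) \<in> boundary_trace ` \<Lambda>" if "vjoin a b \<in> boundary_trace ` \<Lambda>" for k a b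
    using vec.subspace_scale[OF subspace_trace that, of k] by (simp add: vjoin_scale)
  show "hermitian_inner (\<eta>T a b) d - hermitian_inner (\<eta>0 a b) c = cnj (hermitian_inner (\<eta>T c d) b - hermitian_inner (\<eta>0 c d) a)"
    if "vjoin a b \<in> boundary_trace ` \<Lambda>" "vjoin c d \<in> boundary_trace ` \<Lambda>" for a b c d
  proof -
    \<comment> \<open>Isotropy of \<Lambda> applied to the two chosen lifts is the required
      symmetry.\<close>
    have "Omega (vjoin (vjoin (\<eta>0 a b) a) (vjoin (\<eta>T a b) b)) (vjoin (vjoin (\<eta>0 c d) c) (vjoin (\<eta>T c d) d)) = 0"
      using L sec[OF that(1)] sec[OF that(2)] unfolding max_isotropic_def by blast
    then have "hermitian_inner a (\<eta>0 c d) - hermitian_inner (\<eta>0 a b) c + hermitian_inner (\<eta>T a b) d - hermitian_inner b (\<eta>T c d) = 0"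
      unfolding Omega_eq vtop_vjoin vbot_vjoin .
    then show ?thesis
      unfolding complex_cnj_diff hermitian_sym[of b "\<eta>T c d", symmetric] hermitian_sym[of a "\<eta>0 c d", symmetric]
        hermitian_sym[of "\<eta>T c d" b, symmetric] hermitian_sym[of "\<eta>0 c d" a, symmetric] by (simp add: algebra_simps)
  qed
qed (simp_all add: e0_add e0_scale eT_add eT_scale)

abbreviation eig where "eig \<equiv> eigenspace T P Q R \<Lambda>"
abbreviation mult where "mult \<equiv> eig_mult T P Q R \<Lambda>"

lemma eig_iff:
  "x \<in> eig l \<longleftrightarrow> (\<forall>t. t \<notin> {0..T} \<longrightarrow> x t = 0) \<and>
     (\<exists>y. sol l 0 T x y \<and> vjoin (vjoin (y 0) (x 0)) (vjoin (y T) (x T)) \<in> \<Lambda>)"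
  using eigenspace_sol[of x \<Lambda> l] sol_eigenspace[of l x _ \<Lambda>] unfolding boundary_vec_def by blast

lemma eig_subspace: "cfun.subspace (eig l)"
  unfolding cfun.subspace_def
proof (intro conjI ballI allI)
  have "sol l 0 T (\<lambda>_. 0) (\<lambda>_. 0)"
    unfolding sol_def using vel_scale[of _ 0 0 0] frc_scale[of l _ 0 0 0] by (auto simp: has_vector_derivative_const)
  then show "0 \<in> eig l"
    using vec.subspace_0[OF subspace_L] unfolding eig_iff
    by (auto intro!: exI[of _ "\<lambda>_. 0"] simp: zero_fun_def)
next
  fix x w assume "x \<in> eig l" "w \<in> eig l"
  then obtain y z where *: "sol l 0 T x y" "sol l 0 T w z" "vjoin (vjoin (y 0) (x 0)) (vjoin (y T) (x T)) \<in> \<Lambda>"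
    "vjoin (vjoin (z 0) (w 0)) (vjoin (z T) (w T)) \<in> \<Lambda>" "\<forall>t. t \<notin> {0..T} \<longrightarrow> x t = 0" "\<forall>t. t \<notin> {0..T} \<longrightarrow> w t = 0"
    unfolding eig_iff by blast
  then show "x + w \<in> eig l"
    unfolding eig_iff using sol_add[OF *(1,2)] vec.subspace_add[OF subspace_L *(3,4)]
    by (auto intro!: exI[of _ "\<lambda>\<tau>. y \<tau> + z \<tau>"] simp: plus_fun_def vjoin_add)
next
  fix c x assume "x \<in> eig l"
  then obtain y where *: "sol l 0 T x y" "vjoin (vjoin (y 0) (x 0)) (vjoin (y T) (x T)) \<in> \<Lambda>" "\<forall>t. t \<notin> {0..T} \<longrightarrow> x t = 0"
    unfolding eig_iff by blast
  then show "(\<lambda>t. c *s x t) \<in> eig l"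
    unfolding eig_iff using sol_scale[OF *(1)] vec.subspace_scale[OF subspace_L *(2), of c]
    by (auto intro!: exI[of _ "\<lambda>\<tau>. c *s y \<tau>"] simp: vjoin_scale)
qed

lemma sol_sum:
  assumes "finite I" "\<And>i. i \<in> I \<Longrightarrow> sol l s t (x i) (y i)"
  shows "sol l s t (\<lambda>\<tau>. \<Sum>i\<in>I. x i \<tau>) (\<lambda>\<tau>. \<Sum>i\<in>I. y i \<tau>)"
  using assms
proof (induction I rule: finite_induct)
  case empty
  show ?case unfolding sol_def using vel_scale[of _ 0 0 0] frc_scale[of l _ 0 0 0] by (auto simp: has_vector_derivative_const)
next
  case (insert i I)
  then show ?case using sol_add[of l s t "x i" "y i" "\<lambda>\<tau>. \<Sum>i\<in>I. x i \<tau>" "\<lambda>\<tau>. \<Sum>i\<in>I. y i \<tau>"] by simp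
qed

text \<open>A solution is determined by its initial data, so eigenspaces are finite-dimensional and
  \<open>mult\<close> does not take the default value of an infinite dimension.\<close>

lemma eig_rank: "\<exists>n. cfun.rank_le (eig l) n"
proof -
  have T0: "{0..T} \<subseteq> {0..T}" "0 \<le> T" using T by auto
  have "\<forall>a b. \<exists>x y. sol l 0 T x y \<and> x 0 = a \<and> y 0 = b" using ivp_exists[OF T0(2,1)] by blast
  then obtain X Y where XY: "\<And>a b. sol l 0 T (X a b) (Y a b)" "\<And>a b. X a b 0 = a" "\<And>a b. Y a b 0 = b" by metis
  define Z where "Z a b t = (if t \<in> {0..T} then X a b t else 0)" for a b t
  define A where "A = range (\<lambda>k. Z (axis k 1) 0) \<union> range (\<lambda>k. Z 0 (axis k 1))"
  have "x \<in> cfun.span A" if x: "x \<in> eig l" for x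
  proof -
    obtain y where y: "sol l 0 T x y" and x0: "\<forall>t. t \<notin> {0..T} \<longrightarrow> x t = 0" using x unfolding eig_iff by blast
    define x' where "x' \<tau> = (\<Sum>k\<in>UNIV. (x 0 $ k) *s X (axis k 1) 0 \<tau>) + (\<Sum>k\<in>UNIV. (y 0 $ k) *s X 0 (axis k 1) \<tau>)" for \<tau>
    define y' where "y' \<tau> = (\<Sum>k\<in>UNIV. (x 0 $ k) *s Y (axis k 1) 0 \<tau>) + (\<Sum>k\<in>UNIV. (y 0 $ k) *s Y 0 (axis k 1) \<tau>)" for \<tau>
    have s': "sol l 0 T x' y'"
      unfolding x'_def[abs_def] y'_def[abs_def] by (intro sol_add sol_sum sol_scale XY) auto
    have i: "x 0 = x' 0" "y 0 = y' 0" by (simp_all add: x'_def y'_def XY basis_expansion)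
    have eq: "x \<tau> = x' \<tau>" if "\<tau> \<in> {0..T}" for \<tau> using ivp_unique[OF y s' T0(1) i that] by simp
    have "x = (\<Sum>k\<in>UNIV. (\<lambda>t. (x 0 $ k) *s Z (axis k 1) 0 t)) + (\<Sum>k\<in>UNIV. (\<lambda>t. (y 0 $ k) *s Z 0 (axis k 1) t))"
    proof
      fix t show "x t = ((\<Sum>k\<in>UNIV. (\<lambda>t. (x 0 $ k) *s Z (axis k 1) 0 t)) + (\<Sum>k\<in>UNIV. (\<lambda>t. (y 0 $ k) *s Z 0 (axis k 1) t))) t"
      proof (cases "t \<in> {0..T}")
        case True
        then have "Z a b t = X a b t" for a b unfolding Z_def by (rule if_P)
        then show ?thesis using eq[OF True] by (simp add: sum_fun_apply x'_def)
      next
        case False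
        then have "Z a b t = 0" for a b unfolding Z_def by (rule if_not_P)
        then show ?thesis using x0 False by (simp add: sum_fun_apply del: atLeastAtMost_iff)
      qed
    qed
    also have "\<dots> \<in> cfun.span A"
      unfolding A_def by (intro cfun.span_add cfun.span_sum cfun.span_scale cfun.span_base) auto
    finally show ?thesis .
  qed
  then have "eig l \<subseteq> cfun.span A" by blast
  moreover have "finite A" by (auto simp: A_def)
  ultimately show ?thesis using cfun.rank_le_span by blast
qed

lemma card_le_mult: "cfun.independent K \<Longrightarrow> K \<subseteq> eig l \<Longrightarrow> card K \<le> mult l"
  unfolding eig_mult_def using eig_rank cfun.card_le_dim by blast

lemma eig_basis:
  obtains B where "B \<subseteq> eig l" "cfun.independent B" "finite B" "card B = mult l"
proof -
  obtain n where "cfun.rank_le (eig l) n" using eig_rank by blast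
  then obtain B where B: "B \<subseteq> eig l" "cfun.independent B" "eig l \<subseteq> cfun.span B" "finite B"
    using cfun.basis_of_rank_le by metis
  then have "card B = mult l" unfolding eig_mult_def using cfun.basis_card_eq_dim by blast
  then show thesis using that B by blast
qed

lemma natural_boundary:
  assumes "vjoin a b \<in> boundary_trace ` \<Lambda>"
  shows "vjoin (vjoin y0 a) (vjoin yT b) \<in> \<Lambda> \<longleftrightarrow>
    (\<forall>c d. vjoin c d \<in> boundary_trace ` \<Lambda> \<longrightarrow> hermitian_inner (yT - \<eta>T a b) d = hermitian_inner (y0 - \<eta>0 a b) c)"
  using max_isotropic_natural[OF L sec[OF assms]] .

text \<open>Chooses the partition. The threshold \<open>\<mu> + 1\<close> keeps \<mu> inside the
  open half-line on which the node forms are continuous.\<close>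

lemma minmax:
  assumes E: "cfun.independent E"
    and Ex: "\<And>x. x \<in> cfun.span E \<Longrightarrow> (\<forall>t. t \<notin> {0..T} \<longrightarrow> x t = 0) \<and> vjoin (x 0) (x T) \<in> boundary_trace ` \<Lambda> \<and>
      (\<exists>u. C1_on 0 T x u \<and> Re (bform \<mu> 0 T x u x u) + Re (bd (x 0) (x T) (x 0) (x T)) \<le> 0)"
  shows "\<exists>F. finite F \<and> F \<subseteq> {..\<mu>} \<and> card E \<le> (\<Sum>l\<in>F. mult l)"
proof -
  obtain h where h: "h > 0" "\<And>l s t. l \<le> \<mu> + 1 \<Longrightarrow> 0 \<le> s \<Longrightarrow> s < t \<Longrightarrow> t \<le> T \<Longrightarrow> t - s \<le> h \<Longrightarrow> good l s t"
    using short_good[of "\<mu> + 1"] by blast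
  obtain m :: nat where m: "T / h < real m" using reals_Archimedean2 by blast
  have "0 < T / h" using T h by simp
  then have m0: "m > 0" using m by (metis less_trans of_nat_0_less_iff)
  interpret broken T P Q R "\<lambda>a b. vjoin a b \<in> boundary_trace ` \<Lambda>" \<eta>0 \<eta>T m "\<mu> + 1"
  proof
    fix l i assume l: "l \<le> \<mu> + 1" and i: "i < m"
    show "good l (T * (real i / real m)) (T * (real (Suc i) / real m))"
    proof (rule h(2)[OF l])
      show "0 \<le> T * (real i / real m)" using T by simp
      show "T * (real i / real m) < T * (real (Suc i) / real m)" using T m0 by (simp add: divide_strict_right_mono)
      have "real (Suc i) / real m \<le> 1" using i m0 by simp
      then show "T * (real (Suc i) / real m) \<le> T" using T mult_left_mono[of "real (Suc i) / real m" 1 T] by simp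
      have "T * (real (Suc i) / real m) - T * (real i / real m) = T / real m" using m0 by (simp add: field_simps)
      also have "\<dots> \<le> h" using m m0 h by (simp add: field_simps)
      finally show "T * (real (Suc i) / real m) - T * (real i / real m) \<le> h" .
    qed
  qed (rule m0)
  obtain F K where FK: "finite F" "F \<subseteq> {..\<mu>}" "card E \<le> (\<Sum>l\<in>F. card (K l))"
    "\<And>l. l \<in> F \<Longrightarrow> cfun.independent (K l)" "\<And>l. l \<in> F \<Longrightarrow> K l \<subseteq> eigf l"
    using minmax_broken[OF _ E Ex] by force
  have "eigf l \<subseteq> eig l" for l
  proof
    fix x assume "x \<in> eigf l"
    then obtain y where y: "sol l 0 T x y" "vjoin (x 0) (x T) \<in> boundary_trace ` \<Lambda>" "\<forall>t. t \<notin> {0..T} \<longrightarrow> x t = 0"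
      "\<forall>c d. vjoin c d \<in> boundary_trace ` \<Lambda> \<longrightarrow>
         hermitian_inner (y T - \<eta>T (x 0) (x T)) d = hermitian_inner (y 0 - \<eta>0 (x 0) (x T)) c"
      unfolding eigf_def by blast
    then show "x \<in> eig l" unfolding eig_iff using natural_boundary[OF y(2)] by blast
  qed
  then have "card (K l) \<le> mult l" if "l \<in> F" for l
    using card_le_mult[OF FK(4)[OF that]] FK(5)[OF that] by blast
  then have "(\<Sum>l\<in>F. card (K l)) \<le> (\<Sum>l\<in>F. mult l)" by (rule sum_mono)
  then show ?thesis using FK(1-3) by (intro exI[of _ F]) auto
qed

section \<open>The energy form on functions and the orthogonality of eigenfunctions\<close>

text \<open>A C^1 version of the form domain: only the essential part of the boundary condition is
  imposed.\<close>

definition D where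
  "D = {x. (\<forall>t. t \<notin> {0..T} \<longrightarrow> x t = 0) \<and> (\<exists>u. C1_on 0 T x u) \<and> vjoin (x 0) (x T) \<in> boundary_trace ` \<Lambda>}"

text \<open>Taking the velocities from \<open>dot\<close> makes this a form on functions alone;
  \<open>form_eq\<close> exchanges \<open>dot\<close> for any known derivative.\<close>

definition form where
  "form l x w = bform l 0 T x (dot T x) w (dot T w) + bd (x 0) (x T) (w 0) (w T)"

text \<open>The L^2 inner product; by \<open>form_shift\<close> it is the rate at which
  \<open>form\<close> decreases in the spectral parameter.\<close>

definition G where "G x w = integral {0..T} (\<lambda>\<tau>. hermitian_inner (x \<tau>) (w \<tau>))" for x w :: "real \<Rightarrow> complex^'n"

lemma form_eq:
  assumes "C1_on 0 T x u" "C1_on 0 T w v"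
  shows "form l x w = bform l 0 T x u w v + bd (x 0) (x T) (w 0) (w T)"
  unfolding form_def bform_def
  using assms dot_eq[of x u] dot_eq[of w v] by (auto simp: C1_on_def intro!: integral_cong)

lemma T_sub: "{0..T} \<subseteq> {0..T}" ..

lemma D_subspace: "cfun.subspace D"
  unfolding cfun.subspace_def
proof (intro conjI ballI allI)
  have "C1_on 0 T (\<lambda>_. 0) (\<lambda>_. 0 :: complex^'n)" by (auto simp: C1_on_def has_vector_derivative_const)
  then show "0 \<in> D" using W0 by (auto simp: D_def zero_fun_def)
  show "x + w \<in> D" if "x \<in> D" "w \<in> D" for x w
    using that C1_on_add[of 0 T x _ w] W_add unfolding D_def by (fastforce simp: plus_fun_def)
  show "(\<lambda>t. c *s x t) \<in> D" if "x \<in> D" for c x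
    using that C1_on_scale[of 0 T x] W_scale unfolding D_def by fastforce
qed

lemma form_hermitian: "cfun.hermitian_on D (form l)"
proof (rule cfun.hermitian_onI)
  fix x x' w assume "x \<in> D" "x' \<in> D" "w \<in> D"
  then obtain u u' v where C: "C1_on 0 T x u" "C1_on 0 T x' u'" "C1_on 0 T w v" unfolding D_def by blast
  show "form l (x + x') w = form l x w + form l x' w"
    using form_eq[OF C1_on_add[OF C(1,2)] C(3), of l] bform_add[OF T_sub C, of l]
    by (simp add: plus_fun_def form_eq[OF C(1,3)] form_eq[OF C(2,3)] bd_add)
next
  fix c x w assume "x \<in> D" "w \<in> D"
  then obtain u v where C: "C1_on 0 T x u" "C1_on 0 T w v" unfolding D_def by blast
  show "form l (\<lambda>t. c *s x t) w = c * form l x w"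
    using form_eq[OF C1_on_scale[OF C(1)] C(2), of l c]
    by (simp add: form_eq[OF C] bform_scale bd_scale distrib_left)
next
  fix x w assume xw: "x \<in> D" "w \<in> D"
  then obtain u v where C: "C1_on 0 T x u" "C1_on 0 T w v" unfolding D_def by blast
  have "bd (w 0) (w T) (x 0) (x T) = cnj (bd (x 0) (x T) (w 0) (w T))"
    using xw by (intro bd_sym) (auto simp: D_def)
  then show "form l w x = cnj (form l x w)"
    using bform_sym[OF T_sub C, of l] by (simp add: form_eq[OF C] form_eq[OF C(2,1)])
qed

lemma form_shift: "x \<in> D \<Longrightarrow> w \<in> D \<Longrightarrow> form (l + m) x w = form l x w - of_real m * G x w"
  using bform_shift[OF T_sub, of x _ w _ l m] by (auto simp: D_def form_eq G_def)

text \<open>As a difference of two energy forms, \<open>G\<close> inherits their Hermitian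
  properties without further integration.\<close>

lemma G_form: "x \<in> D \<Longrightarrow> w \<in> D \<Longrightarrow> G x w = form 0 x w - form 1 x w"
  using form_shift[of x w 0 1] by simp

lemma G_hermitian: "cfun.hermitian_on D G"
proof (rule cfun.hermitian_onI)
  note f = cfun.herm_add[OF D_subspace form_hermitian] cfun.herm_scale[OF D_subspace form_hermitian]
  show "G (x + x') w = G x w + G x' w" if "x \<in> D" "x' \<in> D" "w \<in> D" for x x' w
    using that cfun.subspace_add[OF D_subspace that(1,2)] by (simp add: G_form f)
  show "G (\<lambda>t. c *s x t) w = c * G x w" if "x \<in> D" "w \<in> D" for c x w
    using that cfun.subspace_scale[OF D_subspace that(1), of c] by (simp add: G_form f right_diff_distrib)
  show "G w x = cnj (G x w)" if "x \<in> D" "w \<in> D" for x w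
    using that cfun.herm_sym[OF D_subspace form_hermitian that] by (simp add: G_form)
qed

lemma Re_G:
  assumes "continuous_on {0..T} x"
  shows "Re (G x x) = integral {0..T} (\<lambda>\<tau>. (norm (x \<tau>))\<^sup>2)"
proof -
  have "(\<lambda>\<tau>. hermitian_inner (x \<tau>) (x \<tau>)) integrable_on {0..T}"
    by (intro integrable_continuous_real hi.continuous_on assms)
  from integral_linear[OF this bounded_linear_Re] show ?thesis
    by (simp add: G_def o_def Re_hermitian dot_square_norm)
qed

lemma G_pos:
  assumes "x \<in> D" "x \<noteq> 0"
  shows "Re (G x x) > 0"
proof (rule ccontr)
  assume neg: "\<not> Re (G x x) > 0"
  have c: "continuous_on {0..T} x" using assms(1) C1_on_continuous unfolding D_def by blast
  have "x t = 0" for t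
  proof (cases "t \<in> {0..T}")
    case True
    then show ?thesis using integral_sq_zero[OF T c _ True] neg Re_G[OF c] by simp
  qed (use assms(1) in \<open>auto simp: D_def\<close>)
  then show False using assms(2) by auto
qed

lemma G_nonneg: "x \<in> D \<Longrightarrow> Re (G x x) \<ge> 0"
  using G_pos[of x] cfun.herm_zero[OF D_subspace G_hermitian cfun.subspace_0[OF D_subspace]] by (cases "x = 0") auto

lemma eig_D: "eig l \<subseteq> D"
proof
  fix x assume "x \<in> eig l"
  then obtain y where y: "sol l 0 T x y" "vjoin (vjoin (y 0) (x 0)) (vjoin (y T) (x T)) \<in> \<Lambda>" "\<forall>t. t \<notin> {0..T} \<longrightarrow> x t = 0"
    unfolding eig_iff by blast
  have "vjoin (x 0) (x T) = boundary_trace (vjoin (vjoin (y 0) (x 0)) (vjoin (y T) (x T)))" by (simp add: boundary_trace_def)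
  then have "vjoin (x 0) (x T) \<in> boundary_trace ` \<Lambda>" using y(2) by blast
  then show "x \<in> D" using sol_C1[OF y(1) T_sub] y(3) unfolding D_def by blast
qed

text \<open>Weak form of the eigenvalue equation: the end terms of Green's identity and
  \<open>bd\<close> cancel by the natural boundary condition.\<close>

lemma eig_form:
  assumes x: "x \<in> eig l" and w: "w \<in> D"
  shows "form l x w = 0"
proof -
  obtain y where y: "sol l 0 T x y" "vjoin (vjoin (y 0) (x 0)) (vjoin (y T) (x T)) \<in> \<Lambda>"
    using x unfolding eig_iff by blast
  obtain v where v: "C1_on 0 T w v" using w unfolding D_def by blast
  have "vjoin (x 0) (x T) \<in> boundary_trace ` \<Lambda>" "vjoin (w 0) (w T) \<in> boundary_trace ` \<Lambda>" using x w eig_D by (auto simp: D_def)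
  then have "hermitian_inner (y T - \<eta>T (x 0) (x T)) (w T) = hermitian_inner (y 0 - \<eta>0 (x 0) (x T)) (w 0)"
    using natural_boundary y(2) by blast
  then show ?thesis
    unfolding form_eq[OF sol_C1[OF y(1) T_sub] v] green[OF y(1) less_imp_le[OF T] T_sub v] bd_def
    by (simp add: hi.diff_left algebra_simps)
qed

lemma eig_form_shift:
  assumes x: "x \<in> eig l" and w: "w \<in> D"
  shows "form \<mu> x w = of_real (l - \<mu>) * G x w"
  using form_shift[of x w l "\<mu> - l"] eig_form[OF x w] x w eig_D by (auto simp: algebra_simps)

text \<open>Symmetry of \<open>form k\<close> gives \<open>G x w\<close> multiplied by
  \<open>l - k\<close> the value 0.\<close>

lemma eig_orthogonal:
  assumes x: "x \<in> eig l" and w: "w \<in> eig k" and "l \<noteq> k"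
  shows "G x w = 0"
proof -
  have D: "x \<in> D" "w \<in> D" using x w eig_D by auto
  have "form k x w = cnj (form k w x)" by (rule cfun.herm_sym[OF D_subspace form_hermitian D(2,1)])
  then show ?thesis using eig_form[OF w D(1)] eig_form_shift[OF x D(2), of k] assms(3) by simp
qed

text \<open>The converse of the variational count. On the eigenspace of \<open>l\<close> the form is
  \<open>l - \<mu>\<close> times \<open>G\<close>, and distinct eigenspaces are orthogonal for
  \<open>G\<close>. The latter makes the sum direct and removes the cross terms of the form.\<close>

lemma eig_sum:
  assumes "finite F" "F \<subseteq> {..\<mu>}"
  shows "\<exists>E. cfun.independent E \<and> finite E \<and> card E = (\<Sum>l\<in>F. mult l) \<and> E \<subseteq> (\<Union>l\<in>F. eig l) \<and>
    (\<forall>x\<in>cfun.span E. Re (form \<mu> x x) \<le> 0)"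
  using assms
proof (induction F rule: finite_induct)
  case empty
  have "form \<mu> 0 0 = 0" using cfun.herm_zero[OF D_subspace form_hermitian cfun.subspace_0[OF D_subspace]] .
  moreover have "x = 0" if "x \<in> cfun.span {}" for x :: "real \<Rightarrow> complex^'n"
    using that unfolding cfun.span_empty by (rule singletonD)
  ultimately have "\<forall>x\<in>cfun.span {}. Re (form \<mu> x x) \<le> 0" by (metis order_refl zero_complex.sel(1))
  then show ?case by (intro exI[of _ "{}"]) (simp only: cfun.independent_empty card.empty sum.empty finite.emptyI empty_subsetI simp_thms)
next
  case (insert k F)
  then obtain E where E: "cfun.independent E" "finite E" "card E = (\<Sum>l\<in>F. mult l)" "E \<subseteq> (\<Union>l\<in>F. eig l)"
    and En: "\<And>x. x \<in> cfun.span E \<Longrightarrow> Re (form \<mu> x x) \<le> 0" by auto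
  obtain B where B: "B \<subseteq> eig k" "cfun.independent B" "finite B" "card B = mult k" by (rule eig_basis)
  have ED: "cfun.span E \<subseteq> D" using E(4) eig_D by (intro cfun.span_minimal D_subspace) blast
  have Bk: "cfun.span B \<subseteq> eig k" using B(1) eig_subspace by (intro cfun.span_minimal)
  have orth: "G x z = 0" if x: "x \<in> cfun.span E" and z: "z \<in> eig k" for x z
  proof -
    have zD: "z \<in> D" using z eig_D by auto
    let ?S = "{x \<in> D. G x z = 0}"
    have "cfun.subspace ?S"
      unfolding cfun.subspace_def
      using cfun.herm_zero[OF D_subspace G_hermitian zD] cfun.herm_add[OF D_subspace G_hermitian _ _ zD]
        cfun.herm_scale[OF D_subspace G_hermitian _ zD] D_subspace[unfolded cfun.subspace_def] zD by auto
    moreover have "E \<subseteq> ?S"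
    proof
      fix e assume "e \<in> E"
      then obtain l where l: "l \<in> F" "e \<in> eig l" using E(4) by blast
      then have "l \<noteq> k" using insert.hyps by auto
      then show "e \<in> ?S" using eig_orthogonal[OF l(2) z] l(2) eig_D by auto
    qed
    ultimately have "cfun.span E \<subseteq> ?S" by (intro cfun.span_minimal)
    then show ?thesis using x by blast
  qed
  have "cfun.span E \<inter> cfun.span B = {0}"
  proof (intro equalityI subsetI)
    fix x assume "x \<in> cfun.span E \<inter> cfun.span B"
    then have x: "x \<in> cfun.span E" "x \<in> eig k" using Bk by auto
    then have "G x x = 0" "x \<in> D" using orth ED by auto
    then show "x \<in> {0}" using G_pos[of x] by force
  qed (auto intro: cfun.span_zero)
  from cfun.independent_Un_disjoint_span[OF E(1) B(2,3) this]
  have EB: "cfun.independent (E \<union> B)" "E \<inter> B = {}" by auto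
  have "Re (form \<mu> x x) \<le> 0" if x: "x \<in> cfun.span (E \<union> B)" for x
  proof -
    obtain e z where ez: "x = e + z" "e \<in> cfun.span E" "z \<in> cfun.span B" using x unfolding cfun.span_Un by blast
    have z: "z \<in> eig k" using ez Bk by auto
    have D: "e \<in> D" "z \<in> D" using ez ED z eig_D by auto
    have "G z e = 0" using orth[OF ez(2) z] cfun.herm_sym[OF D_subspace G_hermitian D] by simp
    then have ze: "form \<mu> z e = 0" using eig_form_shift[OF z D(1)] by simp
    then have ez0: "form \<mu> e z = 0" using cfun.herm_sym[OF D_subspace form_hermitian D(2,1)] by simp
    have "form \<mu> x x = form \<mu> e e + form \<mu> z z"
      unfolding ez(1) using D ze ez0 cfun.subspace_add[OF D_subspace D]
      by (simp add: cfun.herm_add[OF D_subspace form_hermitian] cfun.herm_add_right[OF D_subspace form_hermitian])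
    moreover have "Re (form \<mu> z z) \<le> 0"
      using eig_form_shift[OF z D(2), of \<mu>] insert.prems G_nonneg[OF D(2)] by (simp add: mult_nonpos_nonneg)
    ultimately show ?thesis using En[OF ez(2)] by simp
  qed
  moreover have "card (E \<union> B) = (\<Sum>l\<in>insert k F. mult l)"
    using E B EB insert.hyps by (simp add: card_Un_disjoint)
  moreover have "E \<union> B \<subseteq> (\<Union>l\<in>insert k F. eig l)" using E(4) B(1) by blast
  ultimately show ?case using EB E B by (intro exI[of _ "E \<union> B"]) auto
qed

lemma minmax_form:
  assumes "cfun.independent E" "cfun.span E \<subseteq> D" "\<And>x. x \<in> cfun.span E \<Longrightarrow> Re (form \<mu> x x) \<le> 0"
  shows "\<exists>F. finite F \<and> F \<subseteq> {..\<mu>} \<and> card E \<le> (\<Sum>l\<in>F. mult l)"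
proof (rule minmax[OF assms(1)])
  fix x assume x: "x \<in> cfun.span E"
  then obtain u where u: "C1_on 0 T x u" using assms(2) unfolding D_def by blast
  then have "Re (bform \<mu> 0 T x u x u) + Re (bd (x 0) (x T) (x 0) (x T)) \<le> 0"
    using assms(3)[OF x] form_eq[OF u u, of \<mu>] by simp
  then show "(\<forall>t. t \<notin> {0..T} \<longrightarrow> x t = 0) \<and> vjoin (x 0) (x T) \<in> boundary_trace ` \<Lambda> \<and>
      (\<exists>u. C1_on 0 T x u \<and> Re (bform \<mu> 0 T x u x u) + Re (bd (x 0) (x T) (x 0) (x T)) \<le> 0)"
    using assms(2) x u unfolding D_def by blast
qed

lemma form_zero_ends:
  assumes "C1_on 0 T x u" "x 0 = 0" "x T = 0"
  shows "form l x x = bform l 0 T x u x u"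
  using form_eq[OF assms(1,1)] assms(2,3) by (simp add: bd_def hi.zero_right)

text \<open>The family \<open>G - l * form 0\<close> is positive at \<open>l = 0\<close>, so
  \<open>eventually_pos_on_span\<close> keeps it positive at some \<open>l > 0\<close>. Dividing by
  that \<open>l\<close> bounds \<open>form 0\<close> by a multiple of \<open>G\<close>, and shifting
  by this multiple makes the form nonpositive.\<close>

lemma form_bounded_on_span:
  assumes "finite E" "E \<subseteq> D"
  shows "\<exists>\<mu>. \<forall>x\<in>cfun.span E. Re (form \<mu> x x) \<le> 0"
proof -
  let ?V = "cfun.span E"
  have VD: "?V \<subseteq> D" using assms(2) by (intro cfun.span_minimal D_subspace)
  define H where "H l x w = G x w - of_real l * form 0 x w" for l :: real and x w
  note f = cfun.herm_add[OF D_subspace form_hermitian] cfun.herm_scale[OF D_subspace form_hermitian]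
    cfun.herm_add[OF D_subspace G_hermitian] cfun.herm_scale[OF D_subspace G_hermitian]
  have H: "cfun.hermitian_on ?V (H l)" for l
  proof (rule cfun.hermitian_on_subset[OF cfun.hermitian_onI VD])
    show "H l v u = cnj (H l u v)" if "u \<in> D" "v \<in> D" for u v
      using cfun.herm_sym[OF D_subspace form_hermitian that, of 0] cfun.herm_sym[OF D_subspace G_hermitian that]
      by (simp add: H_def)
  qed (simp_all add: H_def f algebra_simps)
  have GV: "cfun.hermitian_on ?V G" using G_hermitian VD by (rule cfun.hermitian_on_subset)
  obtain B where BB: "B \<subseteq> ?V \<and> cfun.independent B \<and> ?V \<subseteq> cfun.span B \<and> finite B \<and> (\<forall>u\<in>B. \<forall>v\<in>B. u \<noteq> v \<longrightarrow> G u v = 0)"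
    using cfun.orthogonal_basis_exists[OF cfun.subspace_span GV cfun.rank_le_span[OF assms(1) order_refl]] by (rule exE)
  note B = BB[THEN conjunct1] BB[THEN conjunct2, THEN conjunct1] BB[THEN conjunct2, THEN conjunct2, THEN conjunct1]
    BB[THEN conjunct2, THEN conjunct2, THEN conjunct2, THEN conjunct1]
  have o: "G u v = 0" if "u \<in> B" "v \<in> B" "u \<noteq> v" for u v using BB that by blast
  have "\<exists>\<epsilon>>0. \<forall>l\<in>UNIV. \<bar>l - 0\<bar> < \<epsilon> \<longrightarrow> (\<forall>v\<in>cfun.span B. v \<noteq> 0 \<longrightarrow> Re (H l v v) > 0)"
  proof (rule cfun.eventually_pos_on_span[OF cfun.subspace_span H B(1,4)])
    show "continuous_on UNIV (\<lambda>l. H l u v)" for u v unfolding H_def by (intro continuous_intros)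
    show "H 0 u v = 0" if "u \<in> B" "v \<in> B" "u \<noteq> v" for u v using o that by (simp add: H_def)
    show "Re (H 0 u u) > 0" if "u \<in> B" for u
    proof -
      have "u \<noteq> 0" using that B(2) cfun.dependent_zero by blast
      then show ?thesis using G_pos[of u] that B(1) VD by (auto simp: H_def)
    qed
  qed auto
  then obtain \<epsilon> where \<epsilon>: "\<epsilon> > 0" "\<And>l v. \<bar>l\<bar> < \<epsilon> \<Longrightarrow> v \<in> cfun.span B \<Longrightarrow> v \<noteq> 0 \<Longrightarrow> Re (H l v v) > 0" by auto
  have "Re (form (2 / \<epsilon>) x x) \<le> 0" if x: "x \<in> ?V" for x
  proof (cases "x = 0")
    case True
    then show ?thesis using cfun.herm_zero[OF D_subspace form_hermitian cfun.subspace_0[OF D_subspace]] by simp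
  next
    case False
    have "Re (H (\<epsilon> / 2) x x) > 0" using \<epsilon>(1) x B(3) False by (intro \<epsilon>(2)) auto
    then have "\<epsilon> / 2 * Re (form 0 x x) < Re (G x x)" by (simp add: H_def)
    then have "Re (form 0 x x) < 2 / \<epsilon> * Re (G x x)" using \<epsilon>(1) by (simp add: field_simps)
    moreover have "form (2 / \<epsilon>) x x = form 0 x x - of_real (2 / \<epsilon>) * G x x"
      using form_shift[of x x 0 "2 / \<epsilon>"] x VD by auto
    ultimately show ?thesis by simp
  qed
  then show ?thesis by blast
qed

end

lemma (in sturm_liouville_H1) lagrangian_exists:
  assumes "max_isotropic \<Lambda>"
  shows "\<exists>\<eta>0 \<eta>T. lagrangian T P Q R \<Lambda> \<eta>0 \<eta>T"
proof -
  obtain \<eta>0 \<eta>T :: "complex^'n \<Rightarrow> complex^'n \<Rightarrow> complex^'n"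
    where h: "\<And>a b. vjoin a b \<in> boundary_trace ` \<Lambda> \<Longrightarrow> vjoin (vjoin (\<eta>0 a b) a) (vjoin (\<eta>T a b) b) \<in> \<Lambda>"
    "\<And>a b c d. \<eta>0 (a + c) (b + d) = \<eta>0 a b + \<eta>0 c d" "\<And>k a b. \<eta>0 (k *s a) (k *s b) = k *s \<eta>0 a b"
    "\<And>a b c d. \<eta>T (a + c) (b + d) = \<eta>T a b + \<eta>T c d" "\<And>k a b. \<eta>T (k *s a) (k *s b) = k *s \<eta>T a b"
    by (rule boundary_section[OF assms]) blast
  have "lagrangian T P Q R \<Lambda> \<eta>0 \<eta>T"
    by (rule lagrangian.intro[OF sturm_liouville_H1_axioms lagrangian_axioms.intro[OF assms h]])
  then show ?thesis by blast
qed

text \<open>Rank and nullity for the end-value map on the span of \<open>E\<close>: a basis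
  \<open>B\<close> of its kernel is extended to a basis \<open>C\<close>, and the images of
  \<open>C - B\<close> stay independent, so there are at most \<open>k\<close> of them.\<close>

lemma trace_kernel:
  fixes E :: "(real \<Rightarrow> complex^'n) set" and U :: "(complex^('n + 'n)) set"
  assumes E: "cfun.independent E" "finite E" and U: "\<And>x. x \<in> cfun.span E \<Longrightarrow> vjoin (x 0) (x T) \<in> U" and k: "vec.dim U \<le> k"
  shows "\<exists>B. cfun.independent B \<and> B \<subseteq> cfun.span E \<and> card E \<le> card B + k \<and> (\<forall>x\<in>cfun.span B. x 0 = 0 \<and> x T = 0)"
proof -
  let ?t = "\<lambda>x :: real \<Rightarrow> complex^'n. vjoin (x 0) (x T)"
  interpret t: Vector_Spaces.linear "\<lambda>(c::complex) f t. c *s f t" "(*s)" ?t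
    by unfold_locales (simp_all add: vjoin_add vjoin_scale)
  let ?K = "{x \<in> cfun.span E. ?t x = 0}"
  have Ks: "cfun.subspace ?K"
    using cfun.subspace_inter[OF cfun.subspace_span[of E] t.subspace_kernel] by (simp add: Int_def)
  have r: "cfun.rank_le ?K (card E)" by (rule cfun.rank_le_span[OF E(2)]) auto
  obtain B where B: "B \<subseteq> ?K" "cfun.independent B" "?K \<subseteq> cfun.span B" "finite B"
    by (rule cfun.basis_of_rank_le[OF r])
  have "B \<subseteq> cfun.span E" using B(1) by auto
  then obtain C where C: "B \<subseteq> C" "C \<subseteq> cfun.span E" "cfun.independent C" "cfun.span E \<subseteq> cfun.span C"
    using cfun.maximal_independent_subset_extend[OF _ B(2)] by blast
  have fC: "finite C" using cfun.independent_span_bound[OF E(2) C(3,2)] by simp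
  have cE: "card E \<le> card C" using cfun.independent_span_bound[OF fC E(1)] C(4) cfun.span_superset by blast
  have ind: "cfun.independent (C - B)" using C(3) cfun.independent_mono by blast
  have inj: "inj_on ?t (cfun.span (C - B))"
    unfolding t.inj_on_iff_eq_0[OF cfun.subspace_span]
  proof (intro ballI impI)
    fix x assume x: "x \<in> cfun.span (C - B)" "?t x = 0"
    have "x \<in> cfun.span E"
      using x(1) C(2) cfun.span_minimal[OF _ cfun.subspace_span, of "C - B" E] by blast
    then have xB: "x \<in> cfun.span B" using x(2) B(3) by blast
    obtain c where c: "x = (\<Sum>b\<in>B. (\<lambda>t. c b *s b t))" using xB cfun.span_finite[OF B(4)] by auto
    obtain d where d: "x = (\<Sum>b\<in>C - B. (\<lambda>t. d b *s b t))" using x(1) cfun.span_finite[of "C - B"] fC by auto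
    \<comment> \<open>Subtracting the expansions of \<open>x\<close> over \<open>B\<close> and over
      \<open>C - B\<close> gives a relation on the independent set \<open>C\<close>, so all
      coefficients vanish.\<close>
    define e where "e b = (if b \<in> B then c b else - d b)" for b
    have "(\<Sum>b\<in>C. (\<lambda>t. e b *s b t)) = (\<Sum>b\<in>C - B. (\<lambda>t. e b *s b t)) + (\<Sum>b\<in>B. (\<lambda>t. e b *s b t))"
      by (rule sum.subset_diff[OF C(1) fC])
    also have "(\<Sum>b\<in>B. (\<lambda>t. e b *s b t)) = x" unfolding c by (intro sum.cong) (auto simp: e_def)
    also have "(\<Sum>b\<in>C - B. (\<lambda>t. e b *s b t)) = - x"
      unfolding d sum_negf[symmetric] by (intro sum.cong) (auto simp: e_def fun_eq_iff)
    finally have "(\<Sum>b\<in>C. (\<lambda>t. e b *s b t)) = 0" by (simp only: left_minus)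
    then have "e b = 0" if "b \<in> B" for b
      using cfun.independentD[OF C(3) fC order_refl] that C(1) by blast
    then have "c b = 0" if "b \<in> B" for b using that by (auto simp: e_def)
    then show "x = 0" unfolding c by (intro sum.neutral) (auto simp: fun_eq_iff)
  qed
  have "vec.independent (?t ` (C - B))" by (rule t.independent_injective_image[OF ind inj])
  moreover have "?t ` (C - B) \<subseteq> U" using C(2) U by auto
  ultimately have "card (?t ` (C - B)) \<le> vec.dim U" by (rule vec.independent_card_le_dim[rotated])
  moreover have "card (?t ` (C - B)) = card (C - B)"
    by (rule card_image) (rule inj_on_subset[OF inj cfun.span_superset])
  moreover have "card (C - B) = card C - card B" using C(1) B(4) by (rule card_Diff_subset[rotated])
  ultimately have "card E \<le> card B + k" using cE k by simp
  moreover have "x 0 = 0 \<and> x T = 0" if "x \<in> cfun.span B" for x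
  proof -
    have "x \<in> ?K" using that cfun.span_minimal[OF B(1) Ks] by blast
    then have "?t x = vjoin 0 0" by simp
    then show ?thesis by (simp del: vjoin_zero)
  qed
  ultimately show ?thesis using B(2) \<open>B \<subseteq> cfun.span E\<close> by (intro exI[of _ B]) auto
qed

section \<open>Comparison with the Dirichlet condition\<close>

text \<open>Squaring the positive part makes it C^1, smooth enough for test functions of the form
  domain.\<close>

lemma DERIV_max0_square: "((\<lambda>s::real. (max 0 s)\<^sup>2) has_real_derivative 2 * max 0 s) (at s)"
proof -
  consider "s > 0" | "s < 0" | "s = 0" by linarith
  then show ?thesis
  proof cases
    case 1
    have "((\<lambda>s::real. s\<^sup>2) has_real_derivative 2 * max 0 s) (at s)"
      using 1 by (auto intro!: derivative_eq_intros)
    then show ?thesis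
      by (rule has_field_derivative_transform_within_open[of _ _ _ "{0<..}"]) (use 1 in auto)
  next
    case 2
    have "((\<lambda>s::real. 0) has_real_derivative 2 * max 0 s) (at s)"
      using 2 by (auto intro!: derivative_eq_intros)
    then show ?thesis
      by (rule has_field_derivative_transform_within_open[of _ _ _ "{..<0}"]) (use 2 in auto)
  next
    case 3
    have "((\<lambda>h::real. (max 0 h)\<^sup>2 / h) \<longlongrightarrow> 0) (at 0)"
    proof (rule Lim_null_comparison)
      have "norm ((max 0 h)\<^sup>2 / h) \<le> \<bar>h\<bar>" for h :: real
        by (cases "h > 0") (auto simp: max_def power2_eq_square)
      then show "eventually (\<lambda>h::real. norm ((max 0 h)\<^sup>2 / h) \<le> \<bar>h\<bar>) (at 0)" by simp
      show "((\<lambda>h::real. \<bar>h\<bar>) \<longlongrightarrow> 0) (at 0)" by (rule tendsto_rabs_zero) (rule tendsto_ident_at)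
    qed
    then show ?thesis using 3 by (simp add: DERIV_def)
  qed
qed

context sturm_liouville_H1
begin

text \<open>The boundary form drops out when the end values vanish, and zero end values are
  admissible for every condition. Hence all energy forms agree on these functions.\<close>

lemma zero_ends_transfer:
  assumes "lagrangian T P Q R \<Lambda> \<eta>0 \<eta>T" "lagrangian T P Q R \<Lambda>' \<eta>0' \<eta>T'"
    and "x \<in> lagrangian.D T \<Lambda>" "x 0 = 0" "x T = 0"
  shows "x \<in> lagrangian.D T \<Lambda>'" "lagrangian.form T P Q R \<eta>0' \<eta>T' l x x = lagrangian.form T P Q R \<eta>0 \<eta>T l x x"
proof -
  interpret A: lagrangian T P Q R \<Lambda> \<eta>0 \<eta>T by fact
  interpret B: lagrangian T P Q R \<Lambda>' \<eta>0' \<eta>T' by fact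
  obtain u where u: "C1_on 0 T x u" using assms(3) unfolding A.D_def by blast
  show "x \<in> B.D" using assms(3-5) B.W0 unfolding A.D_def B.D_def by simp
  show "B.form l x x = A.form l x x" using A.form_zero_ends[OF u assms(4,5)] B.form_zero_ends[OF u assms(4,5)] by simp
qed

lemma Dirichlet_zero_ends:
  fixes x :: "real \<Rightarrow> complex^'n"
  assumes "lagrangian T P Q R Dirichlet \<eta>0 \<eta>T" "x \<in> lagrangian.D T Dirichlet"
  shows "x 0 = 0 \<and> x T = 0"
proof -
  interpret lagrangian T P Q R Dirichlet \<eta>0 \<eta>T by fact
  obtain w where w: "w \<in> Dirichlet" "vjoin (x 0) (x T) = boundary_trace w" using assms(2) unfolding D_def by blast
  then have "x 0 = vbot (vtop w)" "x T = vbot (vbot w)" by (simp_all add: boundary_trace_def)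
  then show ?thesis using w(1) by (simp add: Dirichlet_def)
qed

text \<open>Dirichlet eigenfunctions are admissible for \<Lambda> with the same energy, so their
  span is a test space for \<Lambda> at the same \<mu>.\<close>

lemma count_Dirichlet_le:
  assumes "max_isotropic \<Lambda>" and F: "finite F" "F \<subseteq> {..\<mu>}"
  shows "\<exists>F'. finite F' \<and> F' \<subseteq> {..\<mu>} \<and> (\<Sum>l\<in>F. eig_mult T P Q R Dirichlet l) \<le> (\<Sum>l\<in>F'. eig_mult T P Q R \<Lambda> l)"
proof -
  obtain d0 dT where d: "lagrangian T P Q R Dirichlet d0 dT" using lagrangian_exists[OF Dirichlet_max_isotropic] by blast
  obtain e0 eT where e: "lagrangian T P Q R \<Lambda> e0 eT" using lagrangian_exists[OF assms(1)] by blast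
  interpret A: lagrangian T P Q R Dirichlet d0 dT by (rule d)
  interpret B: lagrangian T P Q R \<Lambda> e0 eT by (rule e)
  obtain E where E: "cfun.independent E" "card E = (\<Sum>l\<in>F. A.mult l)" "E \<subseteq> (\<Union>l\<in>F. A.eig l)"
    "\<And>x. x \<in> cfun.span E \<Longrightarrow> Re (A.form \<mu> x x) \<le> 0" using A.eig_sum[OF F] by blast
  have ED: "cfun.span E \<subseteq> A.D" using E(3) A.eig_D by (intro cfun.span_minimal A.D_subspace) blast
  have *: "x \<in> B.D" "B.form \<mu> x x = A.form \<mu> x x" if x: "x \<in> cfun.span E" for x
    using zero_ends_transfer[OF d e] Dirichlet_zero_ends[OF d] x ED by blast+
  then have "cfun.span E \<subseteq> B.D" by blast
  moreover have "Re (B.form \<mu> x x) \<le> 0" if "x \<in> cfun.span E" for x using *(2)[OF that] E(4)[OF that] by simp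
  ultimately show ?thesis using B.minmax_form[OF E(1)] E(2) by metis
qed

text \<open>The span of the eigenfunctions of \<Lambda> becomes a Dirichlet test space after
  imposing zero end values, which by \<open>trace_rank\<close> costs at most 2n - r
  dimensions.\<close>

lemma count_le_Dirichlet:
  assumes "\<Lambda> \<in> layer r" and F: "finite F" "F \<subseteq> {..\<mu>}"
  shows "\<exists>F'. finite F' \<and> F' \<subseteq> {..\<mu>} \<and>
    (\<Sum>l\<in>F. eig_mult T P Q R \<Lambda> l) \<le> (\<Sum>l\<in>F'. eig_mult T P Q R Dirichlet l) + (2 * CARD('n) - r)"
proof -
  have "max_isotropic \<Lambda>" using assms(1) Lag_max_isotropic by (auto simp: layer_def)
  then obtain e0 eT where e: "lagrangian T P Q R \<Lambda> e0 eT" using lagrangian_exists by blast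
  obtain d0 dT where d: "lagrangian T P Q R Dirichlet d0 dT" using lagrangian_exists[OF Dirichlet_max_isotropic] by blast
  interpret A: lagrangian T P Q R Dirichlet d0 dT by (rule d)
  interpret B: lagrangian T P Q R \<Lambda> e0 eT by (rule e)
  obtain E where E: "cfun.independent E" "finite E" "card E = (\<Sum>l\<in>F. B.mult l)" "E \<subseteq> (\<Union>l\<in>F. B.eig l)"
    "\<And>x. x \<in> cfun.span E \<Longrightarrow> Re (B.form \<mu> x x) \<le> 0" using B.eig_sum[OF F] by blast
  have ED: "cfun.span E \<subseteq> B.D" using E(4) B.eig_D by (intro cfun.span_minimal B.D_subspace) blast
  have "\<exists>K. cfun.independent K \<and> K \<subseteq> cfun.span E \<and> card E \<le> card K + (2 * CARD('n) - r) \<and> (\<forall>x\<in>cfun.span K. x 0 = 0 \<and> x T = 0)"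
    using ED by (intro trace_kernel[OF E(1,2) _ trace_rank[OF assms(1)]]) (auto simp: B.D_def)
  then obtain K where K: "cfun.independent K" "K \<subseteq> cfun.span E" "card E \<le> card K + (2 * CARD('n) - r)"
    "\<And>x. x \<in> cfun.span K \<Longrightarrow> x 0 = 0 \<and> x T = 0" by blast
  have KE: "cfun.span K \<subseteq> cfun.span E" by (rule cfun.span_minimal[OF K(2) cfun.subspace_span])
  have *: "x \<in> A.D" "A.form \<mu> x x = B.form \<mu> x x" if x: "x \<in> cfun.span K" for x
    using zero_ends_transfer[OF e d] K(4)[OF x] x KE ED by blast+
  then have "cfun.span K \<subseteq> A.D" by blast
  moreover have "Re (A.form \<mu> x x) \<le> 0" if "x \<in> cfun.span K" for x using *(2)[OF that] E(5) KE that by auto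
  ultimately obtain F' where "finite F'" "F' \<subseteq> {..\<mu>}" "card K \<le> (\<Sum>l\<in>F'. A.mult l)"
    using A.minmax_form[OF K(1)] by metis
  then show ?thesis using K(3) E(3) by (intro exI[of _ F']) auto
qed

text \<open>An infimum of reals is meaningful only with a lower bound. With \<open>B = 0\<close> in
  \<open>boundary_lower\<close> the energy of a Dirichlet function dominates its L^2 norm for very
  negative \<open>l\<close>, while an eigenfunction has energy 0.\<close>

lemma Dirichlet_bounded_below: "\<exists>c. \<forall>l. eig_mult T P Q R Dirichlet l > 0 \<longrightarrow> c < l"
proof -
  obtain d0 dT where d: "lagrangian T P Q R Dirichlet d0 dT" using lagrangian_exists[OF Dirichlet_max_isotropic] by blast
  interpret lagrangian T P Q R Dirichlet d0 dT by (rule d)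
  obtain c where c: "\<And>l x u. l \<le> c \<Longrightarrow> C1_on 0 T x u \<Longrightarrow>
    integral {0..T} (\<lambda>\<tau>. (norm (x \<tau>))\<^sup>2) \<le> Re (bform l 0 T x u x u)"
  proof -
    obtain c where c: "\<And>l s t x u. l \<le> c \<Longrightarrow> 0 \<le> s \<Longrightarrow> s \<le> t \<Longrightarrow> t \<le> T \<Longrightarrow> C1_on s t x u \<Longrightarrow>
      0 * (2 * t / T - 1) * (norm (x t))\<^sup>2 - 0 * (2 * s / T - 1) * (norm (x s))\<^sup>2 + integral {s..t} (\<lambda>\<tau>. (norm (x \<tau>))\<^sup>2)
        \<le> Re (bform l s t x u x u)"
      using boundary_lower[OF order_refl] by metis
    show thesis
    proof (rule that)
      fix l and x u :: "real \<Rightarrow> complex^'n" assume "l \<le> c" "C1_on 0 T x u"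
      from c[OF this(1) order_refl less_imp_le[OF T] order_refl this(2)]
      show "integral {0..T} (\<lambda>\<tau>. (norm (x \<tau>))\<^sup>2) \<le> Re (bform l 0 T x u x u)" by simp
    qed
  qed
  have "c < l" if l: "mult l > 0" for l
  proof (rule ccontr)
    assume n: "\<not> c < l"
    obtain B where B: "B \<subseteq> eig l" "cfun.independent B" "finite B" "card B = mult l" by (rule eig_basis)
    then have "B \<noteq> {}" using l by auto
    then obtain x where x: "x \<in> B" by blast
    then have x0: "x \<noteq> 0" using B(2) cfun.dependent_zero by blast
    have xD: "x \<in> D" "x \<in> eig l" using x B(1) eig_D by auto
    obtain u where u: "C1_on 0 T x u" using xD(1) unfolding D_def by blast
    have "Re (G x x) \<le> Re (bform l 0 T x u x u)" using c[OF _ u, of l] n Re_G[OF C1_on_continuous[OF u]] by simp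
    also have "\<dots> = Re (form l x x)" using form_zero_ends[OF u, of l] Dirichlet_zero_ends[OF d xD(1)] by simp
    also have "\<dots> = 0" using eig_form[OF xD(2,1)] by simp
    finally show False using G_pos[OF xD(1) x0] by simp
  qed
  then show ?thesis by blast
qed

text \<open>Guarantees that the counting sets are nonempty. The span of \<open>k\<close> bumps with
  disjoint supports has nonpositive energy for large \<mu>, so the variational count yields total
  multiplicity at least \<open>k\<close>.\<close>

lemma Dirichlet_infinitely_many: "\<exists>F. finite F \<and> k \<le> (\<Sum>l\<in>F. eig_mult T P Q R Dirichlet l)"
proof (cases "k = 0")
  case True
  then show ?thesis by (intro exI[of _ "{}"]) auto
next
  case False
  obtain d0 dT where d: "lagrangian T P Q R Dirichlet d0 dT" using lagrangian_exists[OF Dirichlet_max_isotropic] by blast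
  interpret lagrangian T P Q R Dirichlet d0 dT by (rule d)
  define a where "a i = T * real i / real k" for i :: nat
  \<comment> \<open>This parabola is positive exactly between \<open>a i\<close> and
    \<open>a (Suc i)\<close>; the square of its positive part is a C^1 bump supported there.\<close>
  define q where "q i t = (t - a i) * (a (Suc i) - t)" for i t
  define v :: "complex^'n" where "v = (\<chi> i. 1)"
  define x where "x i t = (max 0 (q i t))\<^sup>2 *\<^sub>R v" for i t
  define u where "u i t = (2 * max 0 (q i t) * (a i + a (Suc i) - 2 * t)) *\<^sub>R v" for i t
  have v0: "v \<noteq> 0" by (simp add: v_def vec_eq_iff)
  have k0: "real k > 0" using False by simp
  have amono: "a i \<le> a j" if "i \<le> j" for i j
    unfolding a_def using that T k0 by (intro divide_right_mono mult_left_mono) auto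
  have asuc: "a i < a (Suc i)" for i unfolding a_def using T k0 by (intro divide_strict_right_mono) auto
  have xpos: "x i t \<noteq> 0 \<longleftrightarrow> a i < t \<and> t < a (Suc i)" for i t
  proof -
    have "x i t \<noteq> 0 \<longleftrightarrow> 0 < q i t" using v0 by (auto simp: x_def max_def)
    also have "\<dots> \<longleftrightarrow> a i < t \<and> t < a (Suc i)"
      using asuc[of i] by (auto simp: q_def zero_less_mult_iff)
    finally show ?thesis .
  qed
  have C1: "C1_on 0 T (x i) (u i)" for i
    unfolding C1_on_def
  proof (intro conjI ballI)
    show "continuous_on {0..T} (u i)" unfolding u_def q_def by (intro continuous_intros)
    fix t
    have "(q i has_real_derivative (a i + a (Suc i) - 2 * t)) (at t)"
      unfolding q_def[abs_def] by (auto intro!: derivative_eq_intros simp: algebra_simps)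
    from DERIV_chain2[OF DERIV_max0_square[of "q i t"] this]
    have "((\<lambda>t. (max 0 (q i t))\<^sup>2) has_vector_derivative 2 * max 0 (q i t) * (a i + a (Suc i) - 2 * t)) (at t within {0..T})"
      by (simp add: has_real_derivative_iff_has_vector_derivative has_vector_derivative_at_within)
    then show "(x i has_vector_derivative u i t) (at t within {0..T})"
      unfolding x_def[abs_def] u_def
      by (rule bounded_linear.has_vector_derivative[OF bounded_linear_scaleR_left])
  qed
  have xout: "x i t = 0" if "i < k" "\<not> (0 < t \<and> t < T)" for i t
  proof -
    have "0 \<le> a i" "a (Suc i) \<le> T" using amono[of 0 i] amono[of "Suc i" k] that k0 by (simp_all add: a_def)
    then show ?thesis using xpos[of i t] that by auto
  qed
  have xD: "x i \<in> D" if "i < k" for i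
    using C1[of i] xout[OF that] W0 unfolding D_def by auto
  \<comment> \<open>At the midpoint of the \<open>i\<close>-th interval only the \<open>i\<close>-th
    bump is nonzero; evaluation there separates the coefficients of a linear relation.\<close>
  define c where "c i = (a i + a (Suc i)) / 2" for i
  have cx: "x j (c i) = 0 \<longleftrightarrow> j \<noteq> i" for i j
  proof -
    have i: "a i < c i" "c i < a (Suc i)" using asuc[of i] by (auto simp: c_def)
    show ?thesis
    proof (cases "j = i")
      case False
      then have "Suc j \<le> i \<or> Suc i \<le> j" by auto
      then have "a (Suc j) \<le> a i \<or> a (Suc i) \<le> a j" using amono by blast
      then have "x j (c i) = 0" using xpos[of j "c i"] i by force
      then show ?thesis using False by simp
    qed (use xpos[of i "c i"] i in simp)
  qed
  have inj: "inj_on x {..<k}"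
  proof (rule inj_onI)
    fix i j assume "x i = x j"
    then show "i = j" using cx[of i i] cx[of j i] by metis
  qed
  have ind: "cfun.independent (x ` {..<k})"
  proof (rule cfun.independent_if_scalars_zero)
    fix f e assume z: "(\<Sum>e\<in>x ` {..<k}. (\<lambda>t. f e *s e t)) = 0" and "e \<in> x ` {..<k}"
    then obtain i where i: "i < k" "e = x i" by auto
    have "0 = (\<Sum>e\<in>x ` {..<k}. (\<lambda>t. f e *s e t)) (c i)" using z by simp
    also have "\<dots> = (\<Sum>j<k. f (x j) *s x j (c i))"
      unfolding sum_fun_apply by (subst sum.reindex[OF inj]) simp
    also have "\<dots> = (\<Sum>j<k. if j = i then f (x i) *s x i (c i) else 0)"
      using cx by (intro sum.cong) auto
    also have "\<dots> = f e *s x i (c i)" using i by simp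
    finally show "f e = 0" using cx[of i i] by (simp add: vec_eq_iff) blast
  qed simp
  have "\<exists>\<mu>. \<forall>x\<in>cfun.span (x ` {..<k}). Re (form \<mu> x x) \<le> 0"
    using xD by (intro form_bounded_on_span) auto
  then obtain \<mu> where \<mu>: "\<And>y. y \<in> cfun.span (x ` {..<k}) \<Longrightarrow> Re (form \<mu> y y) \<le> 0" by blast
  have "cfun.span (x ` {..<k}) \<subseteq> D" using xD by (intro cfun.span_minimal D_subspace) auto
  from minmax_form[OF ind this \<mu>] show ?thesis unfolding card_image[OF inj] by auto
qed

text \<open>The two counts give \<open>S Dirichlet j \<subseteq> S \<Lambda> j \<subseteq> S
  Dirichlet i\<close>. Infima reverse inclusions, and those of the outer sets agree by
  assumption.\<close>

lemma eigval_eq_Dirichlet: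
  assumes \<Lambda>: "\<Lambda> \<in> layer r" and i: "1 \<le> i" "i + (2 * CARD('n) - r) \<le> j"
    and eq: "eigval T P Q R Dirichlet i = eigval T P Q R Dirichlet j"
  shows "eigval T P Q R \<Lambda> j = eigval T P Q R Dirichlet j"
proof -
  define S where "S = (\<lambda>\<Lambda> k. {\<mu>. \<exists>F. finite F \<and> F \<subseteq> {..\<mu>} \<and> k \<le> (\<Sum>\<nu>\<in>F. eig_mult T P Q R \<Lambda> \<nu>)})"
  have S: "eigval T P Q R \<Lambda> k = Inf (S \<Lambda> k)" for \<Lambda> k by (simp add: eigval_def S_def)
  have iso: "max_isotropic \<Lambda>" using \<Lambda> Lag_max_isotropic by (auto simp: layer_def)
  obtain c where c: "\<And>l. eig_mult T P Q R Dirichlet l > 0 \<Longrightarrow> c < l" using Dirichlet_bounded_below by blast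
  have bdd: "bdd_below (S Dirichlet i)"
  proof (rule bdd_belowI[of _ c])
    fix \<mu> assume "\<mu> \<in> S Dirichlet i"
    then obtain F where F: "F \<subseteq> {..\<mu>}" "i \<le> (\<Sum>\<nu>\<in>F. eig_mult T P Q R Dirichlet \<nu>)" unfolding S_def by blast
    then have "(\<Sum>\<nu>\<in>F. eig_mult T P Q R Dirichlet \<nu>) \<noteq> 0" using i(1) by simp
    then obtain \<nu> where "\<nu> \<in> F" "eig_mult T P Q R Dirichlet \<nu> > 0" by (meson gr0I sum.neutral)
    then show "c \<le> \<mu>" using c[of \<nu>] F(1) by fastforce
  qed
  have ne: "S Dirichlet j \<noteq> {}"
  proof -
    obtain F where F: "finite F" "j \<le> (\<Sum>\<nu>\<in>F. eig_mult T P Q R Dirichlet \<nu>)" using Dirichlet_infinitely_many by blast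
    have "F \<subseteq> {..Max (insert 0 F)}" using F(1) by auto
    then have "Max (insert 0 F) \<in> S Dirichlet j" unfolding S_def using F by blast
    then show ?thesis by blast
  qed
  have sub: "S Dirichlet j \<subseteq> S \<Lambda> j"
  proof
    fix \<mu> assume "\<mu> \<in> S Dirichlet j"
    then obtain F where F: "finite F" "F \<subseteq> {..\<mu>}" "j \<le> (\<Sum>\<nu>\<in>F. eig_mult T P Q R Dirichlet \<nu>)" unfolding S_def by blast
    obtain F' where "finite F'" "F' \<subseteq> {..\<mu>}" "(\<Sum>l\<in>F. eig_mult T P Q R Dirichlet l) \<le> (\<Sum>l\<in>F'. eig_mult T P Q R \<Lambda> l)"
      using count_Dirichlet_le[OF iso F(1,2)] by blast
    then show "\<mu> \<in> S \<Lambda> j" unfolding S_def using F(3) order_trans by blast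
  qed
  have sub': "S \<Lambda> j \<subseteq> S Dirichlet i"
  proof
    fix \<mu> assume "\<mu> \<in> S \<Lambda> j"
    then obtain F where F: "finite F" "F \<subseteq> {..\<mu>}" "j \<le> (\<Sum>\<nu>\<in>F. eig_mult T P Q R \<Lambda> \<nu>)" unfolding S_def by blast
    obtain F' where F': "finite F'" "F' \<subseteq> {..\<mu>}"
      "(\<Sum>l\<in>F. eig_mult T P Q R \<Lambda> l) \<le> (\<Sum>l\<in>F'. eig_mult T P Q R Dirichlet l) + (2 * CARD('n) - r)"
      using count_le_Dirichlet[OF \<Lambda> F(1,2)] by blast
    have "i \<le> (\<Sum>l\<in>F'. eig_mult T P Q R Dirichlet l)" using F(3) F'(3) i(2) by linarith
    then show "\<mu> \<in> S Dirichlet i" unfolding S_def using F' by blast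
  qed
  \<comment> \<open>The counting set of \<Lambda> is nonempty by the first inclusion and bounded
    below by the second.\<close>
  have "Inf (S Dirichlet i) \<le> Inf (S \<Lambda> j)"
    using ne sub sub' bdd by (intro cInf_superset_mono) auto
  moreover have "Inf (S \<Lambda> j) \<le> Inf (S Dirichlet j)"
    using ne sub sub' bdd by (intro cInf_superset_mono bdd_below_mono[OF bdd sub']) auto
  ultimately show ?thesis using eq by (simp add: S)
qed

end

theorem corollary1p6:
  fixes T :: real
    and P Q R :: "real \<Rightarrow> real^'n^'n"
    and r\<^sub>0 j\<^sub>0 :: nat
  assumes "T > 0"
    and "H1_on T P" and "H1_on T Q" and "continuous_on {0..T} R"
    and "\<forall>t\<in>{0..T}. transpose (P t) = P t"
    and "\<forall>t\<in>{0..T}. transpose (R t) = R t"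
    and "\<forall>t\<in>{0..T}. \<forall>v. v \<noteq> 0 \<longrightarrow> v \<bullet> (P t *v v) > 0"
    and "1 \<le> r\<^sub>0" and "r\<^sub>0 \<le> CARD('n)" and "r\<^sub>0 \<le> j\<^sub>0"
    and "\<forall>i\<in>{j\<^sub>0 - (r\<^sub>0 - 1)..j\<^sub>0}. eigval T P Q R Dirichlet i = eigval T P Q R Dirichlet j\<^sub>0"
    and "eig_mult T P Q R Dirichlet (eigval T P Q R Dirichlet j\<^sub>0) = r\<^sub>0"
  shows "\<forall>r. 2 * CARD('n) - r\<^sub>0 + 1 \<le> r \<and> r \<le> 2 * CARD('n) \<longrightarrow>
           (\<forall>\<Lambda>\<in>layer r. eigval T P Q R \<Lambda> j\<^sub>0 = eigval T P Q R Dirichlet j\<^sub>0)"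
proof (intro allI impI ballI)
  interpret sturm_liouville_H1 T P Q R
  proof
    show "0 < T" "continuous_on {0..T} R" "H1_on T P" "H1_on T Q" by fact+
    show "continuous_on {0..T} P" "continuous_on {0..T} Q"
      using assms(1-3) by (auto intro: H1_on_continuous)
    show "transpose (P t) = P t" "transpose (R t) = R t" if "t \<in> {0..T}" for t
      using assms(5,6) that by blast+
    show "v \<bullet> (P t *v v) > 0" if "t \<in> {0..T}" "v \<noteq> 0" for t v
      using assms(7) that by blast
  qed
  fix r and \<Lambda> :: "'n bspace set"
  assume r: "2 * CARD('n) - r\<^sub>0 + 1 \<le> r \<and> r \<le> 2 * CARD('n)" and \<Lambda>: "\<Lambda> \<in> layer r"
  show "eigval T P Q R \<Lambda> j\<^sub>0 = eigval T P Q R Dirichlet j\<^sub>0"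
  \<comment> \<open>The index \<open>i\<close> is that of the first member of the cluster of equal
    Dirichlet eigenvalues. It lies \<open>r\<^sub>0 - 1\<close> below \<open>j\<^sub>0\<close>, and
    the lower bound on \<open>r\<close> says exactly that 2n - r is at most this distance.\<close>
  proof (rule eigval_eq_Dirichlet[OF \<Lambda>])
    show "1 \<le> j\<^sub>0 - (r\<^sub>0 - 1)" using assms(8,10) by linarith
    show "j\<^sub>0 - (r\<^sub>0 - 1) + (2 * CARD('n) - r) \<le> j\<^sub>0" using assms(8-10) r by linarith
    show "eigval T P Q R Dirichlet (j\<^sub>0 - (r\<^sub>0 - 1)) = eigval T P Q R Dirichlet j\<^sub>0"
      by (rule bspec[OF assms(11)]) simp
  qed
qed

end
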